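(* Let $M$ be a closed connected smooth manifold of dimension $n\geqslant 2$. (i) If $\pi_1(M)$ is a finite group (e.g. $M$ is simply connected), then for every $C^1$-function $f\colon M\to\mathbb{R}$ with isolated critical points the Reeb graph $\mathcal{R}(f)$ is a tree. (ii) If $\pi_1(M)$ is an abelian group or, more generally, a discrete amenable group, then for every $C^1$-function $f\colon M\to\mathbb{R}$ with isolated critical points the Reeb graph $\mathcal{R}(f)$ contains at most one loop.
   Context: "Smooth" means (at least) $C^1$. The Reeb graph of $f$ is the quotient $\mathcal{R}(f)=M/\!\sim$, where $x\sim y$ iff $x,y$ lie in the same connected component of a level set $f^{-1}(c)$; it is (homeomorphic to) a finite graph whose vertices are the classes of critical points of $f$. A tree is a finite contractible graph. The number of loops of a connected finite graph is the rank $r$ of its (free) fundamental group $\mathbb{F}_r$, i.e. its first Betti number. *)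

theory Defs
  imports "HOL-Analysis.Analysis" "HOL-Algebra.Generated_Groups"
begin

section \<open>Closed manifolds, functions of class C1, critical points\<close>

text \<open>Only meant for open sets \<open>S\<close>; \<open>f'\<close> is the total derivative, continuous in the operator norm.\<close>

definition C1_on :: "'e::real_normed_vector set \<Rightarrow> ('e \<Rightarrow> 'f::real_normed_vector) \<Rightarrow> bool" where
  "C1_on S f \<longleftrightarrow>
     (\<exists>f' :: 'e \<Rightarrow> 'e \<Rightarrow>\<^sub>L 'f.
        (\<forall>x\<in>S. (f has_derivative blinfun_apply (f' x)) (at x)) \<and> continuous_on S f')"

text \<open>A chart is a pair \<open>(U, \<phi>)\<close> of its domain and the coordinate map; the values of \<open>\<phi>\<close> outside
  \<open>U\<close> are irrelevant, and \<open>inv_into U \<phi>\<close> is the local parametrisation.\<close>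

definition is_chart :: "'a topology \<Rightarrow> 'a set \<times> ('a \<Rightarrow> real^'n) \<Rightarrow> bool" where
  "is_chart M = (\<lambda>(U, \<phi>). openin M U \<and> open (\<phi> ` U) \<and>
     homeomorphic_map (subtopology M U) (top_of_set (\<phi> ` U)) \<phi>)"

definition C1_atlas :: "'a topology \<Rightarrow> ('a set \<times> ('a \<Rightarrow> real^'n)) set \<Rightarrow> bool" where
  "C1_atlas M A \<longleftrightarrow>
     (\<forall>c\<in>A. is_chart M c) \<and>
     topspace M = (\<Union>(U, \<phi>)\<in>A. U) \<and>
     (\<forall>(U, \<phi>)\<in>A. \<forall>(V, \<psi>)\<in>A. C1_on (\<phi> ` (U \<inter> V)) (\<psi> \<circ> inv_into U \<phi>))"

text \<open>Closed means compact without boundary: charts are onto open sets of the whole Euclidean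
  space. Second countability follows from compactness. A manifold of class \<open>C\<^sup>k\<close> with
  \<open>1 \<le> k \<le> \<infinity>\<close> is in particular one of class \<open>C\<^sup>1\<close> with the same atlas, so
  this covers every degree of smoothness.\<close>

definition closed_manifold :: "'a topology \<Rightarrow> ('a set \<times> ('a \<Rightarrow> real^'n)) set \<Rightarrow> bool" where
  "closed_manifold M A \<longleftrightarrow> compact_space M \<and> Hausdorff_space M \<and> C1_atlas M A"

definition C1_function ::
    "('a set \<times> ('a \<Rightarrow> real^'n)) set \<Rightarrow> ('a \<Rightarrow> real) \<Rightarrow> bool" where
  "C1_function A f \<longleftrightarrow> (\<forall>(U, \<phi>)\<in>A. C1_on (\<phi> ` U) (f \<circ> inv_into U \<phi>))"

text \<open>For \<open>f\<close> of class \<open>C\<^sup>1\<close> the choice of the chart around \<open>x\<close> does not matter.\<close>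

definition critical_points ::
    "('a set \<times> ('a \<Rightarrow> real^'n)) set \<Rightarrow> ('a \<Rightarrow> real) \<Rightarrow> 'a set" where
  "critical_points A f =
     {x. \<exists>(U, \<phi>)\<in>A. x \<in> U \<and> ((f \<circ> inv_into U \<phi>) has_derivative (\<lambda>_. 0)) (at (\<phi> x))}"

definition isolated_critical_points ::
    "'a topology \<Rightarrow> ('a set \<times> ('a \<Rightarrow> real^'n)) set \<Rightarrow> ('a \<Rightarrow> real) \<Rightarrow> bool" where
  "isolated_critical_points M A f \<longleftrightarrow>
     (\<forall>x\<in>critical_points A f. \<exists>W. openin M W \<and> x \<in> W \<and> W \<inter> critical_points A f = {x})"


section \<open>The Reeb graph\<close>

definition quotient_topology :: "'a topology \<Rightarrow> ('a \<times> 'a) set \<Rightarrow> 'a set topology" where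
  "quotient_topology X r = topology (\<lambda>\<U>. \<U> \<subseteq> topspace X // r \<and> openin X {x \<in> topspace X. r `` {x} \<in> \<U>})"

lemma openin_quotient_topology:
  "openin (quotient_topology X r) \<U> \<longleftrightarrow>
     \<U> \<subseteq> topspace X // r \<and> openin X {x \<in> topspace X. r `` {x} \<in> \<U>}"
proof -
  have "istopology (\<lambda>\<U>. \<U> \<subseteq> topspace X // r \<and> openin X {x \<in> topspace X. r `` {x} \<in> \<U>})"
    unfolding istopology_def
  proof (intro conjI allI impI)
    fix S T
    assume *: "S \<subseteq> topspace X // r \<and> openin X {x \<in> topspace X. r `` {x} \<in> S}"
      "T \<subseteq> topspace X // r \<and> openin X {x \<in> topspace X. r `` {x} \<in> T}"
    then show "S \<inter> T \<subseteq> topspace X // r" by blast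
    have "{x \<in> topspace X. r `` {x} \<in> S \<inter> T} =
        {x \<in> topspace X. r `` {x} \<in> S} \<inter> {x \<in> topspace X. r `` {x} \<in> T}" by blast
    with * show "openin X {x \<in> topspace X. r `` {x} \<in> S \<inter> T}" by auto
  next
    fix K
    assume *: "\<forall>S\<in>K. S \<subseteq> topspace X // r \<and> openin X {x \<in> topspace X. r `` {x} \<in> S}"
    then show "\<Union>K \<subseteq> topspace X // r" by blast
    have "{x \<in> topspace X. r `` {x} \<in> \<Union>K} = (\<Union>S\<in>K. {x \<in> topspace X. r `` {x} \<in> S})" by blast
    with * show "openin X {x \<in> topspace X. r `` {x} \<in> \<Union>K}" by auto
  qed
  then show ?thesis by (simp add: quotient_topology_def)
qed

lemma topspace_quotient_topology: "topspace (quotient_topology X r) = topspace X // r"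
proof
  show "topspace (quotient_topology X r) \<subseteq> topspace X // r"
    using openin_quotient_topology openin_topspace by blast
  have "{x \<in> topspace X. r `` {x} \<in> topspace X // r} = topspace X"
    by (auto intro: quotientI)
  then show "topspace X // r \<subseteq> topspace (quotient_topology X r)"
    by (intro openin_subset) (simp add: openin_quotient_topology)
qed

lemma quotient_map_quotient_topology:
  "quotient_map X (quotient_topology X r) (\<lambda>x. r `` {x})"
  by (auto simp: quotient_map_def openin_quotient_topology topspace_quotient_topology
      quotient_def)

definition reeb_relation :: "'a topology \<Rightarrow> ('a \<Rightarrow> real) \<Rightarrow> ('a \<times> 'a) set" where
  "reeb_relation M f =
     {(x, y). \<exists>c. connected_component_of (subtopology M {z \<in> topspace M. f z = c}) x y}"

definition reeb_graph :: "'a topology \<Rightarrow> ('a \<Rightarrow> real) \<Rightarrow> 'a set topology" where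
  "reeb_graph M f = quotient_topology M (reeb_relation M f)"


section \<open>The fundamental group\<close>

text \<open>Loops are total functions on the reals of which only the restriction to \<open>[0, 1]\<close> matters:
  the relation below identifies any two functions that agree there. The library operation
  \<open>joinpaths\<close> is available for type class topologies only.\<close>

definition loop_homotopy :: "'a topology \<Rightarrow> 'a \<Rightarrow> ((real \<Rightarrow> 'a) \<times> (real \<Rightarrow> 'a)) set" where
  "loop_homotopy X x =
     {(p, q). homotopic_with (\<lambda>l. l 0 = x \<and> l 1 = x) (top_of_set {0..1}) X p q}"

definition join_loops :: "(real \<Rightarrow> 'a) \<Rightarrow> (real \<Rightarrow> 'a) \<Rightarrow> real \<Rightarrow> 'a" where
  "join_loops p q = (\<lambda>t. if t \<le> 1/2 then p (2 * t) else q (2 * t - 1))"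

definition fundamental_group :: "'a topology \<Rightarrow> 'a \<Rightarrow> (real \<Rightarrow> 'a) set monoid" where
  "fundamental_group X x =
     \<lparr>carrier = {p. pathin X p \<and> p 0 = x \<and> p 1 = x} // loop_homotopy X x,
      mult = (\<lambda>P Q. \<Union>p\<in>P. \<Union>q\<in>Q. loop_homotopy X x `` {join_loops p q}),
      one = loop_homotopy X x `` {\<lambda>_. x}\<rparr>"


section \<open>Free and amenable groups\<close>

text \<open>A letter \<open>(s, True)\<close> stands for the generator \<open>s\<close>, a letter \<open>(s, False)\<close> for its inverse.\<close>

definition eval_word :: "('g, 'm) monoid_scheme \<Rightarrow> ('g \<times> bool) list \<Rightarrow> 'g" where
  "eval_word G w = foldr (\<lambda>(s, b) g. (if b then s else inv\<^bsub>G\<^esub> s) \<otimes>\<^bsub>G\<^esub> g) w \<one>\<^bsub>G\<^esub>"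

definition reduced_word :: "('g \<times> bool) list \<Rightarrow> bool" where
  "reduced_word w \<longleftrightarrow> successively (\<lambda>(s, b) (t, c). \<not> (s = t \<and> b \<noteq> c)) w"

definition free_basis :: "('g, 'm) monoid_scheme \<Rightarrow> 'g set \<Rightarrow> bool" where
  "free_basis G S \<longleftrightarrow> S \<subseteq> carrier G \<and> generate G S = carrier G \<and>
     (\<forall>w. set w \<subseteq> S \<times> UNIV \<and> reduced_word w \<and> w \<noteq> [] \<longrightarrow> eval_word G w \<noteq> \<one>\<^bsub>G\<^esub>)"

definition free_group_of_rank :: "('g, 'm) monoid_scheme \<Rightarrow> nat \<Rightarrow> bool" where
  "free_group_of_rank G r \<longleftrightarrow> group G \<and> (\<exists>S. finite S \<and> card S = r \<and> free_basis G S)"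

text \<open>Amenability as a discrete group: there is a finitely additive, left-invariant probability
  measure on all subsets.\<close>

definition amenable_group :: "('g, 'm) monoid_scheme \<Rightarrow> bool" where
  "amenable_group G \<longleftrightarrow> group G \<and>
     (\<exists>\<mu> :: 'g set \<Rightarrow> real.
        (\<forall>B\<subseteq>carrier G. 0 \<le> \<mu> B) \<and>
        \<mu> (carrier G) = 1 \<and>
        (\<forall>B\<subseteq>carrier G. \<forall>C\<subseteq>carrier G. B \<inter> C = {} \<longrightarrow> \<mu> (B \<union> C) = \<mu> B + \<mu> C) \<and>
        (\<forall>g\<in>carrier G. \<forall>B\<subseteq>carrier G. \<mu> (g <#\<^bsub>G\<^esub> B) = \<mu> B))"


section \<open>Finite graphs, trees, number of loops\<close>

text \<open>A finite graph as a topological space (loops and multiple edges allowed), that is, a finite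
  CW complex of dimension at most one: \<open>V\<close> is the set of vertices and \<open>E\<close> consists of
  characteristic maps of the edges. As the space is Hausdorff and there are finitely many cells,
  it automatically carries the weak topology, and each open edge is homeomorphic to an open
  interval.\<close>

definition finite_graph :: "'a topology \<Rightarrow> bool" where
  "finite_graph X \<longleftrightarrow> Hausdorff_space X \<and>
     (\<exists>V E. finite V \<and> V \<subseteq> topspace X \<and> finite E \<and>
        (\<forall>e\<in>E. pathin X e \<and> e 0 \<in> V \<and> e 1 \<in> V \<and>
               inj_on e {0<..<1} \<and> e ` {0<..<1} \<inter> V = {}) \<and>
        pairwise (\<lambda>e e'. disjnt (e ` {0<..<1}) (e' ` {0<..<1})) E \<and>
        topspace X = V \<union> (\<Union>e\<in>E. e ` {0<..<1}))"

definition is_tree :: "'a topology \<Rightarrow> bool" where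
  "is_tree X \<longleftrightarrow> finite_graph X \<and> contractible_space X"

text \<open>\<open>has_number_of_loops X r\<close>: \<open>X\<close> is a connected finite graph whose number of loops is \<open>r\<close>.\<close>

definition has_number_of_loops :: "'a topology \<Rightarrow> nat \<Rightarrow> bool" where
  "has_number_of_loops X r \<longleftrightarrow> finite_graph X \<and> connected_space X \<and>
     (\<forall>y\<in>topspace X. free_group_of_rank (fundamental_group X y) r)"

end

theory Submission
  imports Defs
begin

text \<open>
The quotient map from \<open>M\<close> onto the Reeb graph has connected fibres. Hence a cycle in the graph is
visible in \<open>M\<close>: if the graph stays connected after an open edge is removed, then the preimage of the
edge is a handle attached to a connected open rest, and some loop in \<open>M\<close> runs once through the handle.
The proof turns this into permutation actions of \<open>\<pi>\<^sub>1(M)\<close>. A path acts by a prescribed permutation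
whenever it crosses a chosen handle and trivially elsewhere; this is the monodromy of a covering that is
trivial over the handles and over the rest (\<open>monodromy\<close>, \<open>band_monodromy\<close>). One handle can act on
the integers by the shift, so \<open>\<pi>\<^sub>1(M)\<close> is infinite (\<open>infinite_if_cycle\<close>). Two handles that can be removed
together act by two arbitrary permutations; if these play ping-pong, then \<open>\<pi>\<^sub>1(M)\<close> is neither commutative
nor amenable (\<open>ping_pong_not_commutative\<close>, \<open>ping_pong_not_amenable\<close>). These actions stand in for a
homomorphism from \<open>\<pi>\<^sub>1(M)\<close> onto the free fundamental group of the graph.

On the side of graphs there are three cases (\<open>bridge_trichotomy\<close>). If all edges are bridges, the
graph contracts to each of its points with that point fixed, so it is a tree and all its fundamental
groups are trivial. If some edge is no bridge but its removal leaves only bridges, the graph is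
homotopic to a circle and its fundamental group at a vertex is infinite cyclic
(\<open>unicyclic_fundamental_group\<close>). Otherwise two edges can be removed together. The hypotheses on
\<open>\<pi>\<^sub>1(M)\<close> exclude the last two cases, or the last one. As any point of the Reeb graph can be declared
a vertex, the fundamental group is found at every base point without changing base points.

It remains to see that the Reeb graph is a finite graph at all (\<open>reeb_arc_graph\<close>). Near a regular point
the inverse function theorem makes the level sets of \<open>f\<close> connected slices of a small box. A component
of a level set without critical points is covered by finitely many such boxes, which chain up on all
nearby levels too; so the height that \<open>f\<close> induces on the quotient is locally injective and open away from the
finitely many images of critical points (\<open>height_locally_injective\<close>). A compact Hausdorff space with
such a height is a finite graph (\<open>arc_graph_exists\<close>): the largest connected open sets on which the
height is injective are the edges, they converge to vertices at both ends, and compactness of level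
sets bounds their number.
\<close>


section \<open>The fundamental group\<close>

definition loops_at :: "'a topology \<Rightarrow> 'a \<Rightarrow> (real \<Rightarrow> 'a) set" where
  "loops_at X x = {p. pathin X p \<and> p 0 = x \<and> p 1 = x}"

definition loop_class :: "'a topology \<Rightarrow> 'a \<Rightarrow> (real \<Rightarrow> 'a) \<Rightarrow> (real \<Rightarrow> 'a) set" where
  "loop_class X x p = loop_homotopy X x `` {p}"

lemma prod_top_of_set:
  "prod_topology (top_of_set S) (top_of_set T) = top_of_set (S \<times> T)"
  using subtopology_Times[of euclidean euclidean S T] by (simp add: euclidean_product_topology)

lemma continuous_map_compose_on:
  assumes "continuous_map (top_of_set D) X F" "continuous_on T g" "g ` T \<subseteq> D"
  shows "continuous_map (top_of_set T) X (\<lambda>z. F (g z))"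
proof -
  have "continuous_map (top_of_set T) (top_of_set D) g"
    using assms(2,3) by (auto simp: continuous_map_in_subtopology)
  from continuous_map_compose[OF this assms(1)] show ?thesis
    by (simp add: o_def)
qed

text \<open>The source of every reparametrisation homotopy below: in a convex domain the straight-line
  homotopy joins two paths with the same ends, and \<open>F\<close> carries it to \<open>X\<close>.\<close>

lemma loop_homotopy_convex:
  fixes \<alpha> \<beta> :: "real \<Rightarrow> 'd::real_normed_vector"
  assumes D: "convex D"
    and F: "continuous_map (top_of_set D) X F"
    and a: "continuous_on {0..1} \<alpha>" "\<alpha> ` {0..1} \<subseteq> D"
    and b: "continuous_on {0..1} \<beta>" "\<beta> ` {0..1} \<subseteq> D"
    and ends: "\<alpha> 0 = \<beta> 0" "\<alpha> 1 = \<beta> 1" "F (\<alpha> 0) = x" "F (\<alpha> 1) = x"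
  shows "(\<lambda>t. F (\<alpha> t), \<lambda>t. F (\<beta> t)) \<in> loop_homotopy X x"
proof -
  define h where "h = (\<lambda>(s,t). (1 - s) *\<^sub>R \<alpha> t + s *\<^sub>R \<beta> t)"
  have "continuous_on ({0..1} \<times> {0..1}) h"
    unfolding h_def split_def
    by (intro continuous_intros continuous_on_compose2[OF a(1)] continuous_on_compose2[OF b(1)]) auto
  moreover have "h ` ({0..1} \<times> {0..1}) \<subseteq> D"
    unfolding h_def using D a(2) b(2) by (auto simp: convex_alt image_subset_iff)
  ultimately have "continuous_map (top_of_set ({0..1} \<times> {0..1})) (top_of_set D) h"
    by (auto simp: continuous_map_in_subtopology)
  from continuous_map_compose[OF this F]
  have "continuous_map (prod_topology (top_of_set {0..1}) (top_of_set {0..1})) X (F \<circ> h)"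
    by (simp add: prod_top_of_set)
  then show ?thesis
    unfolding loop_homotopy_def homotopic_with_def mem_Collect_eq prod.case
    by (intro exI[of _ "F \<circ> h"] conjI) (use ends in \<open>auto simp: h_def algebra_simps simp flip: scaleR_add_left\<close>)
qed

lemma loop_homotopy_loops:
  "(p, q) \<in> loop_homotopy X x \<Longrightarrow> p \<in> loops_at X x \<and> q \<in> loops_at X x"
  unfolding loop_homotopy_def loops_at_def pathin_def
  by (auto dest: homotopic_with_imp_continuous_maps homotopic_with_imp_property)

lemma loop_homotopy_refl: "p \<in> loops_at X x \<Longrightarrow> (p, p) \<in> loop_homotopy X x"
  unfolding loop_homotopy_def loops_at_def pathin_def by simp

lemma loop_homotopy_sym: "(p, q) \<in> loop_homotopy X x \<Longrightarrow> (q, p) \<in> loop_homotopy X x"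
  unfolding loop_homotopy_def by (auto simp: homotopic_with_sym)

lemma loop_homotopy_trans:
  "(p, q) \<in> loop_homotopy X x \<Longrightarrow> (q, r) \<in> loop_homotopy X x \<Longrightarrow> (p, r) \<in> loop_homotopy X x"
  unfolding loop_homotopy_def by (auto intro: homotopic_with_trans)

lemma loop_class_eq_iff:
  assumes "p \<in> loops_at X x"
  shows "loop_class X x p = loop_class X x q \<longleftrightarrow> (p, q) \<in> loop_homotopy X x"
proof
  assume "loop_class X x p = loop_class X x q"
  moreover have "p \<in> loop_class X x p"
    by (simp add: assms loop_class_def loop_homotopy_refl)
  ultimately show "(p, q) \<in> loop_homotopy X x"
    by (auto simp: loop_class_def intro: loop_homotopy_sym)
qed (auto simp: loop_class_def intro: loop_homotopy_sym loop_homotopy_trans)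

lemma pathin_join_loops:
  assumes "pathin X p" "pathin X q" "p 1 = q 0"
  shows "pathin X (join_loops p q)"
  unfolding pathin_def join_loops_def
proof (rule continuous_map_cases_le)
  show "continuous_map (subtopology (top_of_set {0..1}) {x \<in> topspace (top_of_set {0..1}). x \<le> 1 / 2}) X (\<lambda>x. p (2 * x))"
    unfolding subtopology_subtopology using assms(1) unfolding pathin_def
    by (rule continuous_map_compose_on) (auto intro!: continuous_intros)
  show "continuous_map (subtopology (top_of_set {0..1}) {x \<in> topspace (top_of_set {0..1}). 1 / 2 \<le> x}) X (\<lambda>x. q (2 * x - 1))"
    unfolding subtopology_subtopology using assms(2) unfolding pathin_def
    by (rule continuous_map_compose_on) (auto intro!: continuous_intros)
  fix t :: real assume "t = 1/2"
  then have "2 * t = 1" by simp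
  then show "p (2 * t) = q (2 * t - 1)" using assms by simp
qed (auto intro!: continuous_intros)

lemma join_loops_in: "p \<in> loops_at X x \<Longrightarrow> q \<in> loops_at X x \<Longrightarrow> join_loops p q \<in> loops_at X x"
  using pathin_join_loops[of X p q] by (auto simp: loops_at_def join_loops_def)

lemma loop_homotopy_join:
  assumes "(p, p') \<in> loop_homotopy X x" "(q, q') \<in> loop_homotopy X x"
  shows "(join_loops p q, join_loops p' q') \<in> loop_homotopy X x"
proof -
  let ?I = "top_of_set {0..1::real}"
  obtain h where h: "continuous_map (prod_topology ?I ?I) X h" "\<And>t. h (0, t) = p t" "\<And>t. h (1, t) = p' t"
      "\<And>s. s \<in> {0..1} \<Longrightarrow> h (s, 0) = x \<and> h (s, 1) = x"
    using assms(1) unfolding loop_homotopy_def homotopic_with_def by auto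
  obtain k where k: "continuous_map (prod_topology ?I ?I) X k" "\<And>t. k (0, t) = q t" "\<And>t. k (1, t) = q' t"
      "\<And>s. s \<in> {0..1} \<Longrightarrow> k (s, 0) = x \<and> k (s, 1) = x"
    using assms(2) unfolding loop_homotopy_def homotopic_with_def by auto
  let ?S = "{0..1::real} \<times> {0..1::real}"
  have S: "prod_topology ?I ?I = top_of_set ?S" by (simp add: prod_top_of_set)
  have "continuous_map (top_of_set ?S) X (\<lambda>z. if snd z \<le> 1/2 then h (fst z, 2 * snd z) else k (fst z, 2 * snd z - 1))"
  proof (rule continuous_map_cases_le)
    show "continuous_map (subtopology (top_of_set ?S) {z \<in> topspace (top_of_set ?S). snd z \<le> 1 / 2}) X (\<lambda>z. h (fst z, 2 * snd z))"
      unfolding subtopology_subtopology using h(1) unfolding S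
      by (rule continuous_map_compose_on) (auto intro!: continuous_intros)
    show "continuous_map (subtopology (top_of_set ?S) {z \<in> topspace (top_of_set ?S). 1 / 2 \<le> snd z}) X (\<lambda>z. k (fst z, 2 * snd z - 1))"
      unfolding subtopology_subtopology using k(1) unfolding S
      by (rule continuous_map_compose_on) (auto intro!: continuous_intros)
    fix z :: "real \<times> real" assume "z \<in> topspace (top_of_set ?S)" "snd z = 1/2"
    then have "2 * snd z = 1" "fst z \<in> {0..1}" by auto
    then show "h (fst z, 2 * snd z) = k (fst z, 2 * snd z - 1)" using h(4) k(4) by simp
  qed (auto intro!: continuous_intros)
  then show ?thesis
    unfolding loop_homotopy_def homotopic_with_def mem_Collect_eq prod.case S[symmetric]
    by (intro exI[of _ "\<lambda>z. if snd z \<le> 1/2 then h (fst z, 2 * snd z) else k (fst z, 2 * snd z - 1)"] conjI) (use h k in \<open>auto simp: join_loops_def\<close>)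
qed

lemma carrier_fundamental_group:
  "carrier (fundamental_group X x) = loop_class X x ` loops_at X x"
  by (auto simp: fundamental_group_def quotient_def loop_class_def loops_at_def)

lemma one_fundamental_group: "\<one>\<^bsub>fundamental_group X x\<^esub> = loop_class X x (\<lambda>_. x)"
  by (simp add: fundamental_group_def loop_class_def)

lemma mult_fundamental_group:
  assumes "p \<in> loops_at X x" "q \<in> loops_at X x"
  shows "loop_class X x p \<otimes>\<^bsub>fundamental_group X x\<^esub> loop_class X x q = loop_class X x (join_loops p q)"
proof -
  have "loop_homotopy X x `` {join_loops p' q'} = loop_class X x (join_loops p q)"
    if "p' \<in> loop_class X x p" "q' \<in> loop_class X x q" for p' q'
    using loop_homotopy_join[of p p' X x q q'] that loop_class_eq_iff[OF join_loops_in[OF assms]]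
    by (auto simp: loop_class_def)
  moreover have "p \<in> loop_class X x p" "q \<in> loop_class X x q"
    using assms by (auto simp: loop_class_def loop_homotopy_refl)
  ultimately have "(\<Union>p'\<in>loop_class X x p. \<Union>q'\<in>loop_class X x q. loop_homotopy X x `` {join_loops p' q'})
     = loop_class X x (join_loops p q)" by blast
  then show ?thesis by (simp add: fundamental_group_def)
qed

lemma const_loop: "x \<in> topspace X \<Longrightarrow> (\<lambda>_. x) \<in> loops_at X x"
  by (simp add: loops_at_def pathin_def)

lemma reverse_loop: "p \<in> loops_at X x \<Longrightarrow> (\<lambda>t. p (1 - t)) \<in> loops_at X x"
  using continuous_map_compose_on[of "{0..1}" X p "{0..1}" "\<lambda>t. 1 - t"]
  by (simp add: loops_at_def pathin_def continuous_on_diff image_subset_iff)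

lemma loop_homotopy_reparam:
  fixes \<alpha> \<beta> :: "real \<Rightarrow> real"
  assumes "pathin X F"
    and "continuous_on {0..1} \<alpha>" "\<alpha> ` {0..1} \<subseteq> {0..1}"
    and "continuous_on {0..1} \<beta>" "\<beta> ` {0..1} \<subseteq> {0..1}"
    and "\<alpha> 0 = \<beta> 0" "\<alpha> 1 = \<beta> 1" "F (\<alpha> 0) = x" "F (\<alpha> 1) = x"
  shows "(\<lambda>t. F (\<alpha> t), \<lambda>t. F (\<beta> t)) \<in> loop_homotopy X x"
  using assms by (intro loop_homotopy_convex[of "{0..1}"]) (auto simp: pathin_def)

lemma continuous_on_if_le:
  fixes f g :: "real \<Rightarrow> real"
  assumes "continuous_on UNIV f" "continuous_on UNIV g" "f c = g c"
  shows "continuous_on S (\<lambda>t. if t \<le> c then f t else g t)"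
  by (rule continuous_on_subset[OF continuous_on_cases_le[of UNIV id c f g, simplified]])
     (use assms in \<open>auto intro: continuous_on_subset\<close>)

text \<open>The group axioms compare products of loops that trace one and the same path at different
  speeds, so each of them is an instance of the straight-line homotopy of parameters. For an inverse
  the parameter runs from \<open>1\<close> to \<open>0\<close> and back, which contracts to the constant \<open>1\<close>.\<close>

theorem group_fundamental_group:
  assumes x: "x \<in> topspace X"
  shows "group (fundamental_group X x)"
proof (rule groupI)
  let ?G = "fundamental_group X x"
  show "P \<otimes>\<^bsub>?G\<^esub> Q \<in> carrier ?G" if "P \<in> carrier ?G" "Q \<in> carrier ?G" for P Q
    using that by (auto simp: carrier_fundamental_group mult_fundamental_group join_loops_in)
  show "\<one>\<^bsub>?G\<^esub> \<in> carrier ?G"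
    using x by (simp add: carrier_fundamental_group one_fundamental_group const_loop)
  show "P \<otimes>\<^bsub>?G\<^esub> Q \<otimes>\<^bsub>?G\<^esub> R = P \<otimes>\<^bsub>?G\<^esub> (Q \<otimes>\<^bsub>?G\<^esub> R)"
    if PQR: "P \<in> carrier ?G" "Q \<in> carrier ?G" "R \<in> carrier ?G" for P Q R
  proof -
    obtain p q r where pqr: "p \<in> loops_at X x" "q \<in> loops_at X x" "r \<in> loops_at X x"
      and eq: "P = loop_class X x p" "Q = loop_class X x q" "R = loop_class X x r"
      using PQR by (auto simp: carrier_fundamental_group)
    define F where "F = join_loops p (join_loops q r)"
    define \<phi> :: "real \<Rightarrow> real" where
      "\<phi> t = (if t \<le> 1/2 then (if t \<le> 1/4 then 2 * t else t + 1/4) else t / 2 + 1 / 2)" for t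
    have F: "F \<in> loops_at X x" unfolding F_def by (intro join_loops_in pqr)
    have eqF: "join_loops (join_loops p q) r = (\<lambda>t. F (\<phi> t))"
      by (rule ext) (auto simp: F_def join_loops_def \<phi>_def algebra_simps)
    have "continuous_on {0..1} \<phi>" unfolding \<phi>_def
    proof (rule continuous_on_if_le)
      show "continuous_on UNIV (\<lambda>t::real. if t \<le> 1/4 then 2 * t else t + 1/4)"
        by (rule continuous_on_if_le) (auto intro!: continuous_intros)
    qed (auto intro!: continuous_intros)
    then have "((\<lambda>t. F (\<phi> t)), (\<lambda>t. F t)) \<in> loop_homotopy X x"
      using F by (intro loop_homotopy_reparam) (auto simp: loops_at_def \<phi>_def)
    then have "(join_loops (join_loops p q) r, F) \<in> loop_homotopy X x" by (simp only: eqF)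
    then show ?thesis
      using pqr loop_class_eq_iff[OF join_loops_in[OF join_loops_in[OF pqr(1,2)] pqr(3)], of F]
      by (simp add: eq mult_fundamental_group join_loops_in F_def)
  qed
  show "\<one>\<^bsub>?G\<^esub> \<otimes>\<^bsub>?G\<^esub> P = P" if P: "P \<in> carrier ?G" for P
  proof -
    obtain p where p: "p \<in> loops_at X x" and eq: "P = loop_class X x p"
      using P by (auto simp: carrier_fundamental_group)
    define \<phi> :: "real \<Rightarrow> real" where "\<phi> t = (if t \<le> 1/2 then 0 else 2 * t - 1)" for t
    have j: "join_loops (\<lambda>_. x) p = (\<lambda>t. p (\<phi> t))"
      using p by (auto simp: join_loops_def \<phi>_def loops_at_def fun_eq_iff)
    have "continuous_on {0..1} \<phi>" unfolding \<phi>_def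
      by (rule continuous_on_if_le) (auto intro!: continuous_intros)
    then have "((\<lambda>t. p (\<phi> t)), (\<lambda>t. p t)) \<in> loop_homotopy X x"
      using p by (intro loop_homotopy_reparam) (auto simp: loops_at_def \<phi>_def)
    then show ?thesis
      using p loop_class_eq_iff[OF join_loops_in[OF const_loop[OF x] p], of p]
      by (simp add: eq one_fundamental_group mult_fundamental_group const_loop[OF x] j)
  qed
  show "\<exists>Q\<in>carrier ?G. Q \<otimes>\<^bsub>?G\<^esub> P = \<one>\<^bsub>?G\<^esub>" if P: "P \<in> carrier ?G" for P
  proof -
    obtain p where p: "p \<in> loops_at X x" and eq: "P = loop_class X x p"
      using P by (auto simp: carrier_fundamental_group)
    define \<phi> :: "real \<Rightarrow> real" where "\<phi> t = (if t \<le> 1/2 then 1 - 2 * t else 2 * t - 1)" for t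
    have j: "join_loops (\<lambda>t. p (1 - t)) p = (\<lambda>t. p (\<phi> t))"
      using p by (auto simp: join_loops_def \<phi>_def loops_at_def fun_eq_iff)
    have "continuous_on {0..1} \<phi>" unfolding \<phi>_def
      by (rule continuous_on_if_le) (auto intro!: continuous_intros)
    then have "((\<lambda>t. p (\<phi> t)), (\<lambda>t. p 1)) \<in> loop_homotopy X x"
      using p by (intro loop_homotopy_reparam[where \<beta> = "\<lambda>_. 1"]) (auto simp: loops_at_def \<phi>_def)
    moreover have "p 1 = x" using p by (simp add: loops_at_def)
    ultimately have "((\<lambda>t. p (\<phi> t)), (\<lambda>t. x)) \<in> loop_homotopy X x" by simp
    then have "loop_class X x (\<lambda>t. p (1 - t)) \<otimes>\<^bsub>?G\<^esub> P = \<one>\<^bsub>?G\<^esub>"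
      using p loop_class_eq_iff[OF join_loops_in[OF reverse_loop[OF p] p]]
      by (simp add: eq one_fundamental_group mult_fundamental_group reverse_loop j)
    then show ?thesis using reverse_loop[OF p] by (auto simp: carrier_fundamental_group)
  qed
qed


section \<open>Monodromy of a locally constant cocycle\<close>

text \<open>A covering of \<open>P \<union> Q\<close> with fibre \<open>'y\<close> that is trivial over \<open>P\<close> and over \<open>Q\<close>, described without its
  total space: on the overlap \<open>c\<close> passes from the coordinates over \<open>Q\<close> to those over \<open>P\<close>. A lift \<open>L\<close>
  of \<open>h\<close> identifies the fibre over each \<open>h z\<close>, in the coordinates over \<open>P\<close>, with one fixed copy of
  \<open>'y\<close>. Such an identification is locally constant when it is read in a trivialisation, which gives the
  last two clauses.\<close>

definition is_lift ::
  "'a set \<Rightarrow> 'a set \<Rightarrow> ('a \<Rightarrow> 'y \<Rightarrow> 'y) \<Rightarrow> 'z::topological_space set \<Rightarrow> ('z \<Rightarrow> 'a) \<Rightarrow> ('z \<Rightarrow> 'y \<Rightarrow> 'y) \<Rightarrow> bool" where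
  "is_lift P Q c Z h L \<longleftrightarrow>
     (\<forall>z\<in>Z. bij (L z)) \<and>
     (\<forall>z\<in>Z. h z \<in> P \<longrightarrow> (\<forall>\<^sub>F w in at z within Z. L w = L z)) \<and>
     (\<forall>z\<in>Z. h z \<in> Q \<longrightarrow> (\<forall>\<^sub>F w in at z within Z. L w \<circ> c (h w) = L z \<circ> c (h z)))"

lemma is_liftD:
  assumes "is_lift P Q c Z h L" "z \<in> Z"
  shows "bij (L z)"
    and "h z \<in> P \<Longrightarrow> \<forall>\<^sub>F w in at z within Z. L w = L z"
    and "h z \<in> Q \<Longrightarrow> \<forall>\<^sub>F w in at z within Z. L w \<circ> c (h w) = L z \<circ> c (h z)"
  using assms unfolding is_lift_def by blast+

lemma eventually_within_compose:
  fixes g :: "'y::topological_space \<Rightarrow> 'z::topological_space"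
  assumes g: "continuous_on Z' g" "g ` Z' \<subseteq> Z" and z: "z \<in> Z'"
    and ev: "\<forall>\<^sub>F w in at (g z) within Z. \<phi> w" and here: "\<phi> (g z)"
  shows "\<forall>\<^sub>F w in at z within Z'. \<phi> (g w)"
proof -
  obtain S where S: "open S" "g z \<in> S" "\<And>w. w \<in> S \<Longrightarrow> w \<noteq> g z \<Longrightarrow> w \<in> Z \<Longrightarrow> \<phi> w"
    using ev by (auto simp: eventually_at_topological)
  obtain T where T: "open T" "z \<in> T" "\<And>w. w \<in> Z' \<Longrightarrow> w \<in> T \<Longrightarrow> g w \<in> S"
    using g(1) z S(1,2) unfolding continuous_on_topological by (metis (no_types, lifting))
  show ?thesis
    unfolding eventually_at_topological using T S here g(2) by (metis image_subset_iff)
qed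

lemma is_lift_compose:
  assumes L: "is_lift P Q c Z h L" and g: "continuous_on Z' g" "g ` Z' \<subseteq> Z"
  shows "is_lift P Q c Z' (\<lambda>w. h (g w)) (\<lambda>w. L (g w))"
  unfolding is_lift_def
proof (intro conjI ballI impI)
  fix z assume z: "z \<in> Z'"
  then have gz: "g z \<in> Z" using g(2) by blast
  show "bij (L (g z))" using L gz by (simp add: is_lift_def)
  show "\<forall>\<^sub>F w in at z within Z'. L (g w) = L (g z)" if "h (g z) \<in> P"
    by (rule eventually_within_compose[OF g z is_liftD(2)[OF L gz that]]) (rule refl)
  show "\<forall>\<^sub>F w in at z within Z'. L (g w) \<circ> c (h (g w)) = L (g z) \<circ> c (h (g z))" if "h (g z) \<in> Q"
    by (rule eventually_within_compose[OF g z is_liftD(3)[OF L gz that]]) (rule refl)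
qed

lemma is_lift_cong:
  assumes L: "is_lift P Q c Z h L" and eq: "\<And>z. z \<in> Z \<Longrightarrow> h z = h' z" "\<And>z. z \<in> Z \<Longrightarrow> L z = L' z"
  shows "is_lift P Q c Z h' L'"
  unfolding is_lift_def
proof (intro conjI ballI impI)
  fix z assume z: "z \<in> Z"
  have Z: "\<forall>\<^sub>F w in at z within Z. w \<in> Z" by (simp add: eventually_at_filter)
  show "bij (L' z)" using L eq z by (auto simp: is_lift_def)
  show "\<forall>\<^sub>F w in at z within Z. L' w = L' z" if "h' z \<in> P"
  proof -
    have "\<forall>\<^sub>F w in at z within Z. L w = L z" using is_liftD(2)[OF L z] eq z that by simp
    then show ?thesis using Z by eventually_elim (use eq z in auto)
  qed
  show "\<forall>\<^sub>F w in at z within Z. L' w \<circ> c (h' w) = L' z \<circ> c (h' z)" if "h' z \<in> Q"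
  proof -
    have "\<forall>\<^sub>F w in at z within Z. L w \<circ> c (h w) = L z \<circ> c (h z)" using is_liftD(3)[OF L z] eq z that by simp
    then show ?thesis using Z by eventually_elim (use eq z in simp)
  qed
qed

lemma is_lift_left_mult:
  assumes L: "is_lift P Q c Z h L" and g: "bij g"
  shows "is_lift P Q c Z h (\<lambda>z. g \<circ> L z)"
  unfolding is_lift_def
proof (intro conjI ballI impI)
  fix z assume z: "z \<in> Z"
  show "bij (g \<circ> L z)" using L g z by (auto simp: is_lift_def intro: bij_comp)
  show "\<forall>\<^sub>F w in at z within Z. g \<circ> L w = g \<circ> L z" if "h z \<in> P"
    using is_liftD(2)[OF L z that] by (rule eventually_mono) simp
  show "\<forall>\<^sub>F w in at z within Z. g \<circ> L w \<circ> c (h w) = g \<circ> L z \<circ> c (h z)" if "h z \<in> Q"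
    using is_liftD(3)[OF L z that] by (rule eventually_mono) (simp only: o_assoc[symmetric])
qed

lemma eventually_within_closed_Un:
  fixes A B :: "'z::t1_space set"
  assumes "closed A" "closed B"
    and "z \<in> A \<Longrightarrow> \<forall>\<^sub>F w in at z within A. \<phi> w" "z \<in> B \<Longrightarrow> \<forall>\<^sub>F w in at z within B. \<phi> w"
  shows "\<forall>\<^sub>F w in at z within (A \<union> B). \<phi> w"
proof -
  have "\<forall>\<^sub>F w in at z within C. \<phi> w" if "closed C" "z \<in> C \<Longrightarrow> \<forall>\<^sub>F w in at z within C. \<phi> w" for C
  proof (cases "z \<in> C")
    case False
    then show ?thesis unfolding eventually_at_topological using \<open>closed C\<close>
      by (intro exI[of _ "- C"]) auto
  qed (use that in auto)
  from this[OF assms(1,3)] this[OF assms(2,4)] show ?thesis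
    unfolding at_within_union eventually_sup by blast
qed

lemma is_lift_Un:
  fixes A B :: "'z::t1_space set"
  assumes A: "closed A" "is_lift P Q c A h L" and B: "closed B" "is_lift P Q c B h L'"
    and eq: "\<And>z. z \<in> A \<Longrightarrow> z \<in> B \<Longrightarrow> L z = L' z"
  shows "is_lift P Q c (A \<union> B) h (\<lambda>z. if z \<in> A then L z else L' z)"
proof -
  let ?L = "\<lambda>z. if z \<in> A then L z else L' z"
  have LA: "is_lift P Q c A h ?L" by (rule is_lift_cong[OF A(2)]) auto
  have LB: "is_lift P Q c B h ?L" by (rule is_lift_cong[OF B(2)]) (auto simp: eq)
  show ?thesis unfolding is_lift_def
  proof (intro conjI ballI impI)
    fix z assume z: "z \<in> A \<union> B"
    show "bij (?L z)" using z A(2) B(2) by (auto simp: is_lift_def)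
    show "\<forall>\<^sub>F w in at z within A \<union> B. ?L w = ?L z" if "h z \<in> P"
      by (intro eventually_within_closed_Un A B is_liftD(2)[OF LA _ that] is_liftD(2)[OF LB _ that])
    show "\<forall>\<^sub>F w in at z within A \<union> B. ?L w \<circ> c (h w) = ?L z \<circ> c (h z)" if "h z \<in> Q"
      by (intro eventually_within_closed_Un A B is_liftD(3)[OF LA _ that] is_liftD(3)[OF LB _ that])
  qed
qed

lemma comp_inv_cancel:
  assumes "bij L" "bij d"
  shows "(L' \<circ> d) \<circ> inv_into UNIV (L \<circ> d) = L' \<circ> inv_into UNIV L"
proof -
  have "d \<circ> inv_into UNIV d = id" using assms(2) by (meson bij_is_surj surj_iff)
  then show ?thesis using assms by (simp add: o_inv_distrib fun_eq_iff)
qed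

locale cocycle =
  fixes X :: "'a topology" and P Q :: "'a set" and c :: "'a \<Rightarrow> 'y \<Rightarrow> 'y"
  assumes openP: "openin X P" and openQ: "openin X Q" and cover: "topspace X = P \<union> Q"
    and bij_c: "\<And>x. bij (c x)"
    and locally_constant: "\<And>x. x \<in> P \<inter> Q \<Longrightarrow> \<exists>N. openin X N \<and> x \<in> N \<and> (\<forall>y\<in>N. c y = c x)"
begin

text \<open>Read in either trivialisation, the quotient of two lifts is composed of locally constant
  functions; so it is constant on a connected set.\<close>

lemma lift_unique:
  assumes Z: "connected Z" "h ` Z \<subseteq> topspace X"
    and L: "is_lift P Q c Z h L" and L': "is_lift P Q c Z h L'"
  shows "\<exists>g. bij g \<and> (\<forall>z\<in>Z. L' z = g \<circ> L z)"
proof (cases "Z = {}")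
  case True
  then show ?thesis by (intro exI[of _ id]) auto
next
  case False
  then obtain a where a: "a \<in> Z" by blast
  define D where "D z = L' z \<circ> inv_into UNIV (L z)" for z
  have bij: "bij (L z)" "bij (L' z)" if "z \<in> Z" for z using L L' that by (auto simp: is_lift_def)
  have loc: "\<forall>\<^sub>F w in at z within Z. D z = D w" if z: "z \<in> Z" for z
  proof -
    have Zev: "\<forall>\<^sub>F w in at z within Z. w \<in> Z" by (simp add: eventually_at_filter)
    consider "h z \<in> P" | "h z \<in> Q" using Z(2) z cover by blast
    then show ?thesis
    proof cases
      case 1
      then have "\<forall>\<^sub>F w in at z within Z. L w = L z" "\<forall>\<^sub>F w in at z within Z. L' w = L' z"
        using is_liftD(2)[OF L z] is_liftD(2)[OF L' z] by simp_all
      then show ?thesis by eventually_elim (simp add: D_def)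
    next
      case 2
      have D: "D w = (L' w \<circ> c (h w)) \<circ> inv_into UNIV (L w \<circ> c (h w))" if "w \<in> Z" for w
        unfolding D_def by (rule comp_inv_cancel[symmetric]) (use bij that bij_c in auto)
      from 2 have "\<forall>\<^sub>F w in at z within Z. L w \<circ> c (h w) = L z \<circ> c (h z)"
          "\<forall>\<^sub>F w in at z within Z. L' w \<circ> c (h w) = L' z \<circ> c (h z)"
        using is_liftD(3)[OF L z] is_liftD(3)[OF L' z] by simp_all
      then show ?thesis using Zev by eventually_elim (simp only: D z)
    qed
  qed
  have const: "D z = D a" if "z \<in> Z" for z
    using connected_local_const[OF Z(1) that a] loc by blast
  show ?thesis
  proof (intro exI conjI ballI)
    show "bij (D a)" using bij[OF a] by (auto simp: D_def intro: bij_comp bij_imp_bij_inv)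
    fix z assume z: "z \<in> Z"
    have "inv_into UNIV (L z) \<circ> L z = id" using bij(1)[OF z] by (simp add: bij_is_inj)
    then have "D z \<circ> L z = L' z" by (simp add: D_def o_assoc[symmetric])
    then show "L' z = D a \<circ> L z" using const[OF z] by simp
  qed
qed

text \<open>Connectedness of the intersection is what makes the gluing possible: there two lifts differ by
  one constant factor, and one of them can be multiplied by it.\<close>

lemma lift_exists_Un:
  fixes A B :: "'z::t1_space set"
  assumes "closed A" "closed B" "connected (A \<inter> B)" "h ` (A \<inter> B) \<subseteq> topspace X"
    and "\<exists>L. is_lift P Q c A h L" "\<exists>L. is_lift P Q c B h L"
  shows "\<exists>L. is_lift P Q c (A \<union> B) h L"
proof -
  obtain L L' where L: "is_lift P Q c A h L" and L': "is_lift P Q c B h L'" using assms by blast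
  have "is_lift P Q c (A \<inter> B) h L" "is_lift P Q c (A \<inter> B) h L'"
    using is_lift_compose[OF L, of "A \<inter> B" id] is_lift_compose[OF L', of "A \<inter> B" id]
    by (auto simp: continuous_on_id)
  from lift_unique[OF assms(3,4) this(2,1)] obtain g
    where g: "bij g" "\<And>z. z \<in> A \<inter> B \<Longrightarrow> L z = g \<circ> L' z" by blast
  have "is_lift P Q c (A \<union> B) h (\<lambda>z. if z \<in> A then L z else g \<circ> L' z)"
    by (rule is_lift_Un[OF assms(1) L assms(2) is_lift_left_mult[OF L' g(1)]]) (use g(2) in auto)
  then show ?thesis by blast
qed

lemma eventually_continuous_map:
  assumes "continuous_map (top_of_set Z) X h" "z \<in> Z" "openin X N" "h z \<in> N"
  shows "\<forall>\<^sub>F w in at z within Z. h w \<in> N"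
proof -
  have "openin (top_of_set Z) {w \<in> Z. h w \<in> N}"
    using openin_continuous_map_preimage[OF assms(1,3)] by simp
  then obtain S where "open S" "{w \<in> Z. h w \<in> N} = Z \<inter> S" by (auto simp: openin_open)
  then show ?thesis unfolding eventually_at_topological using assms by (intro exI[of _ S]) auto
qed

lemma lift_exists_P:
  assumes h: "continuous_map (top_of_set Z) X h" "h ` Z \<subseteq> P"
  shows "is_lift P Q c Z h (\<lambda>_. id)"
  unfolding is_lift_def
proof (intro conjI ballI impI)
  fix z assume z: "z \<in> Z" "h z \<in> Q"
  then obtain N where N: "openin X N" "h z \<in> N" "\<forall>y\<in>N. c y = c (h z)"
    using locally_constant[of "h z"] h(2) by blast
  show "\<forall>\<^sub>F w in at z within Z. id \<circ> c (h w) = id \<circ> c (h z)"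
    using eventually_continuous_map[OF h(1) z(1) N(1,2)] by eventually_elim (use N(3) in auto)
qed auto

lemma lift_exists_Q:
  assumes h: "continuous_map (top_of_set Z) X h" "h ` Z \<subseteq> Q"
  shows "is_lift P Q c Z h (\<lambda>z. inv_into UNIV (c (h z)))"
  unfolding is_lift_def
proof (intro conjI ballI impI)
  fix z assume z: "z \<in> Z"
  show "bij (inv_into UNIV (c (h z)))" by (simp add: bij_c bij_imp_bij_inv)
  have "inv_into UNIV (c x) \<circ> c x = id" for x using bij_c[of x] by (simp add: bij_is_inj)
  then show "\<forall>\<^sub>F w in at z within Z. inv_into UNIV (c (h w)) \<circ> c (h w) = inv_into UNIV (c (h z)) \<circ> c (h z)" by simp
  assume "h z \<in> P"
  then obtain N where N: "openin X N" "h z \<in> N" "\<forall>y\<in>N. c y = c (h z)"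
    using locally_constant[of "h z"] h(2) z by blast
  show "\<forall>\<^sub>F w in at z within Z. inv_into UNIV (c (h w)) = inv_into UNIV (c (h z))"
    using eventually_continuous_map[OF h(1) z N(1,2)] by eventually_elim (use N(3) in auto)
qed

lemma lift_exists_local:
  fixes h :: "'z::metric_space \<Rightarrow> 'a"
  assumes h: "continuous_map (top_of_set S) X h" and z: "z \<in> S"
  shows "\<exists>e>0. \<forall>Z. Z \<subseteq> S \<and> Z \<subseteq> ball z e \<longrightarrow> (\<exists>L. is_lift P Q c Z h L)"
proof -
  have *: "\<exists>e>0. \<forall>Z. Z \<subseteq> S \<and> Z \<subseteq> ball z e \<longrightarrow> h ` Z \<subseteq> N" if "openin X N" "h z \<in> N" for N
  proof -
    have op: "openin (top_of_set S) {w \<in> S. h w \<in> N}"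
      using openin_continuous_map_preimage[OF h that(1)] by simp
    have "z \<in> {w \<in> S. h w \<in> N}" using that z by simp
    from bspec[OF conjunct2[OF iffD1[OF openin_contains_ball op]] this]
    obtain e where "e > 0" "ball z e \<inter> S \<subseteq> {w \<in> S. h w \<in> N}" by blast
    then show ?thesis by (intro exI[of _ e]) auto
  qed
  have sub: "continuous_map (top_of_set Z) X h" if "Z \<subseteq> S" for Z
    using continuous_map_from_subtopology_mono[OF h that] .
  have "h z \<in> topspace X" using h z by (auto simp: continuous_map_def Pi_iff)
  then consider "h z \<in> P" | "h z \<in> Q" using cover by blast
  then show ?thesis
  proof cases
    case 1
    then show ?thesis using *[OF openP] lift_exists_P sub by meson
  next
    case 2
    then show ?thesis using *[OF openQ] lift_exists_Q sub by meson
  qed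
qed

lemma lift_exists_interval:
  assumes p: "pathin X p"
  shows "\<exists>L. is_lift P Q c {0..1} p L"
proof -
  define R where "R u v \<longleftrightarrow> 0 \<le> u \<and> v \<le> 1 \<longrightarrow> (\<exists>L. is_lift P Q c {u..v} p L)" for u v
  have "(0::real) \<le> 1" by simp
  then have "R 0 1"
  proof (induction rule: Bolzano)
    case (trans u v w)
    show ?case unfolding R_def
    proof
      assume uw: "0 \<le> u \<and> w \<le> 1"
      have "{u..v} \<inter> {v..w} = {v}" "{u..v} \<union> {v..w} = {u..w}" using trans by auto
      moreover have "p v \<in> topspace X" using p uw trans by (auto simp: pathin_def continuous_map_def Pi_iff)
      ultimately show "\<exists>L. is_lift P Q c {u..w} p L"
        using lift_exists_Un[of "{u..v}" "{v..w}" p] trans uw unfolding R_def by auto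
    qed
  next
    case (local t)
    then obtain e where e: "e > 0" "\<And>Z. Z \<subseteq> {0..1} \<Longrightarrow> Z \<subseteq> ball t e \<Longrightarrow> \<exists>L. is_lift P Q c Z p L"
      using lift_exists_local[of "{0..1}" p t] p by (auto simp: pathin_def)
    show ?case unfolding R_def
    proof (intro exI[of _ e] conjI allI impI)
      show "e > 0" by fact
      fix u v assume "u \<le> t \<and> t \<le> v \<and> v - u < e" "0 \<le> u \<and> v \<le> 1"
      then show "\<exists>L. is_lift P Q c {u..v} p L" by (intro e(2)) (auto simp: dist_real_def)
    qed
  qed
  then show ?thesis by (simp add: R_def)
qed

text \<open>Bisection in both directions. Over a thin strip around \<open>{s} \<times> {0..1}\<close> a lift is glued from small
  rectangles, whose images lie in \<open>P\<close> or in \<open>Q\<close>; the strips are then glued along vertical sides.\<close>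

lemma lift_exists_square:
  fixes h :: "real \<times> real \<Rightarrow> 'a"
  assumes h: "continuous_map (top_of_set ({0..1} \<times> {0..1})) X h"
  shows "\<exists>L. is_lift P Q c ({0..1} \<times> {0..1}) h L"
proof -
  have top: "h z \<in> topspace X" if "z \<in> {0..1} \<times> {0..1}" for z
    using h that by (auto simp: continuous_map_def Pi_iff)
  have strip: "\<exists>d>0. \<forall>a b. a \<le> s \<and> s \<le> b \<and> b - a < d \<longrightarrow>
      (0 \<le> a \<and> b \<le> 1 \<longrightarrow> (\<exists>L. is_lift P Q c ({a..b} \<times> {0..1}) h L))"
    if s: "0 \<le> s" "s \<le> 1" for s
  proof -
    define R where "R u v \<longleftrightarrow> 0 \<le> u \<and> v \<le> 1 \<longrightarrow> (\<exists>d>0. \<forall>a b. a \<le> s \<and> s \<le> b \<and> b - a < d \<longrightarrow>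
      (0 \<le> a \<and> b \<le> 1 \<longrightarrow> (\<exists>L. is_lift P Q c ({a..b} \<times> {u..v}) h L)))" for u v
    have "(0::real) \<le> 1" by simp
    then have "R 0 1"
    proof (induction rule: Bolzano)
      case (trans u v w)
      show ?case unfolding R_def
      proof
        assume uw: "0 \<le> u \<and> w \<le> 1"
        obtain d where d: "d > 0" "\<And>a b. a \<le> s \<and> s \<le> b \<and> b - a < d \<Longrightarrow> 0 \<le> a \<and> b \<le> 1 \<Longrightarrow> \<exists>L. is_lift P Q c ({a..b} \<times> {u..v}) h L"
          using trans uw unfolding R_def by auto
        obtain d' where d': "d' > 0" "\<And>a b. a \<le> s \<and> s \<le> b \<and> b - a < d' \<Longrightarrow> 0 \<le> a \<and> b \<le> 1 \<Longrightarrow> \<exists>L. is_lift P Q c ({a..b} \<times> {v..w}) h L"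
          using trans uw unfolding R_def by auto
        show "\<exists>d>0. \<forall>a b. a \<le> s \<and> s \<le> b \<and> b - a < d \<longrightarrow>
            (0 \<le> a \<and> b \<le> 1 \<longrightarrow> (\<exists>L. is_lift P Q c ({a..b} \<times> {u..w}) h L))"
        proof (intro exI[of _ "min d d'"] conjI allI impI)
          fix a b assume ab: "a \<le> s \<and> s \<le> b \<and> b - a < min d d'" "0 \<le> a \<and> b \<le> 1"
          have eqs: "({a..b} \<times> {u..v}) \<inter> ({a..b} \<times> {v..w}) = {a..b} \<times> {v}"
            "({a..b} \<times> {u..v}) \<union> ({a..b} \<times> {v..w}) = {a..b} \<times> {u..w}" using trans by auto
          have "\<exists>L. is_lift P Q c (({a..b} \<times> {u..v}) \<union> ({a..b} \<times> {v..w})) h L"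
            by (intro lift_exists_Un)
               (use d d' ab trans uw in \<open>auto intro!: closed_Times connected_Times top simp: eqs\<close>)
          then show "\<exists>L. is_lift P Q c ({a..b} \<times> {u..w}) h L" by (simp only: eqs)
        qed (use d d' in auto)
      qed
    next
      case (local t)
      then obtain e where e: "e > 0" "\<And>Z. Z \<subseteq> {0..1} \<times> {0..1} \<Longrightarrow> Z \<subseteq> ball (s, t) e \<Longrightarrow> \<exists>L. is_lift P Q c Z h L"
        using lift_exists_local[OF h, of "(s, t)"] s by auto
      show ?case
      proof (intro exI[of _ "e/2"] conjI allI impI)
        show "e / 2 > 0" using e by simp
        fix u v assume uv: "u \<le> t \<and> t \<le> v \<and> v - u < e/2"
        show "R u v" unfolding R_def
        proof (intro exI[of _ "e/2"] conjI allI impI)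
          fix a b assume u0: "0 \<le> u \<and> v \<le> 1" and ab: "a \<le> s \<and> s \<le> b \<and> b - a < e / 2" "0 \<le> a \<and> b \<le> 1"
          show "\<exists>L. is_lift P Q c ({a..b} \<times> {u..v}) h L"
          proof (rule e(2))
            show "{a..b} \<times> {u..v} \<subseteq> ball (s, t) e"
            proof clarify
              fix x y assume "x \<in> {a..b}" "y \<in> {u..v}"
              then have "\<bar>s - x\<bar> < e/2" "\<bar>t - y\<bar> < e/2"
                using uv ab unfolding abs_less_iff atLeastAtMost_iff by linarith+
              then have "dist s x < e/2" "dist t y < e/2" by (auto simp: dist_real_def)
              moreover have "dist (s,t) (x,y) \<le> dist s x + dist t y"
                unfolding dist_Pair_Pair by (rule sqrt_sum_squares_le_sum) auto
              ultimately show "(x, y) \<in> ball (s, t) e" by auto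
            qed
          qed (use u0 ab in auto)
        qed (use e in auto)
      qed
    qed
    then show ?thesis by (simp add: R_def)
  qed
  define T where "T u v \<longleftrightarrow> 0 \<le> u \<and> v \<le> 1 \<longrightarrow> (\<exists>L. is_lift P Q c ({u..v} \<times> {0..1}) h L)" for u v
  have "(0::real) \<le> 1" by simp
  then have "T 0 1"
  proof (induction rule: Bolzano)
    case (trans u v w)
    show ?case unfolding T_def
    proof
      assume uw: "0 \<le> u \<and> w \<le> 1"
      have eqs: "({u..v} \<times> {0..1}) \<inter> ({v..w} \<times> {0..1::real}) = {v} \<times> {0..1}"
        "({u..v} \<times> {0..1}) \<union> ({v..w} \<times> {0..1::real}) = {u..w} \<times> {0..1}" using trans by auto
      have "\<exists>L. is_lift P Q c (({u..v} \<times> {0..1}) \<union> ({v..w} \<times> {0..1})) h L"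
        by (intro lift_exists_Un)
           (use trans uw in \<open>auto intro!: closed_Times connected_Times top simp: eqs T_def\<close>)
      then show "\<exists>L. is_lift P Q c ({u..w} \<times> {0..1}) h L" by (simp only: eqs)
    qed
  next
    case (local s)
    then show ?case using strip unfolding T_def by blast
  qed
  then show ?thesis by (simp add: T_def)
qed

text \<open>Parallel transport along a path, in the coordinates over \<open>P\<close>. A lift is unique up to a factor on
  the left, which cancels here.\<close>

definition has_transport :: "(real \<Rightarrow> 'a) \<Rightarrow> ('y \<Rightarrow> 'y) \<Rightarrow> bool" where
  "has_transport p g \<longleftrightarrow> (\<exists>L. is_lift P Q c {0..1} p L \<and> g = inv_into UNIV (L 0) \<circ> L 1)"

lemma has_transport_exists: "pathin X p \<Longrightarrow> \<exists>g. has_transport p g"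
  using lift_exists_interval by (auto simp: has_transport_def)

lemma has_transport_bij: "has_transport p g \<Longrightarrow> bij g"
  by (auto simp: has_transport_def is_lift_def intro!: bij_comp bij_imp_bij_inv)

lemma has_transport_unique:
  assumes p: "pathin X p" and g: "has_transport p g" and g': "has_transport p g'"
  shows "g = g'"
proof -
  obtain L L' where L: "is_lift P Q c {0..1} p L" "g = inv_into UNIV (L 0) \<circ> L 1"
    and L': "is_lift P Q c {0..1} p L'" "g' = inv_into UNIV (L' 0) \<circ> L' 1"
    using g g' by (auto simp: has_transport_def)
  have "p ` {0..1} \<subseteq> topspace X" using p by (auto simp: pathin_def continuous_map_def)
  from lift_unique[OF _ this L(1) L'(1)] obtain k where k: "bij k" "\<And>z. z \<in> {0..1} \<Longrightarrow> L' z = k \<circ> L z"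
    by auto
  have "inv_into UNIV k \<circ> k = id" using k(1) by (simp add: bij_is_inj)
  moreover have "bij (L 0)" using L by (auto simp: is_lift_def)
  ultimately show ?thesis using L L' k by (simp add: o_inv_distrib fun_eq_iff)
qed

lemma has_transport_join:
  assumes p: "has_transport p g" and q: "has_transport q k" and eq: "p 1 = q 0"
  shows "has_transport (join_loops p q) (g \<circ> k)"
proof -
  obtain L L' where L: "is_lift P Q c {0..1} p L" "g = inv_into UNIV (L 0) \<circ> L 1"
    and L': "is_lift P Q c {0..1} q L'" "k = inv_into UNIV (L' 0) \<circ> L' 1"
    using p q by (auto simp: has_transport_def)
  have bij: "bij (L 0)" "bij (L 1)" "bij (L' 0)" "bij (L' 1)" using L L' by (auto simp: is_lift_def)
  define m where "m = L 1 \<circ> inv_into UNIV (L' 0)"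
  have m: "bij m" unfolding m_def using bij by (intro bij_comp bij_imp_bij_inv)
  have canc: "inv_into UNIV (L' 0) \<circ> L' 0 = id" "inv_into UNIV (L 1) \<circ> L 1 = id" using bij by (auto simp: bij_is_inj)
  have half_eq: "t = 1/2" if "t * 2 = 1" for t :: real using that by simp
  have 1: "is_lift P Q c {0..1/2} (join_loops p q) (\<lambda>t. L (2 * t))"
    by (rule is_lift_cong[OF is_lift_compose[OF L(1), of "{0..1/2}" "\<lambda>t. 2 * t"]])
       (auto intro!: continuous_intros simp: join_loops_def)
  have 2: "is_lift P Q c {1/2..1} (join_loops p q) (\<lambda>t. m \<circ> L' (2 * t - 1))"
    by (rule is_lift_cong[OF is_lift_left_mult[OF is_lift_compose[OF L'(1), of "{1/2..1}" "\<lambda>t. 2 * t - 1"] m]])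
       (use eq in \<open>auto intro!: continuous_intros simp: join_loops_def dest!: half_eq\<close>)
  have "is_lift P Q c ({0..1/2} \<union> {1/2..1}) (join_loops p q)
      (\<lambda>t. if t \<in> {0..1/2} then L (2 * t) else m \<circ> L' (2 * t - 1))"
  proof (rule is_lift_Un[OF _ 1 _ 2])
    fix t :: real assume "t \<in> {0..1/2}" "t \<in> {1/2..1}"
    then have t: "2 * t = 1" by auto
    show "L (2 * t) = m \<circ> L' (2 * t - 1)" unfolding t using canc by (simp add: m_def o_assoc[symmetric])
  qed auto
  moreover have "{0..1/2} \<union> {1/2..1} = {0..1::real}" by auto
  moreover have "g \<circ> k = inv_into UNIV (L 0) \<circ> (m \<circ> L' 1)" by (simp add: L L' m_def o_assoc)
  ultimately show ?thesis unfolding has_transport_def by (intro exI[of _ "\<lambda>t. if t \<in> {0..1/2} then L (2 * t) else m \<circ> L' (2 * t - 1)"]) auto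
qed

lemma has_transport_P:
  assumes "pathin X p" "p ` {0..1} \<subseteq> P"
  shows "has_transport p id"
  using lift_exists_P[of "{0..1}" p] assms by (auto simp: has_transport_def pathin_def intro!: exI[of _ "\<lambda>_. id"])

lemma has_transport_Q:
  assumes "pathin X p" "p ` {0..1} \<subseteq> Q"
  shows "has_transport p (c (p 0) \<circ> inv_into UNIV (c (p 1)))"
  using lift_exists_Q[of "{0..1}" p] assms
  by (auto simp: has_transport_def pathin_def bij_c inv_inv_eq intro!: exI[of _ "\<lambda>z. inv_into UNIV (c (p z))"])

text \<open>Lift the homotopy to the square. Its vertical sides are constant at a point of \<open>P\<close>, where a lift is
  locally constant, so the lift takes the same values at the ends of both horizontal sides.\<close>

lemma has_transport_homotopic:
  assumes pq: "(p, q) \<in> loop_homotopy X x" and x: "x \<in> P" and g: "has_transport p g"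
  shows "has_transport q g"
proof -
  have p: "pathin X p" using loop_homotopy_loops[OF pq] by (simp add: loops_at_def)
  from pq obtain h where "continuous_map (top_of_set ({0..1::real} \<times> {0..1})) X h
      \<and> (\<forall>t. h (0, t) = p t) \<and> (\<forall>t. h (1, t) = q t) \<and> (\<forall>s\<in>{0..1}. h (s, 0) = x \<and> h (s, 1) = x)"
    unfolding loop_homotopy_def homotopic_with_def prod_top_of_set mem_Collect_eq prod.case by (rule exE)
  then have h: "continuous_map (top_of_set ({0..1} \<times> {0..1})) X h" "\<And>t. h (0, t) = p t" "\<And>t. h (1, t) = q t"
      "\<And>s. s \<in> {0..1} \<Longrightarrow> h (s, 0) = x \<and> h (s, 1) = x" by blast+
  obtain L where L: "is_lift P Q c ({0..1} \<times> {0..1}) h L" using lift_exists_square[OF h(1)] by blast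
  have row: "is_lift P Q c {0..1} (\<lambda>t. h (s, t)) (\<lambda>t. L (s, t))" if "s \<in> {0..1}" for s
    by (rule is_lift_compose[OF L]) (use that in \<open>auto intro!: continuous_intros\<close>)
  have side: "L (0, t) = L (1, t)" if t: "t = 0 \<or> t = 1" for t
  proof -
    have lift: "is_lift P Q c {0..1} (\<lambda>s. h (s, t)) (\<lambda>s. L (s, t))"
      by (rule is_lift_compose[OF L]) (use t in \<open>auto intro!: continuous_intros\<close>)
    have "\<forall>\<^sub>F w in at s within {0..1}. L (s, t) = L (w, t)" if "s \<in> {0..1}" for s
    proof -
      have "\<forall>\<^sub>F w in at s within {0..1}. L (w, t) = L (s, t)"
        using is_liftD(2)[OF lift that] h(4)[OF that] x t by auto
      then show ?thesis by eventually_elim simp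
    qed
    then show ?thesis using connected_local_const[of "{0..1::real}" 0 1 "\<lambda>s. L (s, t)"] by auto
  qed
  have "has_transport p (inv_into UNIV (L (0,0)) \<circ> L (0,1))"
    using row[of 0] h(2) by (auto simp: has_transport_def)
  then have "g = inv_into UNIV (L (0,0)) \<circ> L (0,1)" using has_transport_unique[OF p g] by blast
  moreover have "has_transport q (inv_into UNIV (L (1,0)) \<circ> L (1,1))"
    using row[of 1] h(3) by (auto simp: has_transport_def)
  ultimately show ?thesis using side by simp
qed

theorem monodromy:
  assumes x: "x \<in> P"
  obtains act where
    "\<And>S. S \<in> carrier (fundamental_group X x) \<Longrightarrow> bij (act S)"
    "\<And>S T. \<lbrakk>S \<in> carrier (fundamental_group X x); T \<in> carrier (fundamental_group X x)\<rbrakk>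
       \<Longrightarrow> act (S \<otimes>\<^bsub>fundamental_group X x\<^esub> T) = act S \<circ> act T"
    "\<And>p g. \<lbrakk>p \<in> loops_at X x; has_transport p g\<rbrakk> \<Longrightarrow> act (loop_class X x p) = g"
proof -
  define act where "act S = (THE g. \<exists>p\<in>S. has_transport p g)" for S
  have act: "act (loop_class X x p) = g" if p: "p \<in> loops_at X x" and g: "has_transport p g" for p g
    unfolding act_def
  proof (rule the_equality)
    show "\<exists>p\<in>loop_class X x p. has_transport p g"
      using p g loop_homotopy_refl[OF p] by (auto simp: loop_class_def)
    fix k assume "\<exists>q\<in>loop_class X x p. has_transport q k"
    then obtain q where q: "(p, q) \<in> loop_homotopy X x" "has_transport q k" by (auto simp: loop_class_def)
    then have "has_transport q g" using has_transport_homotopic[OF q(1) x g] by blast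
    moreover have "pathin X q" using loop_homotopy_loops[OF q(1)] by (simp add: loops_at_def)
    ultimately show "k = g" using has_transport_unique q(2) by blast
  qed
  have ex: "\<exists>p g. p \<in> loops_at X x \<and> S = loop_class X x p \<and> has_transport p g"
    if "S \<in> carrier (fundamental_group X x)" for S
  proof -
    obtain p where "p \<in> loops_at X x" "S = loop_class X x p"
      using \<open>S \<in> _\<close> by (auto simp: carrier_fundamental_group)
    then show ?thesis using has_transport_exists[of p] by (auto simp: loops_at_def)
  qed
  show thesis
  proof
    show "bij (act S)" if "S \<in> carrier (fundamental_group X x)" for S
      using ex[OF that] act has_transport_bij by fastforce
    show "act (S \<otimes>\<^bsub>fundamental_group X x\<^esub> T) = act S \<circ> act T"
      if S: "S \<in> carrier (fundamental_group X x)" and T: "T \<in> carrier (fundamental_group X x)" for S T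
    proof -
      obtain p g where p: "p \<in> loops_at X x" "S = loop_class X x p" "has_transport p g" using ex[OF S] by blast
      obtain q k where q: "q \<in> loops_at X x" "T = loop_class X x q" "has_transport q k" using ex[OF T] by blast
      have "has_transport (join_loops p q) (g \<circ> k)"
        by (rule has_transport_join) (use p q in \<open>auto simp: loops_at_def\<close>)
      then show ?thesis using p q by (simp add: mult_fundamental_group act join_loops_in)
    qed
  qed (use act in blast)
qed

text \<open>The parts of the loop inside \<open>P\<close> have trivial transport, so only the change of trivialisation
  along the part inside \<open>V\<close> remains.\<close>

lemma crossing_loop:
  assumes x: "x \<in> P" and P: "path_connectedin X P" and V: "path_connectedin X V" "V \<subseteq> Q"
    and uv: "u \<in> V \<inter> P" "v \<in> V \<inter> P"
  shows "\<exists>p\<in>loops_at X x. has_transport p (c u \<circ> inv_into UNIV (c v))"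
proof -
  obtain a where a: "pathin X a" "a ` {0..1} \<subseteq> P" "a 0 = x" "a 1 = u"
    using P x uv unfolding path_connectedin by blast
  obtain b where b: "pathin X b" "b ` {0..1} \<subseteq> P" "b 0 = v" "b 1 = x"
    using P x uv unfolding path_connectedin by blast
  obtain d where d: "pathin X d" "d ` {0..1} \<subseteq> V" "d 0 = u" "d 1 = v"
    using V(1) uv unfolding path_connectedin by blast
  let ?db = "join_loops d b"
  have db: "?db 0 = u" "?db 1 = x" "pathin X ?db"
    using b d pathin_join_loops[of X d b] by (auto simp: join_loops_def)
  have "has_transport ?db ((c u \<circ> inv_into UNIV (c v)) \<circ> id)"
    by (rule has_transport_join) (use has_transport_P[OF b(1,2)] has_transport_Q[OF d(1)] d b V(2) in auto)
  then have "has_transport (join_loops a ?db) (id \<circ> ((c u \<circ> inv_into UNIV (c v)) \<circ> id))"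
    by (rule has_transport_join[OF has_transport_P[OF a(1,2)]]) (use db a in auto)
  moreover have "join_loops a ?db \<in> loops_at X x"
    using pathin_join_loops[of X a ?db] a db by (auto simp: loops_at_def join_loops_def[of a])
  ultimately show ?thesis by auto
qed

end


section \<open>Permutation actions that detect cycles\<close>

text \<open>Each \<open>W i\<close> is a handle attached to \<open>P\<close> along its two ends \<open>N i\<close> and \<open>R i\<close>. The cocycle is trivial
  except at the ends \<open>R i\<close>, so a loop that leaves \<open>P\<close> through \<open>N i\<close> and comes back through \<open>R i\<close> acts by
  the prescribed permutation \<open>b i\<close>. The permutations of different handles are independent of each
  other, which is how the free group on the handles makes itself felt without being constructed.\<close>

lemma band_monodromy:
  fixes b :: "'i \<Rightarrow> 'y \<Rightarrow> 'y" and W N R :: "'i \<Rightarrow> 'a set"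
  assumes P: "openin X P" "path_connectedin X P" "x \<in> P"
    and cover: "topspace X = P \<union> (\<Union>i\<in>I. W i)"
    and W: "\<And>i. i \<in> I \<Longrightarrow> openin X (W i)" "\<And>i. i \<in> I \<Longrightarrow> path_connectedin X (W i)"
    and disj: "\<And>i j. i \<in> I \<Longrightarrow> j \<in> I \<Longrightarrow> i \<noteq> j \<Longrightarrow> W i \<inter> W j = {}"
    and ends: "\<And>i. i \<in> I \<Longrightarrow> W i \<inter> P = N i \<union> R i" "\<And>i. i \<in> I \<Longrightarrow> N i \<inter> R i = {}"
      "\<And>i. i \<in> I \<Longrightarrow> openin X (N i)" "\<And>i. i \<in> I \<Longrightarrow> openin X (R i)"
      "\<And>i. i \<in> I \<Longrightarrow> N i \<noteq> {}" "\<And>i. i \<in> I \<Longrightarrow> R i \<noteq> {}"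
    and b: "\<And>i. i \<in> I \<Longrightarrow> bij (b i)"
  obtains act where
    "\<And>S. S \<in> carrier (fundamental_group X x) \<Longrightarrow> bij (act S)"
    "\<And>S T. \<lbrakk>S \<in> carrier (fundamental_group X x); T \<in> carrier (fundamental_group X x)\<rbrakk>
       \<Longrightarrow> act (S \<otimes>\<^bsub>fundamental_group X x\<^esub> T) = act S \<circ> act T"
    "\<And>i. i \<in> I \<Longrightarrow> \<exists>S\<in>carrier (fundamental_group X x). act S = b i"
proof -
  define c where "c y = (if y \<in> (\<Union>i\<in>I. R i) then inv_into UNIV (b (THE i. i \<in> I \<and> y \<in> W i)) else id)" for y
  have cR: "c y = inv_into UNIV (b i)" if "i \<in> I" "y \<in> R i" for i y
  proof -
    have y: "y \<in> W i" using that ends(1) by blast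
    have "(THE i. i \<in> I \<and> y \<in> W i) = i"
      by (rule the_equality) (use that y disj in blast)+
    then show ?thesis using that by (auto simp: c_def)
  qed
  have cN: "c y = id" if i: "i \<in> I" and y: "y \<in> N i" for i y
  proof -
    have "y \<notin> R j" if "j \<in> I" for j
    proof (cases "j = i")
      case True
      then show ?thesis using ends(2)[OF i] y by blast
    next
      case False
      then have "W i \<inter> W j = {}" using disj[of i j] i that by blast
      then show ?thesis using ends(1)[OF i] ends(1)[OF that] y by blast
    qed
    then show ?thesis by (auto simp: c_def)
  qed
  interpret cocycle X P "\<Union>i\<in>I. W i" c
  proof
    show "openin X P" "topspace X = P \<union> (\<Union>i\<in>I. W i)" by fact+
    show "openin X (\<Union>i\<in>I. W i)" using W(1) by blast
    show "bij (c y)" for y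
    proof (cases "y \<in> (\<Union>i\<in>I. R i)")
      case True
      then obtain i where i: "i \<in> I" "y \<in> R i" by blast
      show ?thesis using cR[OF i] b[OF i(1)] by (simp add: bij_imp_bij_inv)
    qed (simp add: c_def)
    show "\<exists>N. openin X N \<and> y \<in> N \<and> (\<forall>z\<in>N. c z = c y)" if y: "y \<in> P \<inter> (\<Union>i\<in>I. W i)" for y
    proof -
      obtain i where i: "i \<in> I" "y \<in> N i \<union> R i" using y ends(1) by blast
      then consider "y \<in> N i" | "y \<in> R i" by blast
      then show ?thesis
      proof cases
        case 1
        then show ?thesis using ends(3)[OF i(1)] cN[OF i(1)] by auto
      next
        case 2
        then show ?thesis using ends(4)[OF i(1)] cR[OF i(1)] by auto
      qed
    qed
  qed
  obtain act where act: "\<And>S. S \<in> carrier (fundamental_group X x) \<Longrightarrow> bij (act S)"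
    "\<And>S T. \<lbrakk>S \<in> carrier (fundamental_group X x); T \<in> carrier (fundamental_group X x)\<rbrakk>
       \<Longrightarrow> act (S \<otimes>\<^bsub>fundamental_group X x\<^esub> T) = act S \<circ> act T"
    "\<And>p g. \<lbrakk>p \<in> loops_at X x; has_transport p g\<rbrakk> \<Longrightarrow> act (loop_class X x p) = g"
    by (rule monodromy[OF P(3)]) (rule that)
  show thesis
  proof (rule that[OF act(1,2)])
    fix i assume i: "i \<in> I"
    obtain u v where uv: "u \<in> N i" "v \<in> R i" using ends(5,6)[OF i] by blast
    have "c u \<circ> inv_into UNIV (c v) = b i"
      using cN[OF i uv(1)] cR[OF i uv(2)] b[OF i] by (simp add: inv_inv_eq)
    moreover have "\<exists>p\<in>loops_at X x. has_transport p (c u \<circ> inv_into UNIV (c v))"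
      by (rule crossing_loop[OF P(3,2) W(2)[OF i]]) (use i ends(1)[OF i] uv in auto)
    ultimately obtain p where p: "p \<in> loops_at X x" "has_transport p (b i)" by auto
    have "act (loop_class X x p) = b i" by (rule act(3)[OF p])
    then show "\<exists>S\<in>carrier (fundamental_group X x). act S = b i"
      using p(1) by (auto simp: carrier_fundamental_group)
  qed
qed

locale bijection_action = group G for G :: "('g, 'm) monoid_scheme" (structure) +
  fixes act :: "'g \<Rightarrow> 'y \<Rightarrow> 'y"
  assumes act_bij: "g \<in> carrier G \<Longrightarrow> bij (act g)"
    and act_mult: "\<lbrakk>g \<in> carrier G; h \<in> carrier G\<rbrakk> \<Longrightarrow> act (g \<otimes> h) = act g \<circ> act h"
begin

lemma act_one: "act \<one> = id"
proof -
  have "act \<one> \<circ> act \<one> = act \<one>" using act_mult[of \<one> \<one>] by simp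
  then have "act \<one> (act \<one> y) = act \<one> y" for y by (simp add: fun_eq_iff)
  then show ?thesis using act_bij[of \<one>] by (metis bij_is_inj ext id_apply injD one_closed)
qed

lemma act_pow: "g \<in> carrier G \<Longrightarrow> act (g [^] (n::nat)) = act g ^^ n"
  by (induction n) (simp_all add: act_one act_mult funpow_Suc_right del: funpow.simps(2))

end

lemma (in bijection_action) infinite_if_shift:
  fixes \<phi> :: "'y \<Rightarrow> int"
  assumes g: "g \<in> carrier G" and shift: "\<And>y. \<phi> (act g y) = \<phi> y + 1"
  shows "infinite (carrier G)"
proof
  assume fin: "finite (carrier G)"
  have val: "\<phi> ((act g ^^ n) y) = \<phi> y + int n" for n y
    by (induction n) (simp_all add: shift)
  have "inj (\<lambda>n::nat. g [^] n)"
  proof (rule injI)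
    fix m n :: nat assume "g [^] m = g [^] n"
    then have "act g ^^ m = act g ^^ n" using act_pow[OF g] by metis
    then have "\<phi> ((act g ^^ m) undefined) = \<phi> ((act g ^^ n) undefined)" by (rule arg_cong)
    then show "m = n" unfolding val by simp
  qed
  moreover have "range (\<lambda>n::nat. g [^] n) \<subseteq> carrier G" using g by auto
  ultimately have "finite (UNIV :: nat set)"
    using finite_subset[OF _ fin] finite_imageD by blast
  then show False by simp
qed

lemma (in bijection_action) ping_pong_not_commutative:
  assumes gh: "g \<in> carrier G" "h \<in> carrier G"
    and ping: "act g ` (- A2) \<subseteq> A1" and pong: "act h ` (- B2) \<subseteq> B1"
    and disjoint: "A1 \<inter> A2 = {}" "B1 \<inter> B2 = {}" "(A1 \<union> A2) \<inter> (B1 \<union> B2) = {}"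
    and y: "y \<in> A1"
  shows "g \<otimes> h \<noteq> h \<otimes> g"
proof
  assume "g \<otimes> h = h \<otimes> g"
  then have eq: "act g (act h y) = act h (act g y)"
    using act_mult gh by (metis comp_apply)
  have "act h y \<in> B1" using y pong disjoint by blast
  then have "act g (act h y) \<in> A1" using ping disjoint by blast
  moreover have "act g y \<in> A1" using y ping disjoint by blast
  then have "act h (act g y) \<in> B1" using pong disjoint by blast
  ultimately show False using eq disjoint by auto
qed

text \<open>An invariant mean on the group is pushed forward along the orbit map of a point. As \<open>g\<close> moves
  the complement of \<open>A2\<close> into \<open>A1\<close>, the masses of \<open>A1\<close> and \<open>A2\<close> add up to at least one; so do those of
  \<open>B1\<close> and \<open>B2\<close>. Four disjoint sets would have total mass two.\<close>

lemma (in bijection_action) ping_pong_not_amenable: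
  assumes gh: "g \<in> carrier G" "h \<in> carrier G"
    and ping: "act g ` (- A2) \<subseteq> A1" and pong: "act h ` (- B2) \<subseteq> B1"
    and disjoint: "A1 \<inter> A2 = {}" "B1 \<inter> B2 = {}" "(A1 \<union> A2) \<inter> (B1 \<union> B2) = {}"
  shows "\<not> amenable_group G"
proof
  assume "amenable_group G"
  then obtain \<mu> :: "'g set \<Rightarrow> real" where \<mu>:
      "(\<forall>B\<subseteq>carrier G. 0 \<le> \<mu> B) \<and> \<mu> (carrier G) = 1 \<and>
       (\<forall>B\<subseteq>carrier G. \<forall>C\<subseteq>carrier G. B \<inter> C = {} \<longrightarrow> \<mu> (B \<union> C) = \<mu> B + \<mu> C) \<and>
       (\<forall>g\<in>carrier G. \<forall>B\<subseteq>carrier G. \<mu> (g <#\<^bsub>G\<^esub> B) = \<mu> B)"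
    unfolding amenable_group_def by (elim conjE[of "group G"] exE) (rule that)
  then have nonneg: "\<And>B. B \<subseteq> carrier G \<Longrightarrow> 0 \<le> \<mu> B" and total: "\<mu> (carrier G) = 1"
    and add: "\<And>B C. \<lbrakk>B \<subseteq> carrier G; C \<subseteq> carrier G; B \<inter> C = {}\<rbrakk> \<Longrightarrow> \<mu> (B \<union> C) = \<mu> B + \<mu> C"
    and inv: "\<And>k B. \<lbrakk>k \<in> carrier G; B \<subseteq> carrier G\<rbrakk> \<Longrightarrow> \<mu> (k <#\<^bsub>G\<^esub> B) = \<mu> B"
    by blast+
  have mono: "\<mu> B \<le> \<mu> C" if "B \<subseteq> C" "C \<subseteq> carrier G" for B C
  proof -
    have "\<mu> (B \<union> (C - B)) = \<mu> B + \<mu> (C - B)" by (rule add) (use that in auto)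
    moreover have "B \<union> (C - B) = C" using that by auto
    ultimately show ?thesis using nonneg[of "C - B"] that by auto
  qed
  define E where "E S = {k \<in> carrier G. act k undefined \<in> S}" for S
  have E: "E S \<subseteq> carrier G" for S by (auto simp: E_def)
  have E_add: "\<mu> (E (S \<union> T)) = \<mu> (E S) + \<mu> (E T)" if "S \<inter> T = {}" for S T
  proof -
    have "E (S \<union> T) = E S \<union> E T" "E S \<inter> E T = {}" using that by (auto simp: E_def)
    then show ?thesis using add[OF E E] by simp
  qed
  have E_mono: "\<mu> (E S) \<le> \<mu> (E T)" if "S \<subseteq> T" for S T
    by (rule mono[OF _ E]) (use that in \<open>auto simp: E_def\<close>)
  have E_UNIV: "\<mu> (E UNIV) = 1" using total by (simp add: E_def)
  have half: "1 \<le> \<mu> (E A) + \<mu> (E B)" if k: "k \<in> carrier G" and sub: "act k ` (- B) \<subseteq> A" for k A B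
  proof -
    have "k <#\<^bsub>G\<^esub> E (- B) \<subseteq> E A"
      using k sub by (auto simp: l_coset_def E_def act_mult)
    then have "\<mu> (k <#\<^bsub>G\<^esub> E (- B)) \<le> \<mu> (E A)" by (rule mono[OF _ E])
    then have "\<mu> (E (- B)) \<le> \<mu> (E A)" using inv[OF k E] by simp
    moreover have "\<mu> (E (- B \<union> B)) = \<mu> (E (- B)) + \<mu> (E B)" by (rule E_add) auto
    ultimately show ?thesis using E_UNIV by (simp add: Compl_partition2)
  qed
  have "\<mu> (E ((A1 \<union> A2) \<union> (B1 \<union> B2))) = \<mu> (E A1) + \<mu> (E A2) + (\<mu> (E B1) + \<mu> (E B2))"
    using disjoint by (simp add: E_add)
  also have "\<dots> \<ge> 2" using half[OF gh(1) ping] half[OF gh(2) pong] by simp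
  finally show False using E_mono[of "(A1 \<union> A2) \<union> (B1 \<union> B2)" UNIV] E_UNIV by simp
qed

lemma bijection_between_infinite_coinfinite:
  fixes S T :: "nat set"
  assumes "infinite S" "infinite (- S)" "infinite T" "infinite (- T)"
  shows "\<exists>f. bij f \<and> f ` S = T"
proof -
  have *: "\<exists>f. bij_betw f A B" if "infinite A" "infinite B" for A B :: "nat set"
    using to_nat_on_infinite[OF _ that(1)] to_nat_on_infinite[OF _ that(2)]
    by (meson bij_betw_inv bij_betw_trans countableI_type)
  obtain f1 f2 where f: "bij_betw f1 S T" "bij_betw f2 (- S) (- T)" using * assms by metis
  let ?f = "\<lambda>x. if x \<in> S then f1 x else f2 x"
  have 1: "bij_betw ?f S T" using f(1) by (simp cong: bij_betw_cong)
  have "bij_betw ?f (- S) (- T)" using f(2) by (subst bij_betw_cong[of _ _ f2]) auto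
  from bij_betw_combine[OF 1 this] have "bij ?f" by simp
  then show ?thesis using 1 by (metis bij_betw_imp_surj_on)
qed

text \<open>Ping-pong asks for nothing but inclusions of sets, and cardinality provides bijections with
  them; the four sets are residue classes modulo four.\<close>

lemma ping_pong_bijections:
  obtains a b :: "nat \<Rightarrow> nat" and A1 A2 B1 B2 where
    "bij a" "bij b" "a ` (- A2) \<subseteq> A1" "b ` (- B2) \<subseteq> B1"
    "A1 \<inter> A2 = {}" "B1 \<inter> B2 = {}" "(A1 \<union> A2) \<inter> (B1 \<union> B2) = {}" "A1 \<noteq> {}"
proof -
  define C where "C i = {n::nat. n mod 4 = i}" for i
  have inf: "infinite (C i)" if "i < 4" for i
  proof
    assume "finite (C i)"
    moreover have "range (\<lambda>k. 4 * k + i) \<subseteq> C i" using that by (auto simp: C_def)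
    ultimately have "finite (range (\<lambda>k. 4 * k + i))" by (rule finite_subset[rotated])
    then show False using finite_imageD[of "\<lambda>k. 4 * k + i" UNIV] by (auto simp: inj_on_def)
  qed
  have disj: "C i \<inter> C j = {}" if "i \<noteq> j" for i j using that by (auto simp: C_def)
  have coinf: "infinite (- C i)" if "i < 4" for i
  proof -
    define j :: nat where "j = (if i = 0 then 1 else 0)"
    have j: "j < 4" "j \<noteq> i" by (auto simp: j_def)
    have "C j \<subseteq> - C i" using disj[OF j(2)] by blast
    then show ?thesis using inf[OF j(1)] finite_subset by blast
  qed
  obtain a where a: "bij a" "a ` (- C 1) = C 0"
    using bijection_between_infinite_coinfinite[of "- C 1" "C 0"] inf coinf by auto
  obtain b where b: "bij b" "b ` (- C 3) = C 2"
    using bijection_between_infinite_coinfinite[of "- C 3" "C 2"] inf coinf by auto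
  show thesis
  proof (rule that[OF a(1) b(1)])
    show "a ` (- C 1) \<subseteq> C 0" "b ` (- C 3) \<subseteq> C 2" using a b by auto
    show "C 0 \<noteq> {}" using inf[of 0] by force
    show "(C 0 \<union> C 1) \<inter> (C 2 \<union> C 3) = {}" by (auto simp: C_def)
  qed (auto simp: disj)
qed


section \<open>Contractions that fix a point\<close>

lemma continuous_map_closed_Un:
  assumes A: "closedin Z A" "continuous_map (subtopology Z A) Y f"
    and B: "closedin Z B" "continuous_map (subtopology Z B) Y g"
    and cover: "topspace Z \<subseteq> A \<union> B" and eq: "\<And>z. z \<in> A \<Longrightarrow> z \<in> B \<Longrightarrow> f z = g z"
  shows "continuous_map Z Y (\<lambda>z. if z \<in> A then f z else g z)"
  unfolding continuous_map_closedin
proof (intro conjI ballI allI impI)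
  have sub: "A \<subseteq> topspace Z" "B \<subseteq> topspace Z" using A B closedin_subset by auto
  show "(\<lambda>z. if z \<in> A then f z else g z) \<in> topspace Z \<rightarrow> topspace Y"
  proof (rule Pi_I)
    fix z assume z: "z \<in> topspace Z"
    have "f z \<in> topspace Y" if "z \<in> A"
      using A(2) sub that by (auto simp: continuous_map_def Pi_iff)
    moreover have "g z \<in> topspace Y" if "z \<in> B"
      using B(2) sub that by (auto simp: continuous_map_def Pi_iff)
    ultimately show "(if z \<in> A then f z else g z) \<in> topspace Y" using z cover by auto
  qed
  fix C assume C: "closedin Y C"
  have "closedin Z {z \<in> A. f z \<in> C}"
    using closedin_continuous_map_preimage[OF A(2) C] sub
    by (intro closedin_trans_full[OF _ A(1)]) (simp add: Int_absorb1)
  moreover have "closedin Z {z \<in> B. g z \<in> C}"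
    using closedin_continuous_map_preimage[OF B(2) C] sub
    by (intro closedin_trans_full[OF _ B(1)]) (simp add: Int_absorb1)
  moreover have "{z \<in> topspace Z. (if z \<in> A then f z else g z) \<in> C} = {z \<in> A. f z \<in> C} \<union> {z \<in> B. g z \<in> C}"
    using sub cover eq by auto
  ultimately show "closedin Z {z \<in> topspace Z. (if z \<in> A then f z else g z) \<in> C}" by (simp add: closedin_Un)
qed

text \<open>If \<open>A\<close> fell into two pieces, then the piece that misses \<open>p\<close> would also be separated from \<open>C\<close>.\<close>

lemma connectedin_closed_Un_point:
  assumes A: "closedin X A" and C: "closedin X C" and p: "A \<inter> C = {p}"
    and conn: "connectedin X (A \<union> C)"
  shows "connectedin X A"
proof (rule ccontr)
  assume "\<not> connectedin X A"
  moreover have "A \<subseteq> topspace X" using A closedin_subset by auto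
  ultimately obtain E1 E2 where E: "closedin X E1" "closedin X E2" "A \<subseteq> E1 \<union> E2" "E1 \<inter> E2 \<inter> A = {}"
    "E1 \<inter> A \<noteq> {}" "E2 \<inter> A \<noteq> {}" unfolding connectedin_closedin by blast
  have pA: "p \<in> A" "p \<in> C" "\<And>x. x \<in> A \<Longrightarrow> x \<in> C \<Longrightarrow> x = p" using p by auto
  have False if F: "closedin X F1" "closedin X F2" "A \<subseteq> F1 \<union> F2" "F1 \<inter> F2 \<inter> A = {}"
    "F2 \<inter> A \<noteq> {}" "p \<in> F1" for F1 F2
  proof -
    have "closedin X ((F1 \<inter> A) \<union> C)" "closedin X (F2 \<inter> A)" using F A C by auto
    moreover have "A \<union> C \<subseteq> ((F1 \<inter> A) \<union> C) \<union> (F2 \<inter> A)" using F by blast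
    moreover have "x \<notin> F2 \<inter> A" if x: "x \<in> (F1 \<inter> A) \<union> C" for x
    proof
      assume x2: "x \<in> F2 \<inter> A"
      then have "x \<in> F1" using x pA(3)[of x] F(6) by blast
      then show False using F(4) x2 by blast
    qed
    then have "((F1 \<inter> A) \<union> C) \<inter> (F2 \<inter> A) \<inter> (A \<union> C) = {}" by blast
    moreover have "((F1 \<inter> A) \<union> C) \<inter> (A \<union> C) \<noteq> {}" "(F2 \<inter> A) \<inter> (A \<union> C) \<noteq> {}" using F(5) pA(2) by blast+
    ultimately show False using conn unfolding connectedin_closedin by blast
  qed
  from this[of E1 E2] this[of E2 E1] E pA(1) show False by (auto simp: Int_commute Un_commute)
qed

text \<open>The point \<open>w\<close> stays fixed during the contraction. Contractibility alone would not do: two spaces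
  that share a point can be glued compatibly only if the homotopies agree there.\<close>

definition contracts_to :: "'a topology \<Rightarrow> 'a set \<Rightarrow> 'a \<Rightarrow> bool" where
  "contracts_to X S w \<longleftrightarrow>
     homotopic_with (\<lambda>g. g w = w) (subtopology X S) (subtopology X S) id (\<lambda>_. w)"

lemma contracts_to_iff:
  assumes "w \<in> S" "S \<subseteq> topspace X"
  shows "contracts_to X S w \<longleftrightarrow>
    (\<exists>h. continuous_map (prod_topology (top_of_set {0..1::real}) (subtopology X S)) (subtopology X S) h \<and>
       (\<forall>x\<in>S. h (0, x) = x) \<and> (\<forall>x\<in>S. h (1, x) = w) \<and> (\<forall>t\<in>{0..1}. h (t, w) = w))"
proof -
  have "topspace (subtopology X S) = S" using assms by auto
  then show ?thesis
    unfolding contracts_to_def using assms by (subst homotopic_with) (auto simp: Int_absorb1)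
qed

text \<open>First \<open>B\<close> is pushed into \<open>v\<close> while \<open>A\<close> stands still, then \<open>A\<close> is contracted to \<open>w\<close>.\<close>

lemma contracts_to_Un:
  assumes A: "closedin X A" and B: "closedin X B" and v: "A \<inter> B = {v}" and w: "w \<in> A"
    and cA: "contracts_to X A w" and cB: "contracts_to X B v"
  shows "contracts_to X (A \<union> B) w"
proof -
  let ?I = "top_of_set {0..1::real}"
  let ?Y = "subtopology X (A \<union> B)" and ?Z = "prod_topology (top_of_set {0..1::real}) (subtopology X (A \<union> B))"
  have sub: "A \<subseteq> topspace X" "B \<subseteq> topspace X" using A B closedin_subset by auto
  obtain hA where hA: "continuous_map (prod_topology ?I (subtopology X A)) (subtopology X A) hA"
      "\<forall>x\<in>A. hA (0, x) = x" "\<forall>x\<in>A. hA (1, x) = w" "\<forall>t\<in>{0..1}. hA (t, w) = w"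
    using cA contracts_to_iff[OF w sub(1)] by blast
  obtain hB where hB: "continuous_map (prod_topology ?I (subtopology X B)) (subtopology X B) hB"
      "\<forall>x\<in>B. hB (0, x) = x" "\<forall>x\<in>B. hB (1, x) = v" "\<forall>t\<in>{0..1}. hB (t, v) = v"
    using cB contracts_to_iff[of v B X] sub v by blast
  have clY: "closedin ?Y A" "closedin ?Y B" using A B by (auto simp: closedin_subset_topspace)
  have subY: "subtopology ?Y A = subtopology X A" "subtopology ?Y B = subtopology X B"
    by (auto simp: subtopology_subtopology Int_absorb1)
  have intoY: "continuous_map T ?Y f" if "continuous_map T (subtopology X A) f \<or> continuous_map T (subtopology X B) f"
    for T :: "'c topology" and f using that by (auto simp: continuous_map_in_subtopology)
  have subZ: "subtopology ?Z ({0..1} \<times> A) = prod_topology ?I (subtopology X A)"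
    "subtopology ?Z ({0..1} \<times> B) = prod_topology ?I (subtopology X B)"
    unfolding subtopology_Times subY by (simp_all add: subtopology_subtopology)
  have clZ: "closedin ?Z ({0..1} \<times> A)" "closedin ?Z ({0..1} \<times> B)"
    using clY by (auto simp: closedin_prod_Times_iff)
  have topZ: "topspace ?Z \<subseteq> {0..1} \<times> A \<union> {0..1} \<times> B" by auto
  define r where "r x = (if x \<in> A then x else v)" for x
  have r: "continuous_map ?Y (subtopology X A) r" unfolding r_def
  proof (rule continuous_map_closed_Un[OF clY(1) _ clY(2)])
    show "continuous_map (subtopology ?Y A) (subtopology X A) (\<lambda>x. x)"
      unfolding subY by simp
    show "continuous_map (subtopology ?Y B) (subtopology X A) (\<lambda>x. v)" using v sub by auto
  qed (use v in auto)
  have "continuous_map ?Z ?Y (\<lambda>z. if z \<in> {0..1} \<times> A then snd z else hB z)"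
  proof (rule continuous_map_closed_Un[OF clZ(1) _ clZ(2) _ topZ])
    show "continuous_map (subtopology ?Z ({0..1} \<times> A)) ?Y snd"
      unfolding subZ by (intro intoY disjI1 continuous_map_snd)
    show "continuous_map (subtopology ?Z ({0..1} \<times> B)) ?Y hB"
      unfolding subZ by (intro intoY disjI2 hB)
    fix z assume "z \<in> {0..1::real} \<times> A" "z \<in> {0..1} \<times> B"
    then obtain t x where z: "z = (t, x)" "t \<in> {0..1}" "x \<in> A \<inter> B" by blast
    then have "x = v" unfolding v by simp
    then show "snd z = hB z" using hB(4) z(2) by (simp add: z(1))
  qed
  moreover have topY: "topspace ?Y = A \<union> B" using sub by auto
  ultimately have 1: "homotopic_with (\<lambda>g. g w = w) ?Y ?Y id r"
    using w hB(2,3) by (subst homotopic_with)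
      (auto simp: r_def topY intro!: exI[of _ "\<lambda>z. if z \<in> {0..1} \<times> A then snd z else hB z"])
  have "homotopic_with (\<lambda>g. g w = w) (subtopology X A) (subtopology X A) id (\<lambda>_. w)"
    using cA by (simp add: contracts_to_def)
  then have "homotopic_with (\<lambda>g. g w = w) ?Y (subtopology X A) (id \<circ> r) ((\<lambda>_. w) \<circ> r)"
    by (rule homotopic_with_compose_continuous_map_right[OF _ r]) (use w in \<open>auto simp: r_def\<close>)
  then have 2: "homotopic_with (\<lambda>g. g w = w) ?Y ?Y r (\<lambda>_. w)"
    using homotopic_with_compose_continuous_map_left[of _ ?Y "subtopology X A" "id \<circ> r" "(\<lambda>_. w) \<circ> r" ?Y id "\<lambda>g. g w = w"]
    by (auto simp: o_def intoY)
  show ?thesis unfolding contracts_to_def by (rule homotopic_with_trans[OF 1 2])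
qed

lemma contracts_to_Un_all:
  assumes "closedin X A" "closedin X B" "A \<inter> B = {v}"
    and "\<And>w. w \<in> A \<Longrightarrow> contracts_to X A w" "\<And>w. w \<in> B \<Longrightarrow> contracts_to X B w"
    and "w \<in> A \<union> B"
  shows "contracts_to X (A \<union> B) w"
proof (cases "w \<in> A")
  case True
  then show ?thesis using assms by (intro contracts_to_Un[of X A B v]) auto
next
  case False
  then have "contracts_to X (B \<union> A) w" using assms by (intro contracts_to_Un[of X B A v]) auto
  then show ?thesis by (simp add: Un_commute)
qed

section \<open>Finite graphs as unions of arcs\<close>

text \<open>The arcs are injective on the closed interval, so no edge returns to the vertex where it starts.
  For graphs with a height function that is monotone along the edges this is automatic, and it makes
  every closed edge homeomorphic to an interval.\<close>

locale arc_graph =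
  fixes X :: "'a topology" and V :: "'a set" and E :: "(real \<Rightarrow> 'a) set"
  assumes hausdorff: "Hausdorff_space X"
    and finite_V: "finite V" and V_sub: "V \<subseteq> topspace X" and finite_E: "finite E"
    and path: "e \<in> E \<Longrightarrow> pathin X e"
    and ends: "e \<in> E \<Longrightarrow> e 0 \<in> V" "e \<in> E \<Longrightarrow> e 1 \<in> V"
    and inj: "e \<in> E \<Longrightarrow> inj_on e {0..1}"
    and interior_V: "e \<in> E \<Longrightarrow> e ` {0<..<1} \<inter> V = {}"
    and disjoint: "\<lbrakk>e \<in> E; e' \<in> E; e \<noteq> e'\<rbrakk> \<Longrightarrow> e ` {0<..<1} \<inter> e' ` {0<..<1} = {}"
    and cover: "topspace X = V \<union> (\<Union>e\<in>E. e ` {0<..<1})"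
begin

abbreviation closed_arc :: "(real \<Rightarrow> 'a) \<Rightarrow> 'a set" where "closed_arc e \<equiv> e ` {0..1}"
abbreviation open_arc :: "(real \<Rightarrow> 'a) \<Rightarrow> 'a set" where "open_arc e \<equiv> e ` {0<..<1}"

lemma closed_arc_eq: "closed_arc e = open_arc e \<union> {e 0, e 1}"
proof -
  have "{0..1::real} = {0<..<1} \<union> {0, 1}" by auto
  then show ?thesis by (metis image_Un image_insert image_empty)
qed

lemma continuous_e: "e \<in> E \<Longrightarrow> continuous_map (top_of_set {0..1}) X e"
  using path by (simp add: pathin_def)

lemma compactin_e: "e \<in> E \<Longrightarrow> compact T \<Longrightarrow> T \<subseteq> {0..1} \<Longrightarrow> compactin X (e ` T)"
  using image_compactin[OF _ continuous_e] by (simp add: compactin_subtopology)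

lemma closedin_e: "e \<in> E \<Longrightarrow> compact T \<Longrightarrow> T \<subseteq> {0..1} \<Longrightarrow> closedin X (e ` T)"
  using compactin_e compactin_imp_closedin hausdorff by blast

lemma connectedin_e: "e \<in> E \<Longrightarrow> connected T \<Longrightarrow> T \<subseteq> {0..1} \<Longrightarrow> connectedin X (e ` T)"
  using connectedin_continuous_map_image[OF continuous_e] by (simp add: connectedin_subtopology)

lemma arc_sub: "e \<in> E \<Longrightarrow> closed_arc e \<subseteq> topspace X"
  using path_image_subset_topspace path by blast

lemma open_arc_disjoint: "\<lbrakk>e \<in> E; e' \<in> E; e \<noteq> e'\<rbrakk> \<Longrightarrow> open_arc e \<inter> closed_arc e' = {}"
proof -
  assume e: "e \<in> E" "e' \<in> E" "e \<noteq> e'"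
  have "closed_arc e' \<subseteq> open_arc e' \<union> V" unfolding closed_arc_eq using ends[OF e(2)] by blast
  then show ?thesis using disjoint[OF e] interior_V[OF e(1)] by blast
qed

lemma closedin_V: "U \<subseteq> V \<Longrightarrow> closedin X U"
  using V_sub finite_V hausdorff by (meson closedin_Hausdorff_finite finite_subset subset_trans)

lemma closedin_subgraph:
  assumes "U \<subseteq> V" "F \<subseteq> E"
  shows "closedin X (U \<union> (\<Union>e\<in>F. closed_arc e))"
proof (intro closedin_Un closedin_Union)
  show "finite (closed_arc ` F)" using assms(2) finite_E finite_subset by blast
qed (use assms closedin_V in \<open>auto intro!: closedin_e\<close>)

lemma openin_open_arc:
  assumes e: "e \<in> E"
  shows "openin X (open_arc e)"
proof -
  have "open_arc e = topspace X - (V \<union> (\<Union>e'\<in>E - {e}. closed_arc e'))"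
  proof
    show "open_arc e \<subseteq> topspace X - (V \<union> (\<Union>e'\<in>E - {e}. closed_arc e'))"
      using open_arc_disjoint[OF e] interior_V[OF e] cover e by blast
    show "topspace X - (V \<union> (\<Union>e'\<in>E - {e}. closed_arc e')) \<subseteq> open_arc e"
      unfolding cover closed_arc_eq by blast
  qed
  then show ?thesis using closedin_subgraph[of V "E - {e}"] by auto
qed

lemma openin_e:
  assumes e: "e \<in> E" and T: "open T" "T \<subseteq> {0<..<1}"
  shows "openin X (e ` T)"
proof -
  have "{0<..<1} - ({0..1} - T) = T" using T(2) by auto
  moreover have "e ` ({0<..<1} - ({0..1} - T)) = open_arc e - e ` ({0..1} - T)"
    by (rule inj_on_image_set_diff[OF inj[OF e]]) auto
  ultimately have "e ` T = open_arc e - e ` ({0..1} - T)" by simp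
  moreover have "compact ({0..1} - T)" using T(1) by (simp add: compact_diff)
  ultimately show ?thesis
    using closedin_e[OF e, of "{0..1} - T"] openin_open_arc[OF e] by auto
qed

lemma embedding_e:
  assumes e: "e \<in> E"
  shows "homeomorphic_map (top_of_set {0..1}) (subtopology X (closed_arc e)) e"
proof (rule continuous_imp_homeomorphic_map)
  show "compact_space (top_of_set {0..1::real})" by (simp add: compact_space_subtopology)
  show "Hausdorff_space (subtopology X (closed_arc e))" using hausdorff by (simp add: Hausdorff_space_subtopology)
  show "continuous_map (top_of_set {0..1}) (subtopology X (closed_arc e)) e"
    using continuous_e[OF e] by (auto simp: continuous_map_in_subtopology)
qed (use arc_sub[OF e] inj[OF e] in auto)

lemma arc_coordinate:
  assumes e: "e \<in> E"
  obtains d where "continuous_map (subtopology X (closed_arc e)) (top_of_set {0..1}) d"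
    "\<And>t. t \<in> {0..1} \<Longrightarrow> d (e t) = t"
proof -
  obtain d where "homeomorphic_maps (top_of_set {0..1}) (subtopology X (closed_arc e)) e d"
    using embedding_e[OF e] homeomorphic_map_maps by blast
  then show thesis using that by (auto simp: homeomorphic_maps_def)
qed

lemma contracts_to_arc:
  assumes e: "e \<in> E" and w: "w \<in> closed_arc e"
  shows "contracts_to X (closed_arc e) w"
proof -
  obtain d where d: "continuous_map (subtopology X (closed_arc e)) (top_of_set {0..1}) d"
    "\<And>t. t \<in> {0..1} \<Longrightarrow> d (e t) = t" using arc_coordinate[OF e] by blast
  obtain u where u: "u \<in> {0..1}" "w = e u" using w by auto
  let ?Z = "prod_topology (top_of_set {0..1::real}) (subtopology X (closed_arc e))"
  have snd: "continuous_map ?Z euclideanreal (\<lambda>z. d (snd z))" "continuous_map ?Z euclideanreal fst"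
    using continuous_map_compose[OF continuous_map_snd d(1)] continuous_map_fst[of "top_of_set {0..1::real}" "subtopology X (closed_arc e)"]
    by (auto simp: o_def continuous_map_in_subtopology)
  have d01: "d x \<in> {0..1}" if "x \<in> closed_arc e" for x using d(2) that by auto
  have "continuous_map ?Z (top_of_set {0..1}) (\<lambda>z. (1 - fst z) * d (snd z) + fst z * u)"
    unfolding continuous_map_in_subtopology
  proof
    show "continuous_map ?Z euclideanreal (\<lambda>z. (1 - fst z) * d (snd z) + fst z * u)"
      by (intro continuous_intros snd) 
    show "(\<lambda>z. (1 - fst z) * d (snd z) + fst z * u) \<in> topspace ?Z \<rightarrow> {0..1}"
    proof (rule Pi_I)
      fix z assume "z \<in> topspace ?Z"
      then have z: "fst z \<in> {0..1}" "d (snd z) \<in> {0..1}" using d01 by auto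
      have "convex {0..1::real}" by simp
      from convexD[OF this z(2) u(1), of "1 - fst z" "fst z"] z(1)
      show "(1 - fst z) * d (snd z) + fst z * u \<in> {0..1}" by auto
    qed
  qed
  from continuous_map_compose[OF this homeomorphic_imp_continuous_map[OF embedding_e[OF e]]]
  have "continuous_map ?Z (subtopology X (closed_arc e)) (\<lambda>z. e ((1 - fst z) * d (snd z) + fst z * u))"
    by (simp add: o_def)
  then show ?thesis
    unfolding contracts_to_iff[OF w arc_sub[OF e]]
    by (intro exI[of _ "\<lambda>z. e ((1 - fst z) * d (snd z) + fst z * u)"])
       (use d(2) u in \<open>auto simp: algebra_simps\<close>)
qed

end


section \<open>Bridges and the three kinds of connected graphs\<close>

lemma not_connectedin_closed:
  assumes "closedin X S" "\<not> connectedin X S"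
  obtains A B where "closedin X A" "closedin X B" "A \<union> B = S" "A \<inter> B = {}" "A \<noteq> {}" "B \<noteq> {}"
proof -
  have "S \<subseteq> topspace X" using assms closedin_subset by auto
  then obtain E1 E2 where E: "closedin X E1" "closedin X E2" "S \<subseteq> E1 \<union> E2" "E1 \<inter> E2 \<inter> S = {}"
    "E1 \<inter> S \<noteq> {}" "E2 \<inter> S \<noteq> {}" using assms(2) unfolding connectedin_closedin by blast
  show thesis
    by (rule that[of "E1 \<inter> S" "E2 \<inter> S"]) (use E assms in blast)+
qed

lemma connectedin_closed_disjoint_cases:
  assumes "connectedin X S" "closedin X A" "closedin X B" "S \<subseteq> A \<union> B" "A \<inter> B = {}"
  shows "S \<subseteq> A \<or> S \<subseteq> B"
proof (rule ccontr)
  assume "\<not> ?thesis"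
  then have "A \<inter> S \<noteq> {}" "B \<inter> S \<noteq> {}" using assms(4) by blast+
  moreover have "A \<inter> B \<inter> S = {}" using assms(5) by blast
  ultimately show False using assms(1-4) unfolding connectedin_closedin by blast
qed

lemma Int_subset_pair:
  shows "K \<inter> A \<subseteq> {a, b} \<Longrightarrow> b \<notin> A \<Longrightarrow> A \<inter> K \<subseteq> {a}"
    and "K \<inter> A \<subseteq> {a, b} \<Longrightarrow> a \<notin> A \<Longrightarrow> A \<inter> K \<subseteq> {b}"
    and "K \<inter> A \<subseteq> {a, b} \<Longrightarrow> a \<notin> A \<Longrightarrow> b \<notin> A \<Longrightarrow> K \<inter> A = {}"
  by blast+

lemma contracts_to_singleton:
  assumes "w \<in> topspace X"
  shows "contracts_to X {w} w"
  unfolding contracts_to_def by (rule homotopic_with_equal) (use assms in auto)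

context arc_graph
begin

text \<open>A subgraph \<open>A\<close> that hangs on the rest \<open>C\<close> at a single vertex inherits bridges: if \<open>A\<close> stayed
  connected without the edge \<open>f\<close>, so would \<open>A \<union> C\<close>.\<close>

lemma bridge_side_bridges:
  assumes A: "closedin X A" and C: "closedin X C" and p: "A \<inter> C = {p}" "p \<in> V"
    and conn: "connectedin X (A \<union> C)" and f: "f \<in> E"
    and sub: "closed_arc f \<subseteq> A" and bridge: "\<not> connectedin X ((A \<union> C) - open_arc f)"
  shows "\<not> connectedin X (A - open_arc f)"
proof
  assume 1: "connectedin X (A - open_arc f)"
  have 2: "connectedin X C"
    by (rule connectedin_closed_Un_point[OF C A, of p]) (use p conn in \<open>auto simp: Un_commute Int_commute\<close>)
  have pf: "p \<notin> open_arc f" using interior_V[OF f] p by blast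
  have "open_arc f \<subseteq> A" using sub unfolding closed_arc_eq by blast
  then have "C \<inter> open_arc f \<subseteq> {p}" using p(1) by blast
  then have "C \<inter> open_arc f = {}" using pf by blast
  then have "(A \<union> C) - open_arc f = (A - open_arc f) \<union> C" by blast
  moreover have "connectedin X ((A - open_arc f) \<union> C)"
    by (rule connectedin_Un[OF 1 2]) (use p pf in blast)
  ultimately show False using bridge by simp
qed

text \<open>Induction on the number of edges. The removal of a bridge \<open>e\<close> leaves two connected closed
  pieces, one at each end of \<open>e\<close>, whose edges are again bridges. Both pieces and the closed arc \<open>e\<close>
  itself contract to each of their points, and successive pieces meet in a single point.\<close>

lemma contracts_to_if_all_bridges:
  assumes "U \<subseteq> V" "F \<subseteq> E" "\<And>e. e \<in> F \<Longrightarrow> e 0 \<in> U \<and> e 1 \<in> U"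
    and "connectedin X (U \<union> (\<Union>e\<in>F. closed_arc e))"
    and "\<And>e. e \<in> F \<Longrightarrow> \<not> connectedin X ((U \<union> (\<Union>e\<in>F. closed_arc e)) - open_arc e)"
    and "w \<in> U \<union> (\<Union>e\<in>F. closed_arc e)"
  shows "contracts_to X (U \<union> (\<Union>e\<in>F. closed_arc e)) w"
  using assms
proof (induction "card F" arbitrary: U F w rule: less_induct)
  case less
  define S where "S = U \<union> (\<Union>e\<in>F. closed_arc e)"
  note U = less.prems(1) and F = less.prems(2) and endsF = less.prems(3)
    and conn = less.prems(4)[folded S_def] and bridges = less.prems(5)[folded S_def] and w = less.prems(6)[folded S_def]
  have finF: "finite F" using F finite_E finite_subset by blast
  show ?case unfolding S_def[symmetric]
  proof (cases "F = {}")
    case True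
    then have SU: "S = U" by (simp add: S_def)
    have "S \<subseteq> {w} \<or> S \<subseteq> U - {w}"
      by (rule connectedin_closed_disjoint_cases[OF conn]) (use w SU U in \<open>auto intro!: closedin_V\<close>)
    then have "S = {w}" using w by blast
    then show "contracts_to X S w" using contracts_to_singleton[of w X] U V_sub SU by auto
  next
    case False
    then obtain e where eF: "e \<in> F" by blast
    then have e: "e \<in> E" using F by blast
    have S_e: "S - open_arc e = U \<union> (\<Union>f\<in>F - {e}. closed_arc f)"
    proof
      show "S - open_arc e \<subseteq> U \<union> (\<Union>f\<in>F - {e}. closed_arc f)"
      proof
        fix x assume x: "x \<in> S - open_arc e"
        then consider "x \<in> U" | f where "f \<in> F" "x \<in> closed_arc f" by (auto simp: S_def)
        then show "x \<in> U \<union> (\<Union>f\<in>F - {e}. closed_arc f)"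
        proof cases
          case 2
          then have "f = e \<Longrightarrow> x \<in> U" using x endsF[OF eF] unfolding closed_arc_eq by blast
          then show ?thesis using 2 by blast
        qed simp
      qed
      have "U \<inter> open_arc e = {}" using interior_V[OF e] U by blast
      moreover have "closed_arc f \<inter> open_arc e = {}" if "f \<in> F - {e}" for f
        using open_arc_disjoint[OF e, of f] that F by blast
      ultimately show "U \<union> (\<Union>f\<in>F - {e}. closed_arc f) \<subseteq> S - open_arc e"
        unfolding S_def by blast
    qed
    have "closedin X (S - open_arc e)" unfolding S_e by (rule closedin_subgraph) (use U F in auto)
    then obtain A0 B0 where AB0: "closedin X A0" "closedin X B0" "A0 \<union> B0 = S - open_arc e"
        "A0 \<inter> B0 = {}" "A0 \<noteq> {}" "B0 \<noteq> {}"
      using not_connectedin_closed bridges[OF eF] by metis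
    have e01: "e 0 \<in> S - open_arc e" "e 1 \<in> S - open_arc e" using endsF[OF eF] unfolding S_e by auto
    obtain A B where AB: "closedin X A" "closedin X B" "A \<union> B = S - open_arc e"
        "A \<inter> B = {}" "B \<noteq> {}" "e 0 \<in> A"
    proof (cases "e 0 \<in> A0")
      case True
      then show ?thesis using that[of A0 B0] AB0 by blast
    next
      case False
      then have "e 0 \<in> B0" using e01 AB0 by blast
      then show ?thesis using that[of B0 A0] AB0 by (simp add: Un_commute Int_commute)
    qed
    have arcS: "closed_arc e \<subseteq> S" using eF by (auto simp: S_def)
    have S_split: "S = (A \<union> closed_arc e) \<union> B"
      using AB(3) arcS e01 unfolding closed_arc_eq by blast
    have cle: "closedin X (closed_arc e)" by (rule closedin_e[OF e]) auto
    have arc_sub': "closed_arc e \<inter> (S - open_arc e) \<subseteq> {e 0, e 1}" unfolding closed_arc_eq by blast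
    have subAB: "closed_arc e \<inter> A \<subseteq> {e 0, e 1}" "closed_arc e \<inter> B \<subseteq> {e 0, e 1}"
      using arc_sub' unfolding AB(3)[symmetric] by blast+
    have e0B: "e 0 \<notin> B" using AB(4,6) by blast
    have e1B: "e 1 \<in> B"
    proof (rule ccontr)
      assume "e 1 \<notin> B"
      have "closed_arc e \<inter> B = {}"
        by (rule Int_subset_pair(3)[OF subAB(2) e0B \<open>e 1 \<notin> B\<close>])
      then have disj: "(A \<union> closed_arc e) \<inter> B = {}" using AB(4) by blast
      have "S \<subseteq> A \<union> closed_arc e \<or> S \<subseteq> B"
        by (rule connectedin_closed_disjoint_cases[OF conn closedin_Un[OF AB(1) cle] AB(2) equalityD1[OF S_split] disj])
      moreover have "B \<subseteq> S" using S_split by blast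
      ultimately show False using disj AB(5) e0B e01(1) by blast
    qed
    have Ae: "A \<inter> closed_arc e = {e 0}"
    proof
      have "e 1 \<notin> A" using AB(4) e1B by blast
      then show "A \<inter> closed_arc e \<subseteq> {e 0}" using subAB(1) by (rule Int_subset_pair(1)[rotated])
      show "{e 0} \<subseteq> A \<inter> closed_arc e" using AB(6) unfolding closed_arc_eq by blast
    qed
    have Be: "B \<inter> closed_arc e = {e 1}"
    proof
      show "B \<inter> closed_arc e \<subseteq> {e 1}" by (rule Int_subset_pair(2)[OF subAB(2) e0B])
      show "{e 1} \<subseteq> B \<inter> closed_arc e" using e1B unfolding closed_arc_eq by blast
    qed
    \<comment> \<open>Both ends are treated at once: \<open>T\<close> is the piece, \<open>T'\<close> the opposite one, \<open>C\<close> the rest of the graph.\<close>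
    have side: "contracts_to X T x"
      if T: "closedin X T" and C: "closedin X C" and TC: "T \<union> C = S" and p: "T \<inter> C = {p}" "p \<in> V"
        and T_eq: "T \<subseteq> S - open_arc e" and T': "closedin X T'" "T \<union> T' = S - open_arc e" "T \<inter> T' = {}" and x: "x \<in> T"
      for T C T' p x
    proof -
      define G where "G = {f \<in> F - {e}. closed_arc f \<subseteq> T}"
      have T_sub: "T = (U \<inter> T) \<union> (\<Union>f\<in>G. closed_arc f)"
      proof
        show "T \<subseteq> (U \<inter> T) \<union> (\<Union>f\<in>G. closed_arc f)"
        proof
          fix y assume y: "y \<in> T"
          have "y \<in> U \<union> (\<Union>f\<in>F - {e}. closed_arc f)" by (rule subsetD[OF T_eq[unfolded S_e] y])
          then consider "y \<in> U" | f where "f \<in> F - {e}" "y \<in> closed_arc f"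
            by (rule UnE) (erule that(1), erule UN_E, erule (1) that(2))
          then show "y \<in> (U \<inter> T) \<union> (\<Union>f\<in>G. closed_arc f)"
          proof cases
            case 1
            then show ?thesis using y by blast
          next
            case 2
            have "connectedin X (closed_arc f)" using 2 F by (intro connectedin_e) auto
            moreover have "closed_arc f \<subseteq> T \<union> T'" unfolding T'(2) S_e by (intro le_supI2 UN_upper 2)
            ultimately have "closed_arc f \<subseteq> T \<or> closed_arc f \<subseteq> T'"
              using T T'(1,3) by (intro connectedin_closed_disjoint_cases) auto
            then have "closed_arc f \<subseteq> T" using y 2(2) T'(3) by (metis IntI empty_iff subsetD)
            then have "f \<in> G" using 2 by (simp add: G_def)
            then show ?thesis using 2(2) by (intro UnI2 UN_I)
          qed
        qed
        show "(U \<inter> T) \<union> (\<Union>f\<in>G. closed_arc f) \<subseteq> T"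
          by (intro Un_least Int_lower2 UN_least) (simp add: G_def)
      qed
      have G: "G \<subseteq> F - {e}" "\<And>f. f \<in> G \<Longrightarrow> closed_arc f \<subseteq> T" by (simp_all add: G_def subset_eq)
      have "card G < card F"
        using eF G(1) finF by (intro psubset_card_mono) blast+
      moreover have "U \<inter> T \<subseteq> V" "G \<subseteq> E" using U F G(1) by blast+
      moreover have "f 0 \<in> U \<inter> T \<and> f 1 \<in> U \<inter> T" if "f \<in> G" for f
        using endsF[of f] subsetD[OF G(1) that] subsetD[OF G(2)[OF that]] by (auto simp del: image_subset_iff)
      moreover have "connectedin X T"
        by (rule connectedin_closed_Un_point[OF T C p(1)]) (simp add: TC conn)
      moreover have "\<not> connectedin X (T - open_arc f)" if "f \<in> G" for f
        by (rule bridge_side_bridges[OF T C p])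
           (use subsetD[OF G(1) that] G(2)[OF that] conn bridges[of f] F in \<open>auto simp: TC simp del: image_subset_iff\<close>)
      ultimately show ?thesis
        using less.hyps[of G "U \<inter> T" x] x unfolding T_sub[symmetric] by blast
    qed
    have cA: "contracts_to X A x" if "x \<in> A" for x
    proof (rule side[of A "closed_arc e \<union> B" "e 0" B])
      show "A \<inter> (closed_arc e \<union> B) = {e 0}" using Ae AB(4) by blast
    qed (use AB cle S_split ends[OF e] that in \<open>auto intro: closedin_Un\<close>)
    have cB: "contracts_to X B x" if "x \<in> B" for x
    proof (rule side[of B "closed_arc e \<union> A" "e 1" A])
      show "B \<inter> (closed_arc e \<union> A) = {e 1}" using Be AB(4) by blast
    qed (use AB cle S_split ends[OF e] that in \<open>auto intro: closedin_Un\<close>)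
    have cAe: "contracts_to X (A \<union> closed_arc e) x" if "x \<in> A \<union> closed_arc e" for x
      by (rule contracts_to_Un_all[OF AB(1) cle Ae cA contracts_to_arc[OF e] that])
    show "contracts_to X S w" unfolding S_split
    proof (rule contracts_to_Un_all[OF _ AB(2) _ cAe cB])
      show "(A \<union> closed_arc e) \<inter> B = {e 1}" using Be AB(4) by blast
    qed (use AB cle w S_split in \<open>auto intro: closedin_Un\<close>)
  qed
qed

lemma topspace_eq: "topspace X = V \<union> (\<Union>e\<in>E. closed_arc e)"
  unfolding closed_arc_eq cover using ends by blast

lemma topspace_minus_open_arc:
  assumes "e \<in> E"
  shows "topspace X - open_arc e = V \<union> (\<Union>f\<in>E - {e}. closed_arc f)"
proof
  show "topspace X - open_arc e \<subseteq> V \<union> (\<Union>f\<in>E - {e}. closed_arc f)"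
    unfolding closed_arc_eq cover using ends by blast
  have "V \<inter> open_arc e = {}" using interior_V[OF assms] by blast
  moreover have "closed_arc f \<inter> open_arc e = {}" if "f \<in> E - {e}" for f
    using open_arc_disjoint[OF assms, of f] that by blast
  ultimately show "V \<union> (\<Union>f\<in>E - {e}. closed_arc f) \<subseteq> topspace X - open_arc e"
    unfolding topspace_eq by blast
qed

text \<open>The three cases correspond to first Betti number zero, one, and at least two,
  expressed through bridges: in the first case every edge is a bridge, in the second case there is an edge
  that is no bridge but whose removal leaves only bridges, and in the third case two edges can be
  removed together.\<close>

theorem bridge_trichotomy:
  assumes conn: "connected_space X"
  obtains (tree) "\<And>w. w \<in> topspace X \<Longrightarrow> contracts_to X (topspace X) w"
  | (unicyclic) e where "e \<in> E" "connectedin X (topspace X - open_arc e)"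
      "\<And>w. w \<in> topspace X - open_arc e \<Longrightarrow> contracts_to X (topspace X - open_arc e) w"
  | (bicyclic) e e' where "e \<in> E" "e' \<in> E" "e \<noteq> e'" "connectedin X (topspace X - open_arc e)"
      "connectedin X (topspace X - open_arc e - open_arc e')"
proof (cases "\<exists>e\<in>E. connectedin X (topspace X - open_arc e)")
  case False
  have "contracts_to X (topspace X) w" if "w \<in> topspace X" for w
    using contracts_to_if_all_bridges[of V E w, folded topspace_eq] that conn ends False
    by (auto simp: connectedin_topspace)
  then show thesis by (rule tree)
next
  case True
  then obtain e where e: "e \<in> E" "connectedin X (topspace X - open_arc e)" by blast
  show thesis
  proof (cases "\<exists>e'\<in>E - {e}. connectedin X (topspace X - open_arc e - open_arc e')")
    case True
    then show thesis using bicyclic e by blast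
  next
    case False
    have "contracts_to X (topspace X - open_arc e) w" if "w \<in> topspace X - open_arc e" for w
      using contracts_to_if_all_bridges[of V "E - {e}" w, folded topspace_minus_open_arc[OF e(1)]]
        that e ends False by auto
    then show thesis by (rule unicyclic[OF e])
  qed
qed

text \<open>Without the middle thirds of the edges in \<open>F\<close>: unlike the complement of the open edges this is
  open, and it overlaps each open edge in two end pieces.\<close>

definition band_complement :: "(real \<Rightarrow> 'a) set \<Rightarrow> 'a set" where
  "band_complement F = topspace X - (\<Union>e\<in>F. e ` {1/3..2/3})"

lemma subset_band_complement:
  assumes "S \<subseteq> topspace X" "\<And>f. f \<in> F \<Longrightarrow> S \<inter> f ` {1/3..2/3} = {}"
  shows "S \<subseteq> band_complement F"
proof
  fix x assume x: "x \<in> S"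
  show "x \<in> band_complement F" unfolding band_complement_def
  proof (intro DiffI notI)
    show "x \<in> topspace X" using x assms(1) by (rule subsetD[rotated])
    assume "x \<in> (\<Union>f\<in>F. f ` {1/3..2/3})"
    then obtain f where f: "f \<in> F" "x \<in> f ` {1/3..2/3}" by (rule UN_E)
    have "x \<in> {}" unfolding assms(2)[OF f(1), symmetric] using x f(2) by (rule IntI)
    then show False by (rule emptyE)
  qed
qed

lemma openin_band_complement:
  assumes "F \<subseteq> E"
  shows "openin X (band_complement F)"
  unfolding band_complement_def
proof (intro openin_diff closedin_Union)
  show "finite ((\<lambda>e. e ` {1/3..2/3}) ` F)" using assms finite_E finite_subset by blast
  show "closedin X S" if "S \<in> (\<lambda>e. e ` {1/3..2/3}) ` F" for S
    using that assms by (auto intro!: closedin_e)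
qed auto

lemma middle_disjoint:
  assumes "e \<in> E" "f \<in> E" "T \<subseteq> {0..1}" "T \<inter> {1/3..2/3} = {}"
  shows "e ` T \<inter> f ` {1/3..2/3} = {}"
proof (cases "e = f")
  case True
  have "e ` (T \<inter> {1/3..2/3}) = e ` T \<inter> e ` {1/3..2/3}"
    by (rule inj_on_image_Int[OF inj[OF assms(1)]]) (use assms(3) in auto)
  then show ?thesis using assms(4) True by simp
next
  case False
  have "f ` {1/3..2/3} \<subseteq> open_arc f" by (intro image_mono) auto
  moreover have "e ` T \<subseteq> closed_arc e" by (intro image_mono assms)
  ultimately show ?thesis using open_arc_disjoint[OF assms(2,1)] False by blast
qed

lemma band_complement_eq:
  assumes F: "F \<subseteq> E" "F \<noteq> {}"
  shows "band_complement F =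
    (\<Union>e\<in>F. (topspace X - (\<Union>e\<in>F. open_arc e)) \<union> e ` {0..<1/3} \<union> e ` {2/3<..1})"
proof -
  let ?K = "topspace X - (\<Union>e\<in>F. open_arc e)"
  define piece where "piece e = ?K \<union> e ` {0..<1/3} \<union> e ` {2/3<..1}" for e :: "real \<Rightarrow> 'a"
  have "\<Union>(piece ` F) = band_complement F"
  proof
    have sides: "e ` {0..<1/3} \<union> e ` {2/3<..1} \<subseteq> band_complement F" if e: "e \<in> F" for e
    proof -
      have eE: "e \<in> E" using e F by blast
      have "e ` T \<subseteq> band_complement F" if T: "T \<subseteq> {0..1}" "T \<inter> {1/3..2/3} = {}" for T
      proof (rule subset_band_complement)
        show "e ` T \<subseteq> topspace X" by (rule order_trans[OF image_mono[OF T(1)] arc_sub[OF eE]])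
        show "e ` T \<inter> f ` {1/3..2/3} = {}" if "f \<in> F" for f
          by (rule middle_disjoint[OF eE _ T]) (use that F in blast)
      qed
      note * = this
      have "e ` {0..<1/3} \<subseteq> band_complement F" by (rule *) auto
      moreover have "e ` {2/3<..1} \<subseteq> band_complement F" by (rule *) auto
      ultimately show ?thesis by (rule Un_least)
    qed
    have K: "?K \<subseteq> band_complement F"
    proof -
      have "e ` {1/3..2/3} \<subseteq> open_arc e" for e by (intro image_mono) auto
      then show ?thesis unfolding band_complement_def by blast
    qed
    show "\<Union>(piece ` F) \<subseteq> band_complement F"
      unfolding piece_def Un_assoc by (intro UN_least Un_least[OF K sides])
    show "band_complement F \<subseteq> \<Union>(piece ` F)"
    proof
      fix x assume x: "x \<in> band_complement F"
      show "x \<in> \<Union>(piece ` F)"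
      proof (cases "x \<in> ?K")
        case True
        obtain e where e: "e \<in> F" using F(2) by blast
        have "x \<in> piece e" unfolding piece_def by (intro UnI1 True)
        then show ?thesis by (rule UN_I[OF e])
      next
        case False
        moreover have "x \<in> topspace X" using x unfolding band_complement_def by (rule DiffD1)
        ultimately have "x \<in> (\<Union>e\<in>F. open_arc e)" by simp
        then obtain e where e: "e \<in> F" "x \<in> open_arc e" by (rule UN_E)
        then obtain t where t: "x = e t" "t \<in> {0<..<1}" by (elim imageE)
        have "t \<notin> {1/3..2/3}"
        proof
          assume "t \<in> {1/3..2/3}"
          then have "x \<in> (\<Union>e\<in>F. e ` {1/3..2/3})" unfolding t(1) by (intro UN_I[OF e(1)] imageI)
          then show False using x unfolding band_complement_def by (metis DiffD2)
        qed
        then have "t \<in> {0..<1/3} \<or> t \<in> {2/3<..1}" using t by auto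
        then have "x \<in> piece e" unfolding piece_def t(1) by (meson UnI1 UnI2 imageI)
        then show ?thesis by (rule UN_I[OF e(1)])
      qed
    qed
  qed
  then show ?thesis unfolding piece_def by (rule sym)
qed

lemma connectedin_band_complement:
  assumes F: "F \<subseteq> E" and conn: "connectedin X (topspace X - (\<Union>e\<in>F. open_arc e))"
  shows "connectedin X (band_complement F)"
proof (cases "F = {}")
  case True
  then show ?thesis using conn by (simp add: band_complement_def)
next
  case False
  let ?K = "topspace X - (\<Union>e\<in>F. open_arc e)"
  define piece where "piece e = ?K \<union> e ` {0..<1/3} \<union> e ` {2/3<..1}" for e :: "real \<Rightarrow> 'a"
  have VK: "V \<subseteq> ?K" using V_sub interior_V F by blast
  have "connectedin X (\<Union>(piece ` F))"
  proof (rule connectedin_Union)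
    show "connectedin X S" if S: "S \<in> piece ` F" for S
    proof -
      obtain e where e: "e \<in> F" "S = piece e" using S by blast
      have eE: "e \<in> E" using e F by blast
      have K: "e 0 \<in> ?K" "e 1 \<in> ?K" using eE ends VK by blast+
      have i: "e 0 \<in> e ` {0..<1/3}" "e 1 \<in> e ` {2/3<..1}" by auto
      have c: "connectedin X (e ` {0..<1/3})" "connectedin X (e ` {2/3<..1})"
        by (auto intro!: connectedin_e[OF eE])
      have "connectedin X (?K \<union> e ` {0..<1/3})"
        using IntI[OF K(1) i(1)] by (intro connectedin_Un conn c) (metis empty_iff)
      moreover have "(?K \<union> e ` {0..<1/3}) \<inter> e ` {2/3<..1} \<noteq> {}"
        using IntI[OF UnI1[OF K(2)] i(2)] by (metis empty_iff)
      ultimately show ?thesis unfolding e(2) piece_def by (rule connectedin_Un[OF _ c(2)])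
    qed
    obtain e where "e \<in> F" using False by blast
    then have "e 0 \<in> ?K" using F ends VK by blast
    then show "\<Inter>(piece ` F) \<noteq> {}" unfolding piece_def by blast
  qed
  moreover have "\<Union>(piece ` F) = band_complement F"
    unfolding piece_def by (rule band_complement_eq[OF F False, symmetric])
  ultimately show ?thesis by simp
qed

lemma open_arc_Int_band_complement:
  assumes F: "F \<subseteq> E" and e: "e \<in> F"
  shows "open_arc e \<inter> band_complement F = e ` {0<..<1/3} \<union> e ` {2/3<..<1}"
proof
  show "open_arc e \<inter> band_complement F \<subseteq> e ` {0<..<1/3} \<union> e ` {2/3<..<1}"
  proof
    fix x assume x: "x \<in> open_arc e \<inter> band_complement F"
    then obtain t where t: "x = e t" "t \<in> {0<..<1}" by (elim IntE imageE)
    have "t \<notin> {1/3..2/3}"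
    proof
      assume "t \<in> {1/3..2/3}"
      then have "x \<in> (\<Union>e\<in>F. e ` {1/3..2/3})" unfolding t(1) by (intro UN_I[OF e] imageI)
      then show False using x unfolding band_complement_def by (metis DiffD2 IntD2)
    qed
    then have "t \<in> {0<..<1/3} \<or> t \<in> {2/3<..<1}" using t(2) by auto
    then show "x \<in> e ` {0<..<1/3} \<union> e ` {2/3<..<1}" unfolding t(1) by (meson UnI1 UnI2 imageI)
  qed
  have eE: "e \<in> E" using e F by blast
  have "e ` T \<subseteq> open_arc e \<inter> band_complement F" if T: "T \<subseteq> {0<..<1}" "T \<inter> {1/3..2/3} = {}" for T
  proof (intro Int_greatest subset_band_complement image_mono T)
    have T': "T \<subseteq> {0..1}" using T(1) by auto
    show "e ` T \<subseteq> topspace X" by (rule order_trans[OF image_mono[OF T'] arc_sub[OF eE]])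
    show "e ` T \<inter> f ` {1/3..2/3} = {}" if "f \<in> F" for f
      by (rule middle_disjoint[OF eE _ T' T(2)]) (use that F in blast)
  qed
  note * = this
  have "e ` {0<..<1/3} \<subseteq> open_arc e \<inter> band_complement F" by (rule *) auto
  moreover have "e ` {2/3<..<1} \<subseteq> open_arc e \<inter> band_complement F" by (rule *) auto
  ultimately show "e ` {0<..<1/3} \<union> e ` {2/3<..<1} \<subseteq> open_arc e \<inter> band_complement F"
    by (rule Un_least)
qed

lemma topspace_eq_band_complement:
  assumes "F \<subseteq> E"
  shows "topspace X = band_complement F \<union> (\<Union>e\<in>F. open_arc e)"
proof -
  have set: "T = (T - M) \<union> B" if "M \<subseteq> B" "B \<subseteq> T" for T M B :: "'a set" using that by blast
  have "(\<Union>e\<in>F. e ` {1/3..2/3}) \<subseteq> (\<Union>e\<in>F. open_arc e)"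
    by (intro UN_mono image_mono) auto
  moreover have "(\<Union>e\<in>F. open_arc e) \<subseteq> topspace X"
    by (intro UN_least openin_subset openin_open_arc) (use assms in blast)
  ultimately show ?thesis unfolding band_complement_def by (rule set)
qed

end


section \<open>The fundamental group of a graph with one cycle\<close>

lemma free_group_rank_0:
  assumes G: "group G" and trivial: "carrier G = {\<one>\<^bsub>G\<^esub>}"
  shows "free_group_of_rank G 0"
  unfolding free_group_of_rank_def free_basis_def
  using G trivial group.generate_empty[OF G] by (intro conjI exI[of _ "{}"]) auto

lemma reduced_word_one_letter:
  assumes "reduced_word w" "set w \<subseteq> {g} \<times> UNIV"
  shows "\<exists>b. w = replicate (length w) (g, b)"
  using assms
proof (induction w rule: induct_list012)
  case (3 x y zs)
  then have red: "reduced_word (y # zs)" and xy: "snd x = snd y"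
    by (auto simp: reduced_word_def case_prod_beta)
  obtain b where "y # zs = replicate (length (y # zs)) (g, b)" using "3.IH"(2) red "3.prems"(2) by auto
  then have b: "y = (g, b)" "zs = replicate (length zs) (g, b)" by auto
  have "x = (g, b)" using xy b(1) "3.prems"(2) by (cases x) auto
  then show ?case using b by (intro exI[of _ b]) simp
qed auto

text \<open>A reduced word in a single letter is a power of the letter or of its inverse.\<close>

lemma free_group_rank_1:
  fixes G (structure) and C :: "int \<Rightarrow> 'g"
  assumes G: "group G" and onto: "carrier G = range C"
    and hom: "\<And>m n. C m \<otimes> C n = C (m + n)"
    and free: "\<And>n. C n = \<one> \<Longrightarrow> n = 0"
  shows "free_group_of_rank G 1"
proof -
  interpret group G by fact
  have closed: "C n \<in> carrier G" for n using onto by auto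
  have C0: "C 0 = \<one>"
    using hom[of 0 0] closed by (simp add: l_cancel_one)
  have inv: "inv (C n) = C (- n)" for n
    by (rule inv_equality) (simp_all add: hom C0 closed)
  have sub: "subgroup (generate G {C 1}) G" by (rule generate_is_subgroup) (simp add: closed)
  have nat: "C (int n) \<in> generate G {C 1}" for n
  proof (induction n)
    case 0
    then show ?case by (simp add: C0 generate.one)
  next
    case (Suc n)
    have "C (int n) \<otimes> C 1 \<in> generate G {C 1}"
      by (rule generate.eng[OF Suc]) (simp add: generate.incl)
    then show ?case by (simp add: hom add.commute)
  qed
  have "C n \<in> generate G {C 1}" for n
  proof (cases "n \<ge> 0")
    case True
    then show ?thesis using nat[of "nat n"] by simp
  next
    case False
    then obtain k where k: "n = - int k" by (intro that[of "nat (- n)"]) simp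
    have "inv (C (int k)) \<in> generate G {C 1}" using subgroup.m_inv_closed[OF sub nat] .
    then show ?thesis by (simp add: inv k)
  qed
  then have gen: "generate G {C 1} = carrier G"
    using onto generate_in_carrier[of "{C 1}"] closed by auto
  have pos: "eval_word G (replicate n (C 1, True)) = C (int n)" for n
    by (induction n) (simp_all add: eval_word_def C0 hom)
  have neg: "eval_word G (replicate n (C 1, False)) = C (- int n)" for n
    by (induction n) (simp_all add: eval_word_def C0 hom inv)
  have "eval_word G w \<noteq> \<one>" if w: "set w \<subseteq> {C 1} \<times> UNIV" "reduced_word w" "w \<noteq> []" for w
  proof -
    from reduced_word_one_letter[OF w(2,1)] obtain b where b: "w = replicate (length w) (C 1, b)" ..
    have "eval_word G w = eval_word G (replicate (length w) (C 1, b))" by (rule arg_cong[OF b])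
    also have "\<dots> = C (if b then int (length w) else - int (length w))" by (cases b) (simp_all add: pos neg)
    finally have "eval_word G w = C (if b then int (length w) else - int (length w))" .
    moreover have "(if b then int (length w) else - int (length w)) \<noteq> 0" using w(3) by auto
    ultimately show ?thesis using free by metis
  qed
  then have "free_basis G {C 1}" unfolding free_basis_def using closed gen by blast
  then show ?thesis unfolding free_group_of_rank_def using G by (intro conjI exI[of _ "{C 1}"]) auto
qed

lemma trivial_fundamental_group:
  assumes w: "w \<in> topspace X" and c: "contracts_to X (topspace X) w"
  shows "free_group_of_rank (fundamental_group X w) 0"
proof (rule free_group_rank_0[OF group_fundamental_group[OF w]])
  have "loop_class X w p = loop_class X w (\<lambda>_. w)" if p: "p \<in> loops_at X w" for p
  proof -
    have "homotopic_with (\<lambda>l. l 0 = w \<and> l 1 = w) (top_of_set {0..1}) X (id \<circ> p) ((\<lambda>_. w) \<circ> p)"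
      by (rule homotopic_with_compose_continuous_map_right[of "\<lambda>g. g w = w"])
         (use c p in \<open>auto simp: contracts_to_def loops_at_def pathin_def\<close>)
    then have "(p, \<lambda>_. w) \<in> loop_homotopy X w" by (simp add: loop_homotopy_def o_def)
    then show ?thesis by (simp add: loop_class_eq_iff[OF p])
  qed
  then have "loop_class X w ` loops_at X w = (\<lambda>_. loop_class X w (\<lambda>_. w)) ` loops_at X w"
    by (rule image_cong[OF refl])
  also have "\<dots> = {loop_class X w (\<lambda>_. w)}" by (rule image_constant[OF const_loop[OF w]])
  finally show "carrier (fundamental_group X w) = {\<one>\<^bsub>fundamental_group X w\<^esub>}"
    unfolding carrier_fundamental_group one_fundamental_group .
qed

lemma continuous_map_periodic:
  assumes p: "p \<in> loops_at X y"
  shows "continuous_map euclideanreal X (\<lambda>u. p (frac u))"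
proof (rule pasting_lemma_locally_finite[where T = "\<lambda>i::int. {of_int i..of_int i + 1}" and f = "\<lambda>i u. p (u - of_int i)" and I = UNIV])
  have p01: "p 0 = y" "p 1 = y" "continuous_map (top_of_set {0..1}) X p"
    using p by (auto simp: loops_at_def pathin_def)
  fix x :: real
  show "\<exists>V. openin euclideanreal V \<and> x \<in> V \<and> finite {i \<in> UNIV. {real_of_int i..real_of_int i + 1} \<inter> V \<noteq> {}}"
  proof (intro exI[of _ "{x - 1<..<x + 1}"] conjI)
    have "i \<in> {\<lfloor>x\<rfloor> - 3..\<lfloor>x\<rfloor> + 3}" if "{real_of_int i..real_of_int i + 1} \<inter> {x - 1<..<x + 1} \<noteq> {}" for i
    proof -
      obtain z where "real_of_int i \<le> z" "z \<le> real_of_int i + 1" "x - 1 < z" "z < x + 1" using \<open>_ \<noteq> {}\<close> by auto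
      then have "real_of_int i < x + 1" "x - 2 < real_of_int i" by linarith+
      then show ?thesis unfolding atLeastAtMost_iff by linarith
    qed
    then have "{i \<in> UNIV. {real_of_int i..real_of_int i + 1} \<inter> {x - 1<..<x + 1} \<noteq> {}} \<subseteq> {\<lfloor>x\<rfloor> - 3..\<lfloor>x\<rfloor> + 3}"
    proof (intro subsetI, elim CollectE conjE)
      fix i assume "{real_of_int i..real_of_int i + 1} \<inter> {x - 1<..<x + 1} \<noteq> {}"
      then show "i \<in> {\<lfloor>x\<rfloor> - 3..\<lfloor>x\<rfloor> + 3}" by fact
    qed
    then show "finite {i \<in> UNIV. {real_of_int i..real_of_int i + 1} \<inter> {x - 1<..<x + 1} \<noteq> {}}"
      by (rule finite_subset[OF _ finite_atLeastAtMost_int])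
  qed auto
  show "\<exists>j. j \<in> UNIV \<and> x \<in> {real_of_int j..real_of_int j + 1} \<and> p (frac x) = p (x - real_of_int j)"
    by (intro exI[of _ "\<lfloor>x\<rfloor>"]) (simp add: frac_def real_of_int_floor_add_one_ge)
  show "closedin euclideanreal {real_of_int i..real_of_int i + 1}" for i by auto
  show "continuous_map (subtopology euclideanreal {real_of_int i..real_of_int i + 1}) X (\<lambda>u. p (u - real_of_int i))" for i
    by (rule continuous_map_compose_on[OF p01(3)]) (auto intro!: continuous_intros)
  show "p (x - real_of_int i) = p (x - real_of_int j)"
    if x: "x \<in> topspace euclideanreal \<inter> {real_of_int i..real_of_int i + 1} \<inter> {real_of_int j..real_of_int j + 1}" for i j
  proof -
    have "real_of_int i \<le> x" "x \<le> real_of_int i + 1" "real_of_int j \<le> x" "x \<le> real_of_int j + 1"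
      using x by auto
    then consider "i = j" | "j = i + 1" | "i = j + 1" by linarith
    then show ?thesis
    proof cases
      case 2
      then have "x - real_of_int i = 1" "x - real_of_int j = 0" using x by auto
      then show ?thesis using p01 by simp
    next
      case 3
      then have "x - real_of_int i = 0" "x - real_of_int j = 1" using x by auto
      then show ?thesis using p01 by simp
    qed simp
  qed
qed

text \<open>The class of \<open>p\<close> run through \<open>n\<close> times, as the image of the segment from \<open>0\<close> to \<open>n\<close> under the
  periodic extension of \<open>p\<close> to the real line. Any other path from \<open>0\<close> to \<open>n\<close> would give the same
  class.\<close>

definition winding_class :: "'a topology \<Rightarrow> 'a \<Rightarrow> (real \<Rightarrow> 'a) \<Rightarrow> int \<Rightarrow> (real \<Rightarrow> 'a) set" where
  "winding_class X y p n = loop_class X y (\<lambda>t. p (frac (of_int n * t)))"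

context
  fixes X :: "'a topology" and y :: 'a and p :: "real \<Rightarrow> 'a"
  assumes p: "p \<in> loops_at X y"
begin

lemma frac_loop:
  assumes "continuous_on {0..1} \<alpha>" "\<alpha> 0 = 0" "\<alpha> 1 \<in> \<int>"
  shows "(\<lambda>t. p (frac (\<alpha> t))) \<in> loops_at X y"
proof -
  have "p 0 = y" using p by (simp add: loops_at_def)
  moreover have "pathin X (\<lambda>t. p (frac (\<alpha> t)))" unfolding pathin_def
    by (rule continuous_map_compose_on[of UNIV]) (use continuous_map_periodic[OF p] assms in auto)
  ultimately show ?thesis using assms by (auto simp: loops_at_def frac_eq_0_iff[THEN iffD2])
qed

lemma winding_class_lift:
  assumes a: "continuous_on {0..1} \<alpha>" "\<alpha> 0 = 0" "\<alpha> 1 = of_int n"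
  shows "loop_class X y (\<lambda>t. p (frac (\<alpha> t))) = winding_class X y p n"
proof -
  have "p 0 = y" using p by (simp add: loops_at_def)
  then have "(\<lambda>t. p (frac (\<alpha> t)), \<lambda>t. p (frac (of_int n * t))) \<in> loop_homotopy X y"
    by (intro loop_homotopy_convex[of UNIV]) (use continuous_map_periodic[OF p] a in \<open>auto intro!: continuous_intros\<close>)
  then show ?thesis
    unfolding winding_class_def using frac_loop[OF a(1,2)] a(3) by (subst loop_class_eq_iff) auto
qed

lemma winding_class_in: "winding_class X y p n \<in> carrier (fundamental_group X y)"
  unfolding winding_class_def carrier_fundamental_group
  by (intro imageI frac_loop) (auto intro!: continuous_intros)

lemma winding_class_add:
  "winding_class X y p m \<otimes>\<^bsub>fundamental_group X y\<^esub> winding_class X y p n = winding_class X y p (m + n)"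
proof -
  define \<alpha> where "\<alpha> t = (if t \<le> 1/2 then of_int m * (2 * t) else of_int m + of_int n * (2 * t - 1))" for t :: real
  have per: "frac (of_int m + u) = frac u" for u :: real by (simp add: frac_def)
  have "winding_class X y p m \<otimes>\<^bsub>fundamental_group X y\<^esub> winding_class X y p n =
      loop_class X y (join_loops (\<lambda>t. p (frac (of_int m * t))) (\<lambda>t. p (frac (of_int n * t))))"
    unfolding winding_class_def
    by (intro mult_fundamental_group frac_loop) (auto intro!: continuous_intros)
  also have "join_loops (\<lambda>t. p (frac (of_int m * t))) (\<lambda>t. p (frac (of_int n * t))) = (\<lambda>t. p (frac (\<alpha> t)))"
    by (rule ext) (simp add: join_loops_def \<alpha>_def per)
  also have "loop_class X y (\<lambda>t. p (frac (\<alpha> t))) = winding_class X y p (m + n)"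
  proof (rule winding_class_lift)
    show "continuous_on {0..1} \<alpha>" unfolding \<alpha>_def
      by (rule continuous_on_if_le) (auto intro!: continuous_intros)
  qed (auto simp: \<alpha>_def)
  finally show ?thesis .
qed

end

text \<open>An action in which some class shifts the integers by one excludes torsion. That class is the
  \<open>n\<close>-th power of the generator for some \<open>n\<close>; if the \<open>k\<close>-th power of the generator were trivial, then so
  would be the \<open>k\<close>-th power of the shift.\<close>

lemma winding_class_eq_one:
  assumes p: "p \<in> loops_at X y"
    and onto: "carrier (fundamental_group X y) = range (winding_class X y p)"
    and act: "bijection_action (fundamental_group X y) act"
    and S: "S \<in> carrier (fundamental_group X y)" and shift: "\<And>i::int. act S i = i + 1"
    and one: "winding_class X y p k = \<one>\<^bsub>fundamental_group X y\<^esub>"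
  shows "k = 0"
proof -
  let ?G = "fundamental_group X y" and ?C = "winding_class X y p"
  interpret bijection_action ?G act by fact
  have closed: "?C n \<in> carrier ?G" for n by (rule winding_class_in[OF p])
  have C0: "?C 0 = \<one>\<^bsub>?G\<^esub>"
    using winding_class_add[OF p, of 0 0] closed by (simp add: l_cancel_one)
  obtain n where n: "S = ?C n" using S onto by auto
  have pow: "?C i [^]\<^bsub>?G\<^esub> (j::nat) = ?C (i * int j)" for i j
    by (induction j) (simp_all add: C0 winding_class_add[OF p] algebra_simps)
  have neg: "?C (- k) = \<one>\<^bsub>?G\<^esub>"
    using winding_class_add[OF p, of k "- k"] closed by (simp add: one C0)
  have abs: "?C \<bar>k\<bar> = \<one>\<^bsub>?G\<^esub>" using one neg by (cases "k \<ge> 0") auto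
  have kn: "?C (\<bar>k\<bar> * n) = \<one>\<^bsub>?G\<^esub>"
  proof (cases "n \<ge> 0")
    case True
    then show ?thesis using pow[of "\<bar>k\<bar>" "nat n"] by (simp add: abs)
  next
    case False
    then have "?C (- (\<bar>k\<bar> * n)) = \<one>\<^bsub>?G\<^esub>" using pow[of "\<bar>k\<bar>" "nat (- n)"] by (simp add: abs)
    then show ?thesis using winding_class_add[OF p, of "\<bar>k\<bar> * n" "- (\<bar>k\<bar> * n)"] closed by (simp add: C0)
  qed
  have "S [^]\<^bsub>?G\<^esub> nat \<bar>k\<bar> = \<one>\<^bsub>?G\<^esub>"
    unfolding n pow using kn by (simp add: mult.commute)
  then have "act S ^^ nat \<bar>k\<bar> = id" using act_pow[OF S, of "nat \<bar>k\<bar>"] by (simp add: act_one)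
  moreover have "(act S ^^ m) 0 = int m" for m by (induction m) (simp_all add: shift)
  ultimately have "int (nat \<bar>k\<bar>) = 0" by (metis id_apply)
  then show ?thesis by simp
qed

context arc_graph
begin

text \<open>Contract the complement \<open>K\<close> of the open edge \<open>e\<close> to \<open>y\<close>. Meanwhile the ends of \<open>e\<close> travel along
  their tracks in \<open>K\<close>, and \<open>e\<close> is stretched over the part of these tracks that has been passed. In the
  end \<open>K\<close> has become the point \<open>y\<close> and \<open>e\<close> a loop \<open>p\<close>, so the identity is homotopic to a map that factors
  through a circle.\<close>

lemma unicyclic_retraction:
  assumes e: "e \<in> E" and y: "y \<in> topspace X - open_arc e"
    and c: "contracts_to X (topspace X - open_arc e) y"
  obtains p d r where "p \<in> loops_at X y"
    "continuous_map (subtopology X (closed_arc e)) (top_of_set {0..1}) d" "\<And>t. t \<in> {0..1} \<Longrightarrow> d (e t) = t"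
    "homotopic_with (\<lambda>g. g y = y) X X id r"
    "\<And>x. x \<in> topspace X - open_arc e \<Longrightarrow> r x = y" "\<And>x. x \<in> open_arc e \<Longrightarrow> r x = p (d x)"
proof -
  let ?I = "top_of_set {0..1::real}"
  define K where "K = topspace X - open_arc e"
  define Q where "Q = closed_arc e"
  have clK: "closedin X K" unfolding K_def using openin_open_arc[OF e] by blast
  have clQ: "closedin X Q" unfolding Q_def by (rule closedin_e[OF e]) auto
  have KQ: "topspace X \<subseteq> K \<union> Q" unfolding K_def Q_def closed_arc_eq by blast
  have Ksub: "K \<subseteq> topspace X" "y \<in> K" using y unfolding K_def by simp_all
  have eK: "e 0 \<in> K" "e 1 \<in> K" unfolding K_def using ends[OF e] V_sub interior_V[OF e] by blast+
  obtain d where d: "continuous_map (subtopology X Q) ?I d" "\<And>t. t \<in> {0..1} \<Longrightarrow> d (e t) = t"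
    using arc_coordinate[OF e] unfolding Q_def by blast
  have QE: "\<exists>t\<in>{0..1}. x = e t" if "x \<in> Q" for x using that unfolding Q_def by (elim imageE) blast
  have KQ_ends: "x = e 0 \<or> x = e 1" if "x \<in> K" "x \<in> Q" for x
    using that unfolding K_def Q_def closed_arc_eq by (metis DiffD2 UnE empty_iff insert_iff)
  from c Ksub obtain h where h: "continuous_map (prod_topology ?I (subtopology X K)) (subtopology X K) h"
      and h_simps: "\<forall>x\<in>K. h (0, x) = x" "\<forall>x\<in>K. h (1, x) = y" "\<forall>t\<in>{0..1}. h (t, y) = y"
    unfolding K_def[symmetric] contracts_to_iff[OF Ksub(2,1)] by blast
  have hX: "continuous_map (prod_topology ?I (subtopology X K)) X h"
    using h by (rule continuous_map_into_fulltopology)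
  have trace: "continuous_map ?I X (\<lambda>s. h (s, x))" if x: "x \<in> K" for x
  proof -
    have "continuous_map ?I (prod_topology ?I (subtopology X K)) (\<lambda>s. (s, x))"
      by (intro continuous_map_pairedI) (use x Ksub in auto)
    from continuous_map_compose[OF this hX] show ?thesis by (simp add: o_def)
  qed
  \<comment> \<open>The track of \<open>e 0\<close> backwards, the edge, and the track of \<open>e 1\<close>, on \<open>[-1, 0]\<close>, \<open>[0, 1]\<close> and \<open>[1, 2]\<close>;
    at time \<open>s\<close> the edge occupies the parameters \<open>[-s, 1 + s]\<close>.\<close>
  define \<kappa> where "\<kappa> u = (if u \<le> 0 then h (- u, e 0) else if u \<le> 1 then e u else h (u - 1, e 1))" for u
  have \<kappa>: "continuous_map (top_of_set {-1..2}) X \<kappa>"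
    unfolding \<kappa>_def
  proof (rule continuous_map_cases_le)
    show "continuous_map (subtopology (top_of_set {-1..2}) {u \<in> topspace (top_of_set {-1..2}). u \<le> 0}) X (\<lambda>u. h (- u, e 0))"
      unfolding subtopology_subtopology
      by (rule continuous_map_compose_on[OF trace[OF eK(1)]]) (auto intro!: continuous_intros)
    show "continuous_map (subtopology (top_of_set {-1..2}) {u \<in> topspace (top_of_set {-1..2}). 0 \<le> u}) X
        (\<lambda>u. if u \<le> 1 then e u else h (u - 1, e 1))"
      unfolding subtopology_subtopology
    proof (rule continuous_map_cases_le)
      show "continuous_map (subtopology (top_of_set ({-1..2} \<inter> {u \<in> topspace (top_of_set {-1..2}). 0 \<le> u}))
         {u \<in> topspace (top_of_set ({-1..2} \<inter> {u \<in> topspace (top_of_set {-1..2}). 0 \<le> u})). u \<le> 1}) X e"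
        unfolding subtopology_subtopology
        by (rule continuous_map_compose_on[OF continuous_e[OF e], where g = "\<lambda>u. u"]) (auto intro!: continuous_intros)
      show "continuous_map (subtopology (top_of_set ({-1..2} \<inter> {u \<in> topspace (top_of_set {-1..2}). 0 \<le> u}))
         {u \<in> topspace (top_of_set ({-1..2} \<inter> {u \<in> topspace (top_of_set {-1..2}). 0 \<le> u})). 1 \<le> u}) X (\<lambda>u. h (u - 1, e 1))"
        unfolding subtopology_subtopology
        by (rule continuous_map_compose_on[OF trace[OF eK(2)]]) (auto intro!: continuous_intros)
    qed (use h_simps(1) eK in \<open>auto intro!: continuous_intros\<close>)
  qed (use h_simps(1) eK in \<open>auto intro!: continuous_intros\<close>)
  define H where "H z = (if z \<in> {0..1} \<times> K then h z else \<kappa> (d (snd z) * (1 + 2 * fst z) - fst z))" for z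
  define p where "p t = \<kappa> (3 * t - 1)" for t
  define r where "r x = H (1, x)" for x
  let ?Z = "prod_topology ?I X"
  have subZ: "subtopology ?Z ({0..1} \<times> T) = prod_topology ?I (subtopology X T)" for T
    unfolding subtopology_Times by (simp add: subtopology_subtopology)
  have H: "continuous_map ?Z X H"
    unfolding H_def
  proof (rule continuous_map_closed_Un)
    show "closedin ?Z ({0..1} \<times> K)" "closedin ?Z ({0..1} \<times> Q)"
      using clK clQ by (simp_all add: closedin_prod_Times_iff)
    show "continuous_map (subtopology ?Z ({0..1} \<times> K)) X h" unfolding subZ by (rule hX)
    let ?u = "\<lambda>z. d (snd z) * (1 + 2 * fst z) - fst z"
    have "continuous_map (prod_topology ?I (subtopology X Q)) (top_of_set {-1..2}) ?u"
      unfolding continuous_map_in_subtopology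
    proof
      have "continuous_map (prod_topology ?I (subtopology X Q)) euclideanreal (\<lambda>z. d (snd z))"
        "continuous_map (prod_topology ?I (subtopology X Q)) euclideanreal fst"
        using continuous_map_compose[OF continuous_map_snd d(1)] continuous_map_fst[of ?I "subtopology X Q"]
        by (auto simp: o_def continuous_map_in_subtopology)
      then show "continuous_map (prod_topology ?I (subtopology X Q)) euclideanreal ?u"
        by (intro continuous_intros)
      show "?u \<in> topspace (prod_topology ?I (subtopology X Q)) \<rightarrow> {-1..2}"
      proof (rule Pi_I)
        fix z assume "z \<in> topspace (prod_topology ?I (subtopology X Q))"
        then have z: "fst z \<in> {0..1}" "snd z \<in> Q" by auto
        then have dz: "d (snd z) \<in> {0..1}" using QE d(2) by metis
        have st: "0 \<le> fst z" "fst z \<le> 1" using z(1) by simp_all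
        define q where "q = d (snd z) * (1 + 2 * fst z)"
        have "q \<le> 1 * (1 + 2 * fst z)" unfolding q_def
          by (rule mult_right_mono) (use dz st in simp_all)
        moreover have "0 \<le> q" unfolding q_def using dz st by simp
        ultimately have "-1 \<le> q - fst z" "q - fst z \<le> 2" using st by simp_all
        then show "?u z \<in> {-1..2}" by (simp add: q_def)
      qed
    qed
    from continuous_map_compose[OF this \<kappa>]
    show "continuous_map (subtopology ?Z ({0..1} \<times> Q)) X (\<lambda>z. \<kappa> (?u z))"
      unfolding subZ by (simp add: o_def)
    show "topspace ?Z \<subseteq> {0..1} \<times> K \<union> {0..1} \<times> Q" using KQ by auto
    fix z assume z1: "z \<in> {0..1::real} \<times> K" and z2: "z \<in> {0..1} \<times> Q"
    obtain s x where z: "z = (s, x)" "0 \<le> s" "s \<le> 1" "x \<in> K" "x \<in> Q" using z1 z2 by (cases z) auto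
    have "h (s, x) = \<kappa> (d x * (1 + 2 * s) - s)"
    proof (cases "x = e 0")
      case True
      then have "d x = 0" using d(2)[of 0] by simp
      then show ?thesis using z(2) True by (simp add: \<kappa>_def)
    next
      case False
      then have x: "x = e 1" using KQ_ends z(4,5) by blast
      then have dx: "d x = 1" using d(2)[of 1] by simp
      show ?thesis
      proof (cases "s = 0")
        case True
        then show ?thesis using dx x h_simps(1) eK by (simp add: \<kappa>_def)
      next
        case False
        then show ?thesis using dx x z(2) by (simp add: \<kappa>_def algebra_simps)
      qed
    qed
    then show "h z = \<kappa> (?u z)" by (simp add: z(1))
  qed
  have p: "p \<in> loops_at X y"
  proof -
    have "pathin X p" unfolding pathin_def p_def
      by (rule continuous_map_compose_on[OF \<kappa>]) (auto intro!: continuous_intros)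
    moreover have "p 0 = y" "p 1 = y" using h_simps(2) eK by (simp_all add: p_def \<kappa>_def)
    ultimately show ?thesis by (simp add: loops_at_def)
  qed
  have HK: "H (s, x) = h (s, x)" if "s \<in> {0..1}" "x \<in> K" for s x using that by (simp add: H_def)
  have HQ: "H (s, x) = \<kappa> (d x * (1 + 2 * s) - s)" if "x \<notin> K" for s x using that by (simp add: H_def)
  have H0: "H (0, x) = x" if x: "x \<in> topspace X" for x
  proof (cases "x \<in> K")
    case True
    then show ?thesis using HK[of 0 x] h_simps(1) by simp
  next
    case False
    then have "x \<in> Q" using x KQ by blast
    then obtain t where t: "t \<in> {0..1}" "x = e t" using QE by blast
    then have "t \<noteq> 0" using False eK by metis
    then show ?thesis using t False d(2) by (simp add: HQ \<kappa>_def)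
  qed
  have "homotopic_with (\<lambda>g. g y = y) X X id r"
  proof (subst homotopic_with)
    have "\<forall>s\<in>{0..1}. H (s, y) = y" using HK Ksub(2) h_simps(3) by simp
    then show "\<exists>h. continuous_map (prod_topology ?I X) X h \<and> (\<forall>x\<in>topspace X. h (0, x) = id x) \<and>
        (\<forall>x\<in>topspace X. h (1, x) = r x) \<and> (\<forall>t\<in>{0..1}. h (t, y) = y)"
      using H H0 by (intro exI[of _ H]) (simp add: r_def)
  qed (use Ksub in auto)
  moreover have "r x = y" if "x \<in> K" for x using that HK h_simps(2) by (simp add: r_def)
  moreover have "r x = p (d x)" if "x \<in> open_arc e" for x
  proof -
    have "x \<notin> K" using that by (simp add: K_def)
    then show ?thesis by (simp add: r_def HQ p_def algebra_simps)
  qed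
  ultimately show thesis using that p d unfolding K_def Q_def by blast
qed

end


context arc_graph
begin

lemma path_connectedin_contracts_to:
  assumes S: "S \<subseteq> topspace X" and c: "contracts_to X S y"
  shows "path_connectedin X S"
proof -
  have "homotopic_with (\<lambda>_. True) (subtopology X S) (subtopology X S) id (\<lambda>_. y)"
    using c unfolding contracts_to_def by (rule homotopic_with_mono) simp
  then have "contractible_space (subtopology X S)" unfolding contractible_space_def by blast
  then show ?thesis
    using contractible_imp_path_connected_space S by (simp add: path_connectedin_def)
qed

lemma path_connectedin_e:
  assumes e: "e \<in> E" and T: "T \<subseteq> {0..1}" "path_connected T"
  shows "path_connectedin X (e ` T)"
  by (rule path_connectedin_continuous_map_image[OF continuous_e[OF e]])
     (use T in \<open>simp add: path_connectedin_subtopology\<close>)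

text \<open>Collapsing the complement of the open edge turns \<open>X\<close> into a circle; a continuous logarithm of
  the image of the loop \<open>q\<close> in the unit circle counts how often \<open>q\<close> passes the edge.\<close>

lemma lift_through_circle:
  assumes e: "e \<in> E" and y: "y \<in> topspace X - open_arc e" and q: "q \<in> loops_at X y"
    and d: "continuous_map (subtopology X (closed_arc e)) (top_of_set {0..1}) d" "\<And>t. t \<in> {0..1} \<Longrightarrow> d (e t) = t"
  obtains \<alpha> where "continuous_on {0..1} \<alpha>" "\<alpha> 0 = 0" "\<alpha> 1 \<in> \<int>"
    "\<And>t. t \<in> {0..1} \<Longrightarrow> q t \<in> topspace X - open_arc e \<Longrightarrow> frac (\<alpha> t) = 0"
    "\<And>t. t \<in> {0..1} \<Longrightarrow> q t \<in> open_arc e \<Longrightarrow> frac (\<alpha> t) = d (q t)"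
proof -
  define K where "K = topspace X - open_arc e"
  define Q where "Q = closed_arc e"
  have clK: "closedin X K" unfolding K_def using openin_open_arc[OF e] by blast
  have clQ: "closedin X Q" unfolding Q_def by (rule closedin_e[OF e]) auto
  have KQ: "topspace X \<subseteq> K \<union> Q" unfolding K_def Q_def closed_arc_eq by blast
  have KQ_ends: "x = e 0 \<or> x = e 1" if "x \<in> K" "x \<in> Q" for x
    using that unfolding K_def Q_def closed_arc_eq by (metis DiffD2 UnE empty_iff insert_iff)
  define \<theta> :: "'a \<Rightarrow> complex" where "\<theta> x = (if x \<in> K then 1 else exp (of_real (d x) * (2 * of_real pi * \<i>)))" for x
  have "continuous_map X euclidean \<theta>"
    unfolding \<theta>_def
  proof (rule continuous_map_closed_Un[OF clK _ clQ _ KQ])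
    have "continuous_map (top_of_set {0..1}) euclidean (\<lambda>u. exp (complex_of_real u * (2 * of_real pi * \<i>)))"
      by (auto intro!: continuous_intros)
    from continuous_map_compose[OF d(1)[folded Q_def] this]
    show "continuous_map (subtopology X Q) euclidean (\<lambda>x. exp (of_real (d x) * (2 * of_real pi * \<i>)))"
      by (simp add: o_def)
    fix x assume "x \<in> K" "x \<in> Q"
    then have "x = e 0 \<or> x = e 1" by (rule KQ_ends)
    then have "d x = 0 \<or> d x = 1" using d(2)[of 0] d(2)[of 1] by auto
    then show "1 = exp (complex_of_real (d x) * (2 * of_real pi * \<i>))" by auto
  qed auto
  moreover have "continuous_map (top_of_set {0..1}) X q" using q by (simp add: loops_at_def pathin_def)
  ultimately have "continuous_map (top_of_set {0..1}) euclidean (\<lambda>t. \<theta> (q t))"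
    using continuous_map_compose[of "top_of_set {0..1}" X q euclidean \<theta>] by (simp add: o_def)
  then have "continuous_on {0..1} (\<lambda>t. \<theta> (q t))" by simp
  moreover have "contractible {0..1::real}" by (simp add: convex_imp_contractible)
  moreover have "\<theta> (q t) \<noteq> 0" for t by (simp add: \<theta>_def)
  ultimately obtain g where g: "continuous_on {0..1} g" "\<And>t. t \<in> {0..1} \<Longrightarrow> \<theta> (q t) = exp (g t)"
    using continuous_logarithm_on_contractible[of "{0..1}" "\<lambda>t. \<theta> (q t)"] by metis
  define \<alpha> where "\<alpha> t = Im (g t - g 0) / (2 * pi)" for t
  have q01: "q 0 = y" "q 1 = y" using q by (auto simp: loops_at_def)
  have \<theta>y: "\<theta> y = 1" using y by (simp add: \<theta>_def K_def)
  have rel: "\<theta> (q t) = exp (g t - g 0)" if "t \<in> {0..1}" for t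
    using g(2)[OF that] g(2)[of 0] q01 \<theta>y by (simp add: exp_diff)
  have \<alpha>_eq: "\<exists>n::int. \<alpha> t = u + of_int n"
    if t: "t \<in> {0..1}" and u: "\<theta> (q t) = exp (of_real u * (2 * of_real pi * \<i>))" for t u
  proof -
    obtain n :: int where "g t - g 0 = of_real u * (2 * of_real pi * \<i>) + (of_int (2 * n) * pi) * \<i>"
      using u rel[OF t] exp_eq by metis
    then have "Im (g t - g 0) = u * (2 * pi) + 2 * of_int n * pi" by simp
    then have "\<alpha> t = u + of_int n" by (simp add: \<alpha>_def field_simps)
    then show ?thesis ..
  qed
  have fK: "\<alpha> t \<in> \<int>" if t: "t \<in> {0..1}" and x: "q t \<in> K" for t
  proof -
    have "\<theta> (q t) = exp (of_real 0 * (2 * of_real pi * \<i>))" using x by (simp add: \<theta>_def)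
    from \<alpha>_eq[OF t this] show ?thesis by auto
  qed
  show thesis
  proof
    show "continuous_on {0..1} \<alpha>" unfolding \<alpha>_def by (intro continuous_intros g(1)) auto
    show "\<alpha> 0 = 0" by (simp add: \<alpha>_def)
    show "\<alpha> 1 \<in> \<int>" using fK[of 1] q01 y by (simp add: K_def)
    show "frac (\<alpha> t) = 0" if "t \<in> {0..1}" "q t \<in> topspace X - open_arc e" for t
      using fK that unfolding K_def by (simp add: frac_eq_0_iff)
    show "frac (\<alpha> t) = d (q t)" if t: "t \<in> {0..1}" and x: "q t \<in> open_arc e" for t
    proof -
      obtain u where u: "q t = e u" "u \<in> {0<..<1}" using x by (elim imageE)
      then have du: "d (q t) = u" using d(2)[of u] by simp
      have "q t \<notin> K" using x by (simp add: K_def)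
      then have "\<theta> (q t) = exp (of_real u * (2 * of_real pi * \<i>))" by (simp add: \<theta>_def du)
      from \<alpha>_eq[OF t this] obtain n :: int where "\<alpha> t = u + of_int n" ..
      then have "frac (\<alpha> t) = frac u" by (simp add: frac_def)
      also have "\<dots> = u" using u by (simp add: frac_eq)
      finally show ?thesis by (simp add: du)
    qed
  qed
qed

text \<open>Every loop is homotopic to its image under the retraction, which is a power of the loop \<open>p\<close>
  that runs once through the edge. The powers are distinct because the edge is a handle whose crossing
  can act on the integers as the shift.\<close>

theorem unicyclic_fundamental_group:
  assumes e: "e \<in> E" and y: "y \<in> topspace X - open_arc e"
    and c: "contracts_to X (topspace X - open_arc e) y"
  shows "free_group_of_rank (fundamental_group X y) 1"
proof -
  let ?G = "fundamental_group X y"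
  have yX: "y \<in> topspace X" using y by blast
  obtain p d r where p: "p \<in> loops_at X y"
    and d: "continuous_map (subtopology X (closed_arc e)) (top_of_set {0..1}) d" "\<And>t. t \<in> {0..1} \<Longrightarrow> d (e t) = t"
    and hom: "homotopic_with (\<lambda>g. g y = y) X X id r"
    and rK: "\<And>x. x \<in> topspace X - open_arc e \<Longrightarrow> r x = y" and re: "\<And>x. x \<in> open_arc e \<Longrightarrow> r x = p (d x)"
    by (rule unicyclic_retraction[OF e y c]) (rule that)
  have p0: "p 0 = y" using p by (simp add: loops_at_def)
  have "loop_class X y q \<in> range (winding_class X y p)" if q: "q \<in> loops_at X y" for q
  proof -
    have qc: "continuous_map (top_of_set {0..1}) X q" using q by (simp add: loops_at_def pathin_def)
    obtain \<alpha> where a: "continuous_on {0..1} \<alpha>" "\<alpha> 0 = 0" "\<alpha> 1 \<in> \<int>"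
      "\<And>t. t \<in> {0..1} \<Longrightarrow> q t \<in> topspace X - open_arc e \<Longrightarrow> frac (\<alpha> t) = 0"
      "\<And>t. t \<in> {0..1} \<Longrightarrow> q t \<in> open_arc e \<Longrightarrow> frac (\<alpha> t) = d (q t)"
      by (rule lift_through_circle[OF e y q d(1)]) (erule d(2), rule that)
    have "homotopic_with (\<lambda>l. l 0 = y \<and> l 1 = y) (top_of_set {0..1}) X (id \<circ> q) (r \<circ> q)"
      by (rule homotopic_with_compose_continuous_map_right[OF hom qc]) (use q in \<open>auto simp: loops_at_def\<close>)
    then have 1: "(q, r \<circ> q) \<in> loop_homotopy X y" by (simp add: loop_homotopy_def)
    have eq: "r (q t) = p (frac (\<alpha> t))" if t: "t \<in> {0..1}" for t
    proof (cases "q t \<in> open_arc e")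
      case True
      then show ?thesis using re a(5)[OF t] by simp
    next
      case False
      then have "q t \<in> topspace X - open_arc e"
        using qc t by (auto simp: continuous_map_def Pi_iff simp del: image_iff)
      then have "r (q t) = y" "frac (\<alpha> t) = 0" by (rule rK, rule a(4)[OF t])
      then show ?thesis by (simp only: p0)
    qed
    have rq: "r \<circ> q \<in> loops_at X y" using loop_homotopy_loops[OF 1] by blast
    have "(r \<circ> q, \<lambda>t. p (frac (\<alpha> t))) \<in> loop_homotopy X y"
      unfolding loop_homotopy_def mem_Collect_eq prod.case
      by (rule homotopic_with_equal) (use rq frac_loop[OF p a(1-3)] eq in \<open>auto simp: loops_at_def pathin_def\<close>)
    with 1 have "(q, \<lambda>t. p (frac (\<alpha> t))) \<in> loop_homotopy X y" by (rule loop_homotopy_trans)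
    moreover obtain n where "\<alpha> 1 = of_int n" using a(3) by (auto elim: Ints_cases)
    ultimately have "loop_class X y q = winding_class X y p n"
      using winding_class_lift[OF p a(1,2)] loop_class_eq_iff[OF q] by metis
    then show ?thesis by (rule range_eqI)
  qed
  then have onto: "carrier ?G = range (winding_class X y p)"
    unfolding carrier_fundamental_group
    using winding_class_in[OF p] unfolding carrier_fundamental_group by (intro equalityI image_subsetI) auto
  let ?P = "band_complement {e}"
  have eE: "{e} \<subseteq> E" using e by simp
  have P_eq: "?P = (topspace X - open_arc e) \<union> e ` {0..<1/3} \<union> e ` {2/3<..1}"
    using band_complement_eq[OF eE] by simp
  have yP: "y \<in> ?P" unfolding P_eq using y by (intro UnI1)
  have endsK: "e 0 \<in> topspace X - open_arc e" "e 1 \<in> topspace X - open_arc e"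
    using ends[OF e] V_sub interior_V[OF e] by blast+
  have pcK: "path_connectedin X (topspace X - open_arc e)"
    by (rule path_connectedin_contracts_to[OF _ c]) blast
  have ends_in: "e 0 \<in> e ` {0..<1/3}" "e 1 \<in> e ` {2/3<..1}" by (auto intro!: imageI)
  have pc_ends: "path_connectedin X (e ` {0..<1/3})" "path_connectedin X (e ` {2/3<..1})"
    by (auto intro!: path_connectedin_e[OF e] convex_imp_path_connected)
  have pc1: "path_connectedin X ((topspace X - open_arc e) \<union> e ` {0..<1/3})"
    using IntI[OF endsK(1) ends_in(1)] by (intro path_connectedin_Un[OF pcK pc_ends(1)]) (metis empty_iff)
  have "((topspace X - open_arc e) \<union> e ` {0..<1/3}) \<inter> e ` {2/3<..1} \<noteq> {}"
    using IntI[OF UnI1[OF endsK(2)] ends_in(2)] by (metis empty_iff)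
  then have pcP: "path_connectedin X ?P" unfolding P_eq by (rule path_connectedin_Un[OF pc1 pc_ends(2)])
  obtain act where act: "\<And>S. S \<in> carrier ?G \<Longrightarrow> bij (act S)"
    "\<And>S T. \<lbrakk>S \<in> carrier ?G; T \<in> carrier ?G\<rbrakk> \<Longrightarrow> act (S \<otimes>\<^bsub>?G\<^esub> T) = act S \<circ> act T"
    "\<And>i. i \<in> {e} \<Longrightarrow> \<exists>S\<in>carrier ?G. act S = (\<lambda>j::int. j + 1)"
  proof (rule band_monodromy[of X ?P y open_arc "{e}" "\<lambda>e. e ` {0<..<1/3}" "\<lambda>e. e ` {2/3<..<1}" "\<lambda>_ j::int. j + 1"])
    show "path_connectedin X ?P" "y \<in> ?P" by fact+
    show "open_arc i \<inter> open_arc j = {}" if "i \<in> {e}" "j \<in> {e}" "i \<noteq> j" for i j using that by simp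
    show "openin X ?P" by (rule openin_band_complement[OF eE])
    show "topspace X = ?P \<union> (\<Union>e\<in>{e}. open_arc e)" by (rule topspace_eq_band_complement[OF eE])
    show "bij (\<lambda>j::int. j + 1)" by (rule bij_betw_byWitness[of _ "\<lambda>j. j - 1"]) auto
    fix i assume "i \<in> {e}"
    then have i: "i = e" by simp
    show "openin X (open_arc i)" unfolding i by (rule openin_open_arc[OF e])
    show "path_connectedin X (open_arc i)" unfolding i
      by (rule path_connectedin_e[OF e]) (auto simp: convex_imp_path_connected)
    show "open_arc i \<inter> ?P = i ` {0<..<1/3} \<union> i ` {2/3<..<1}"
      unfolding i by (rule open_arc_Int_band_complement[OF eE]) simp
    have "e ` ({0<..<1/3} \<inter> {2/3<..<1}) = e ` {0<..<1/3} \<inter> e ` {2/3<..<1}"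
      by (rule inj_on_image_Int[OF inj[OF e]]) auto
    then show "i ` {0<..<1/3} \<inter> i ` {2/3<..<1} = {}" unfolding i by (simp add: image_is_empty)
    show "openin X (i ` {0<..<1/3})" "openin X (i ` {2/3<..<1})"
      unfolding i by (auto intro!: openin_e[OF e])
    show "i ` {0<..<1/3} \<noteq> {}" "i ` {2/3<..<1} \<noteq> {}" by simp_all
  qed (rule that)
  obtain S where S: "S \<in> carrier ?G" "act S = (\<lambda>j::int. j + 1)" using act(3) by blast
  have act_action: "bijection_action ?G act"
    by (intro bijection_action.intro bijection_action_axioms.intro group_fundamental_group[OF yX] act(1,2))
  show ?thesis
  proof (rule free_group_rank_1[OF group_fundamental_group[OF yX] onto])
    show "n = 0" if "winding_class X y p n = \<one>\<^bsub>?G\<^esub>" for n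
      by (rule winding_class_eq_one[OF p onto act_action S(1) _ that]) (simp add: S(2))
  qed (rule winding_class_add[OF p])
qed

end


section \<open>Spaces with a locally injective height function\<close>

lemma open_connected_bounded_real:
  fixes S :: "real set"
  assumes S: "open S" "connected S" "bounded S" "S \<noteq> {}"
  obtains a b where "a < b" "S = {a<..<b}"
proof -
  have bdd: "bdd_below S" "bdd_above S" using S(3) by (auto simp: bounded_imp_bdd_below bounded_imp_bdd_above)
  have ivl: "is_interval S" using S(2) is_interval_connected_1 by blast
  have eq: "S = {Inf S<..<Sup S}"
  proof
    show "S \<subseteq> {Inf S<..<Sup S}"
    proof
      fix t assume t: "t \<in> S"
      then obtain e where e: "e > 0" "ball t e \<subseteq> S" using S(1) openE by blast
      then have "t - e/2 \<in> S" "t + e/2 \<in> S" by (auto simp: dist_real_def subset_iff)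
      then have "Inf S \<le> t - e/2" "t + e/2 \<le> Sup S" using bdd by (auto intro: cInf_lower cSup_upper)
      then show "t \<in> {Inf S<..<Sup S}" using e by auto
    qed
    show "{Inf S<..<Sup S} \<subseteq> S"
    proof
      fix t assume t: "t \<in> {Inf S<..<Sup S}"
      obtain a where a: "a \<in> S" "a < t" using cInf_lessD[OF S(4), of t] t by auto
      obtain b where b: "b \<in> S" "t < b" using less_cSupD[OF S(4), of t] t by auto
      show "t \<in> S" using mem_is_interval_1_I[OF ivl a(1) b(1)] a(2) b(2) by simp
    qed
  qed
  obtain x where "x \<in> S" using S(4) by blast
  then have "Inf S < Sup S" using eq by (metis greaterThanLessThan_iff less_trans)
  then show thesis using eq that by blast
qed

lemma Hausdorff_disjoint_neighbourhoods:
  assumes X: "Hausdorff_space X" and V: "finite V" "V \<subseteq> topspace X"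
  obtains W where "\<And>v. v \<in> V \<Longrightarrow> openin X (W v)" "\<And>v. v \<in> V \<Longrightarrow> v \<in> W v"
    "\<And>u v. u \<in> V \<Longrightarrow> v \<in> V \<Longrightarrow> u \<noteq> v \<Longrightarrow> W u \<inter> W v = {}"
proof -
  have "\<forall>u v. \<exists>P Q. u \<in> V \<and> v \<in> V \<and> u \<noteq> v \<longrightarrow> openin X P \<and> openin X Q \<and> u \<in> P \<and> v \<in> Q \<and> P \<inter> Q = {}"
    using X V(2) unfolding Hausdorff_space_def disjnt_def by (metis subsetD)
  then obtain P Q where PQ: "\<And>u v. u \<in> V \<Longrightarrow> v \<in> V \<Longrightarrow> u \<noteq> v \<Longrightarrow>
      openin X (P u v) \<and> openin X (Q u v) \<and> u \<in> P u v \<and> v \<in> Q u v \<and> P u v \<inter> Q u v = {}"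
    by metis
  define W where "W v = topspace X \<inter> (\<Inter>u\<in>V - {v}. P v u \<inter> Q u v)" for v
  show thesis
  proof
    show "openin X (W v)" if v: "v \<in> V" for v
    proof (cases "V - {v} = {}")
      case True
      then have "W v = topspace X" by (simp only: W_def) simp
      then show ?thesis by simp
    next
      case False
      have "openin X (\<Inter>u\<in>V - {v}. P v u \<inter> Q u v)"
        by (rule openin_Inter) (use V(1) False v PQ in auto)
      then show ?thesis by (simp add: W_def openin_Int)
    qed
    show "v \<in> W v" if "v \<in> V" for v using that PQ V(2) by (auto simp: W_def)
    show "W u \<inter> W v = {}" if "u \<in> V" "v \<in> V" "u \<noteq> v" for u v
    proof -
      have "W u \<subseteq> P u v" using that by (auto simp: W_def)
      moreover have "W v \<subseteq> Q u v" using that by (auto simp: W_def)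
      ultimately show ?thesis using PQ[OF that] by blast
    qed
  qed
qed

lemma connectedin_one_of_disjoint_opens:
  assumes S: "connectedin X S" "S \<noteq> {}" and W: "\<And>v. v \<in> V \<Longrightarrow> openin X (W v)"
    "\<And>u v. u \<in> V \<Longrightarrow> v \<in> V \<Longrightarrow> u \<noteq> v \<Longrightarrow> W u \<inter> W v = {}"
    and cover: "S \<subseteq> (\<Union>v\<in>V. W v)"
  shows "\<exists>v\<in>V. S \<subseteq> W v"
proof -
  obtain x v where xv: "x \<in> S" "v \<in> V" "x \<in> W v" using S(2) cover by blast
  let ?O = "\<Union>u\<in>V - {v}. W u"
  have "S \<subseteq> W v"
  proof (rule ccontr)
    assume "\<not> S \<subseteq> W v"
    then have "?O \<inter> S \<noteq> {}" using cover by blast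
    moreover have "openin X (W v)" "openin X ?O" using W(1) xv(2) by blast+
    moreover have "S \<subseteq> W v \<union> ?O" using cover by blast
    moreover have "W v \<inter> ?O \<inter> S = {}" using W(2) xv(2) by blast
    moreover have "W v \<inter> S \<noteq> {}" using xv by blast
    ultimately show False using S(1) unfolding connectedin by blast
  qed
  then show ?thesis using xv(2) by blast
qed

text \<open>For disjoint neighbourhoods \<open>W v\<close> of the points of \<open>V\<close>, compactness confines the end of the path
  to their union, and connectedness to a single \<open>W v\<close>. Shrinking that \<open>W v\<close> cannot change the choice
  of \<open>v\<close>.\<close>

lemma path_end_limit:
  fixes s :: "real \<Rightarrow> 'a"
  assumes X: "compact_space X" "Hausdorff_space X" and V: "finite V" "V \<subseteq> topspace X"
    and ab: "a < b" and s: "continuous_map (top_of_set {a<..<b}) X s"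
    and leave: "\<And>z. z \<in> topspace X - V \<Longrightarrow> \<exists>N t. openin X N \<and> z \<in> N \<and> t < b \<and> (\<forall>u. t < u \<and> u < b \<longrightarrow> s u \<notin> N)"
  obtains v where "v \<in> V" "\<And>W. openin X W \<Longrightarrow> v \<in> W \<Longrightarrow> \<exists>t<b. \<forall>u. t < u \<and> u < b \<longrightarrow> s u \<in> W"
proof -
  have claim: "\<exists>v\<in>V. \<exists>t<b. \<forall>u. t < u \<and> u < b \<longrightarrow> s u \<in> W v"
    if W: "\<And>v. v \<in> V \<Longrightarrow> openin X (W v)" "\<And>v. v \<in> V \<Longrightarrow> v \<in> W v"
    "\<And>u v. u \<in> V \<Longrightarrow> v \<in> V \<Longrightarrow> u \<noteq> v \<Longrightarrow> W u \<inter> W v = {}" for W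
  proof -
    obtain N t where N: "\<And>z. z \<in> topspace X - V \<Longrightarrow> openin X (N z) \<and> z \<in> N z \<and> t z < b \<and> (\<forall>u. t z < u \<and> u < b \<longrightarrow> s u \<notin> N z)"
      using leave by metis
    let ?\<U> = "W ` V \<union> N ` (topspace X - V)"
    have op: "\<forall>U\<in>?\<U>. openin X U" using W(1) N by blast
    have cov: "topspace X \<subseteq> \<Union>?\<U>"
    proof
      fix z assume "z \<in> topspace X"
      then consider "z \<in> V" | "z \<in> topspace X - V" by blast
      then show "z \<in> \<Union>?\<U>" by cases (use W(2) N in blast)+
    qed
    obtain \<F> where \<F>: "finite \<F>" "\<F> \<subseteq> ?\<U>" "topspace X \<subseteq> \<Union>\<F>"
      using mp[OF spec[OF X(1)[unfolded compact_space_alt]] conjI[OF op cov]] by blast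
    obtain T where T: "finite T" "T \<subseteq> topspace X - V" "\<F> - W ` V = N ` T"
    proof -
      have "finite (\<F> - W ` V)" using \<F>(1) by (rule finite_Diff)
      moreover have "\<F> - W ` V \<subseteq> N ` (topspace X - V)" using \<F>(2) by blast
      ultimately show ?thesis using finite_subset_image that by metis
    qed
    define t1 where "t1 = Max (insert a (t ` T))"
    have "t1 \<in> insert a (t ` T)" unfolding t1_def using T(1) by (intro Max_in) auto
    then have t1b: "t1 < b" using ab N T(2) by blast
    have t1a: "a \<le> t1" "\<And>z. z \<in> T \<Longrightarrow> t z \<le> t1" unfolding t1_def using T(1) by auto
    have top: "s u \<in> topspace X" if "a < u" "u < b" for u
      using s that by (auto simp: continuous_map_def Pi_iff)
    have inW: "s u \<in> (\<Union>v\<in>V. W v)" if u: "t1 < u" "u < b" for u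
    proof -
      obtain F where F: "F \<in> \<F>" "s u \<in> F" using top[of u] u t1a(1) \<F>(3) by force
      have "F \<in> W ` V"
      proof (rule ccontr)
        assume "F \<notin> W ` V"
        then have "F \<in> N ` T" unfolding T(3)[symmetric] using F(1) by (intro DiffI)
        then obtain z where z: "z \<in> T" "F = N z" by (elim imageE)
        then have "t z < u" using t1a(2)[OF z(1)] u(1) by linarith
        then show False using N[of z] z T(2) u(2) F(2) by blast
      qed
      then show ?thesis using F(2) by blast
    qed
    have "connectedin X (s ` {t1<..<b})"
      by (rule connectedin_continuous_map_image[OF s]) (use t1a(1) in \<open>auto simp: connectedin_subtopology\<close>)
    then have "\<exists>v\<in>V. s ` {t1<..<b} \<subseteq> W v"
      by (rule connectedin_one_of_disjoint_opens[OF _ _ W(1,3)]) (use t1b inW in auto)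
    then obtain v where v: "v \<in> V" "s ` {t1<..<b} \<subseteq> W v" by blast
    have "\<forall>u. t1 < u \<and> u < b \<longrightarrow> s u \<in> W v" using v(2) by (simp add: image_subset_iff)
    then show ?thesis using v(1) t1b by blast
  qed
  obtain W where W: "\<And>v. v \<in> V \<Longrightarrow> openin X (W v)" "\<And>v. v \<in> V \<Longrightarrow> v \<in> W v"
    "\<And>u v. u \<in> V \<Longrightarrow> v \<in> V \<Longrightarrow> u \<noteq> v \<Longrightarrow> W u \<inter> W v = {}"
    by (rule Hausdorff_disjoint_neighbourhoods[OF X(2) V]) (rule that)
  obtain v t where v: "v \<in> V" "t < b" "\<And>u. t < u \<and> u < b \<Longrightarrow> s u \<in> W v" using claim[OF W] by blast
  show thesis
  proof (rule that[OF v(1)])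
    fix N assume N: "openin X N" "v \<in> N"
    define W' where "W' u = (if u = v then W v \<inter> N else W u)" for u
    have "\<exists>w\<in>V. \<exists>t<b. \<forall>u. t < u \<and> u < b \<longrightarrow> s u \<in> W' w"
    proof (rule claim)
      show "openin X (W' w)" "w \<in> W' w" if "w \<in> V" for w
        using W that N by (auto simp: W'_def)
      show "W' u \<inter> W' w = {}" if "u \<in> V" "w \<in> V" "u \<noteq> w" for u w
      proof -
        have "W' u \<subseteq> W u" "W' w \<subseteq> W w" by (auto simp: W'_def)
        then show ?thesis using W(3)[OF that] by blast
      qed
    qed
    then obtain w t' where w: "w \<in> V" "t' < b" "\<And>u. t' < u \<and> u < b \<Longrightarrow> s u \<in> W' w" by blast
    obtain u where u: "max t t' < u" "u < b" using v(2) w(2) dense[of "max t t'" b] by auto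
    have "s u \<in> W v" "s u \<in> W' w" using v(3) w(3) u by auto
    moreover have "W' w \<subseteq> W w" by (auto simp: W'_def)
    ultimately have "w = v" using W(3)[OF w(1) v(1)] by blast
    then have "W' w \<subseteq> N" by (auto simp: W'_def)
    then show "\<exists>t<b. \<forall>u. t < u \<and> u < b \<longrightarrow> s u \<in> N" using w(2,3) by blast
  qed
qed

text \<open>Off the finite set \<open>V\<close> the height is a local homeomorphism to the real line. Such a space is a
  finite graph; the edges are the components of the complement of \<open>V\<close>, and the height embeds each of them
  as an interval.\<close>

locale height_space =
  fixes X :: "'a topology" and h :: "'a \<Rightarrow> real" and V :: "'a set"
  assumes compact: "compact_space X" and hausdorff: "Hausdorff_space X"
    and cont: "continuous_map X euclideanreal h"
    and finite_V: "finite V" and V_sub: "V \<subseteq> topspace X"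
    and locally_inj: "x \<in> topspace X - V \<Longrightarrow> \<exists>N. openin X N \<and> x \<in> N \<and> inj_on h N"
    and locally_open: "\<lbrakk>x \<in> topspace X - V; openin X N; x \<in> N\<rbrakk> \<Longrightarrow> \<exists>\<epsilon>>0. {h x - \<epsilon><..<h x + \<epsilon>} \<subseteq> h ` N"
begin

lemma open_image:
  assumes N: "openin X N" "N \<inter> V = {}"
  shows "open (h ` N)"
  unfolding open_dist
proof clarify
  fix x assume x: "x \<in> N"
  then have "x \<in> topspace X - V" using N openin_subset by blast
  from locally_open[OF this N(1) x] obtain \<epsilon> where "\<epsilon> > 0" "{h x - \<epsilon><..<h x + \<epsilon>} \<subseteq> h ` N" by blast
  then show "\<exists>e>0. \<forall>y. dist y (h x) < e \<longrightarrow> y \<in> h ` N"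
    by (intro exI[of _ \<epsilon>]) (auto simp: dist_real_def abs_less_iff subset_iff)
qed

definition sheet :: "'a set \<Rightarrow> bool" where
  "sheet A \<longleftrightarrow> openin X A \<and> connectedin X A \<and> A \<inter> V = {} \<and> inj_on h A"

lemma section_continuous:
  assumes A: "openin X A" "A \<inter> V = {}" "inj_on h A" and J: "J \<subseteq> h ` A"
  shows "continuous_map (top_of_set J) X (inv_into A h)"
  unfolding continuous_map_def
proof (intro conjI allI impI)
  have sub: "A \<subseteq> topspace X" using A(1) openin_subset by blast
  show "inv_into A h \<in> topspace (top_of_set J) \<rightarrow> topspace X"
    using J sub by (auto intro!: inv_into_into[THEN subsetD[OF sub]])
  fix U assume U: "openin X U"
  have "{t \<in> J. inv_into A h t \<in> U} = J \<inter> h ` (A \<inter> U)"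
  proof
    show "{t \<in> J. inv_into A h t \<in> U} \<subseteq> J \<inter> h ` (A \<inter> U)"
    proof
      fix t assume t: "t \<in> {t \<in> J. inv_into A h t \<in> U}"
      then have "t \<in> h ` A" using J by blast
      then have "inv_into A h t \<in> A" "h (inv_into A h t) = t" by (rule inv_into_into, rule f_inv_into_f)
      then show "t \<in> J \<inter> h ` (A \<inter> U)" using t by force
    qed
    show "J \<inter> h ` (A \<inter> U) \<subseteq> {t \<in> J. inv_into A h t \<in> U}" using A(3) by auto
  qed
  moreover have "open (h ` (A \<inter> U))" using A U by (intro open_image) auto
  ultimately show "openin (top_of_set J) {t \<in> topspace (top_of_set J). inv_into A h t \<in> U}"
    by (simp add: openin_open_Int)
qed

lemma sheet_exists:
  assumes x: "x \<in> topspace X - V"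
  shows "\<exists>A. sheet A \<and> x \<in> A"
proof -
  obtain N where N: "openin X N" "x \<in> N" "inj_on h N" using locally_inj[OF x] by blast
  have clV: "closedin X V" by (rule closedin_Hausdorff_finite[OF hausdorff V_sub finite_V])
  define N' where "N' = N - V"
  have N': "openin X N'" "x \<in> N'" "inj_on h N'" "N' \<inter> V = {}"
    unfolding N'_def using N x clV by (auto intro: inj_on_subset)
  obtain \<epsilon> where e: "\<epsilon> > 0" "{h x - \<epsilon><..<h x + \<epsilon>} \<subseteq> h ` N'" using locally_open[OF x N'(1,2)] by blast
  define A where "A = {z \<in> N'. h z \<in> {h x - \<epsilon><..<h x + \<epsilon>}}"
  have A_eq: "A = inv_into N' h ` {h x - \<epsilon><..<h x + \<epsilon>}"
  proof
    show "A \<subseteq> inv_into N' h ` {h x - \<epsilon><..<h x + \<epsilon>}"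
    proof
      fix z assume z: "z \<in> A"
      then have "inv_into N' h (h z) = z" using N'(3) by (auto simp: A_def)
      then show "z \<in> inv_into N' h ` {h x - \<epsilon><..<h x + \<epsilon>}" using z by (force simp: A_def)
    qed
    show "inv_into N' h ` {h x - \<epsilon><..<h x + \<epsilon>} \<subseteq> A"
    proof (rule image_subsetI)
      fix t assume t: "t \<in> {h x - \<epsilon><..<h x + \<epsilon>}"
      then have "t \<in> h ` N'" using e(2) by blast
      then have "inv_into N' h t \<in> N'" "h (inv_into N' h t) = t" by (rule inv_into_into, rule f_inv_into_f)
      then show "inv_into N' h t \<in> A" using t by (simp add: A_def)
    qed
  qed
  have "openin X {z \<in> topspace X. h z \<in> {h x - \<epsilon><..<h x + \<epsilon>}}"
    by (rule openin_continuous_map_preimage[OF cont]) simp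
  then have "openin X (N' \<inter> {z \<in> topspace X. h z \<in> {h x - \<epsilon><..<h x + \<epsilon>}})" using N'(1) by (rule openin_Int[rotated])
  moreover have "N' \<inter> {z \<in> topspace X. h z \<in> {h x - \<epsilon><..<h x + \<epsilon>}} = A"
    using openin_subset[OF N'(1)] by (auto simp: A_def)
  ultimately have "openin X A" by simp
  moreover have "connectedin X A" unfolding A_eq
    by (rule connectedin_continuous_map_image[OF section_continuous[OF N'(1,4,3) e(2)]])
       (simp add: connectedin_subtopology)
  moreover have "A \<subseteq> N'" by (auto simp: A_def)
  moreover have "x \<in> A" using N'(2) e(1) by (simp add: A_def)
  ultimately show ?thesis unfolding sheet_def using N'(3,4) inj_on_subset by blast
qed

lemma sheet_image:
  assumes "sheet A"
  shows "open (h ` A)" "connected (h ` A)"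
proof -
  show "open (h ` A)" using assms open_image by (simp add: sheet_def)
  have "connectedin euclideanreal (h ` A)"
    by (rule connectedin_continuous_map_image[OF cont]) (use assms in \<open>simp add: sheet_def\<close>)
  then show "connected (h ` A)" by simp
qed

text \<open>Over the overlap of the two height intervals the sheets \<open>A\<close> and \<open>B\<close> are sections of the height.
  The set where two sections agree is open because \<open>A \<inter> B\<close> is, the set where they differ is open by
  the Hausdorff property, and an interval is connected.\<close>

lemma sheet_Un:
  assumes A: "sheet A" and B: "sheet B" and AB: "A \<inter> B \<noteq> {}"
  shows "sheet (A \<union> B)"
proof -
  let ?I = "h ` A \<inter> h ` B"
  define D where "D = h ` (A \<inter> B)"
  define D' where "D' = {t. \<exists>a\<in>A. \<exists>b\<in>B. h a = t \<and> h b = t \<and> a \<noteq> b}"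
  have sub: "A \<subseteq> topspace X" "B \<subseteq> topspace X" using A B openin_subset unfolding sheet_def by blast+
  have conn: "connected ?I"
    using sheet_image[OF A] sheet_image[OF B] by (simp flip: is_interval_connected_1 add: is_interval_Int)
  have oD: "open D" unfolding D_def using A B by (intro open_image) (auto simp: sheet_def)
  have oD': "open D'"
  proof (subst open_subopen, intro ballI)
    fix t assume "t \<in> D'"
    then obtain a b where ab: "a \<in> A" "b \<in> B" "h a = t" "h b = t" "a \<noteq> b" by (auto simp: D'_def)
    then obtain P Q where PQ: "openin X P" "openin X Q" "a \<in> P" "b \<in> Q" "P \<inter> Q = {}"
      using hausdorff sub unfolding Hausdorff_space_def disjnt_def by (metis subsetD)
    have "open (h ` (A \<inter> P) \<inter> h ` (B \<inter> Q))"
      using A B PQ by (intro open_Int open_image) (auto simp: sheet_def)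
    moreover have "t \<in> h ` (A \<inter> P) \<inter> h ` (B \<inter> Q)"
      using imageI[OF IntI[OF ab(1) PQ(3)], of h] imageI[OF IntI[OF ab(2) PQ(4)], of h]
      unfolding ab(3,4) by (rule IntI)
    moreover have "h ` (A \<inter> P) \<inter> h ` (B \<inter> Q) \<subseteq> D'"
    proof
      fix u assume u: "u \<in> h ` (A \<inter> P) \<inter> h ` (B \<inter> Q)"
      obtain a' where a': "u = h a'" "a' \<in> A \<inter> P" using IntD1[OF u] by (rule imageE)
      obtain b' where b': "u = h b'" "b' \<in> B \<inter> Q" using IntD2[OF u] by (rule imageE)
      have "a' \<noteq> b'" using PQ(5) a'(2) b'(2) by blast
      moreover have "a' \<in> A" "b' \<in> B" "h a' = u" "h b' = u" using a' b' by simp_all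
      ultimately show "u \<in> D'" unfolding D'_def by blast
    qed
    ultimately show "\<exists>T. open T \<and> t \<in> T \<and> T \<subseteq> D'" by blast
  qed
  have cov: "?I \<subseteq> D \<union> D'"
  proof
    fix u assume u: "u \<in> ?I"
    obtain a where a: "u = h a" "a \<in> A" using IntD1[OF u] by (rule imageE)
    obtain b where b: "u = h b" "b \<in> B" using IntD2[OF u] by (rule imageE)
    show "u \<in> D \<union> D'"
    proof (cases "a = b")
      case True
      then have "u \<in> D" unfolding D_def a(1) using a(2) b(2) by (intro imageI IntI) simp_all
      then show ?thesis by (rule UnI1)
    next
      case False
      then have "u \<in> D'" unfolding D'_def using a b by auto
      then show ?thesis by (rule UnI2)
    qed
  qed
  have dis: "D \<inter> D' \<inter> ?I = {}"
  proof (rule equals0I)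
    fix t assume t: "t \<in> D \<inter> D' \<inter> ?I"
    obtain c where "t = h c" "c \<in> A \<inter> B" using IntD1[OF IntD1[OF t]] unfolding D_def by (rule imageE)
    moreover obtain a b where "a \<in> A" "b \<in> B" "h a = t" "h b = t" "a \<noteq> b"
      using IntD2[OF IntD1[OF t]] unfolding D'_def by blast
    moreover have "inj_on h A" "inj_on h B" using A B by (simp_all add: sheet_def)
    ultimately show False by (metis IntE inj_onD)
  qed
  have ne: "D \<inter> ?I \<noteq> {}"
  proof -
    obtain z where z: "z \<in> A" "z \<in> B" using AB by blast
    have "h z \<in> D" unfolding D_def using z by (intro imageI IntI)
    moreover have "h z \<in> ?I" using z by (intro IntI imageI)
    ultimately have "h z \<in> D \<inter> ?I" by (rule IntI)
    then show ?thesis by blast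
  qed
  have D': "D' \<inter> ?I = {}"
    using connectedD[OF conn oD oD' dis cov] by (rule disjE) (erule notE[OF ne], assumption)
  have "inj_on h (A \<union> B)"
  proof (rule inj_onI)
    fix x y assume xy: "x \<in> A \<union> B" "y \<in> A \<union> B" "h x = h y"
    have inj: "inj_on h A" "inj_on h B" using A B by (simp_all add: sheet_def)
    have *: "u = w" if "u \<in> A" "w \<in> B" "h u = h w" for u w
    proof (rule ccontr)
      assume "u \<noteq> w"
      then have "h u \<in> D'" using that unfolding D'_def by auto
      moreover have "h u \<in> h ` A" using that(1) by (rule imageI)
      moreover have "h u \<in> h ` B" unfolding that(3) using that(2) by (rule imageI)
      ultimately have "h u \<in> D' \<inter> ?I" by (intro IntI)
      then show False unfolding D' by (rule emptyE)
    qed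
    consider "x \<in> A" "y \<in> A" | "x \<in> B" "y \<in> B" | "x \<in> A" "y \<in> B" | "x \<in> B" "y \<in> A" using xy by blast
    then show "x = y" by cases (use inj_onD[OF inj(1)] inj_onD[OF inj(2)] *[of x y] *[of y x] xy(3) in auto)
  qed
  then show ?thesis using A B AB by (auto simp: sheet_def intro: openin_Un connectedin_Un)
qed

text \<open>The largest sheet through \<open>x\<close>, since the union of two sheets that meet is a sheet. This is the
  component of \<open>x\<close> off \<open>V\<close>, with injectivity of the height built in.\<close>

definition edge_through :: "'a \<Rightarrow> 'a set" where "edge_through x = \<Union>{A. sheet A \<and> x \<in> A}"

lemma sheet_edge_through:
  assumes x: "x \<in> topspace X - V"
  shows "sheet (edge_through x)" "x \<in> edge_through x"
proof -
  obtain A0 where A0: "sheet A0" "x \<in> A0" using sheet_exists[OF x] by blast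
  then show "x \<in> edge_through x" by (auto simp: edge_through_def)
  have "openin X (edge_through x)" unfolding edge_through_def by (rule openin_Union) (auto simp: sheet_def)
  moreover have "connectedin X (edge_through x)" unfolding edge_through_def
    by (rule connectedin_Union) (auto simp: sheet_def)
  moreover have "edge_through x \<inter> V = {}" by (auto simp: edge_through_def sheet_def)
  moreover have "inj_on h (edge_through x)"
  proof (rule inj_onI)
    fix u w assume "u \<in> edge_through x" "w \<in> edge_through x" and eq: "h u = h w"
    then obtain A B where AB: "sheet A" "x \<in> A" "u \<in> A" "sheet B" "x \<in> B" "w \<in> B" by (auto simp: edge_through_def)
    then have "sheet (A \<union> B)" by (intro sheet_Un) auto
    then show "u = w" using AB eq by (auto simp: sheet_def dest: inj_onD)
  qed
  ultimately show "sheet (edge_through x)" by (simp add: sheet_def)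
qed

lemma edge_through_eq:
  assumes x: "x \<in> topspace X - V" and y: "y \<in> topspace X - V" and meet: "edge_through x \<inter> edge_through y \<noteq> {}"
  shows "edge_through x = edge_through y"
proof -
  have "sheet (edge_through x \<union> edge_through y)" using sheet_edge_through x y meet by (intro sheet_Un) auto
  moreover have "x \<in> edge_through x" "y \<in> edge_through y" using sheet_edge_through x y by auto
  ultimately have "edge_through x \<union> edge_through y \<subseteq> edge_through x" "edge_through x \<union> edge_through y \<subseteq> edge_through y"
    unfolding edge_through_def by blast+
  then show ?thesis by blast
qed

text \<open>For \<open>c u = - u\<close> this concerns the lower end of an edge, traversed downwards.\<close>

lemma height_of_end:
  assumes ab: "a < b" and v: "v \<in> topspace X"
    and lim: "\<And>W. openin X W \<Longrightarrow> v \<in> W \<Longrightarrow> \<exists>t<b. \<forall>u. t < u \<and> u < b \<longrightarrow> s u \<in> W"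
    and hs: "\<And>u. a < u \<Longrightarrow> u < b \<Longrightarrow> h (s u) = c u" and c: "\<And>u. c u = u \<or> c u = - u"
    and c_cont: "isCont c b"
  shows "h v = c b"
proof (rule ccontr)
  assume ne: "h v \<noteq> c b"
  define \<delta> where "\<delta> = \<bar>c b - h v\<bar> / 2"
  have \<delta>: "\<delta> > 0" using ne by (simp add: \<delta>_def)
  have "openin X {y \<in> topspace X. h y \<in> ball (h v) \<delta>}"
    by (rule openin_continuous_map_preimage[OF cont]) simp
  moreover have "v \<in> {y \<in> topspace X. h y \<in> ball (h v) \<delta>}" using v \<delta> by simp
  ultimately obtain t where t: "t < b" "\<And>u. t < u \<and> u < b \<Longrightarrow> s u \<in> {y \<in> topspace X. h y \<in> ball (h v) \<delta>}"
    using lim by blast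
  obtain r where r: "r > 0" "\<And>u. dist u b < r \<Longrightarrow> dist (c u) (c b) < \<delta>"
    using c_cont \<delta> unfolding continuous_at_eps_delta by blast
  obtain u where u: "max (max t a) (b - r) < u" "u < b"
    using dense[of "max (max t a) (b - r)" b] t(1) ab r(1) by auto
  have "dist (h v) (h (s u)) < \<delta>" using t(2)[of u] u by auto
  moreover have "h (s u) = c u" using hs u by auto
  moreover have "dist (c u) (c b) < \<delta>" using r(2)[of u] u by (simp add: dist_real_def)
  ultimately show False unfolding \<delta>_def dist_real_def by (simp add: abs_if field_simps split: if_splits)
qed

text \<open>The section of the height over the interval \<open>h ` edge_through x\<close> cannot accumulate off \<open>V\<close>: not at
  a point of the edge, for reasons of height, and not at a point of another edge, which is open. So it
  converges at both ends to points of \<open>V\<close>.\<close>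

lemma edge_path:
  assumes x: "x \<in> topspace X - V"
  shows "\<exists>e. pathin X e \<and> e 0 \<in> V \<and> e 1 \<in> V \<and> inj_on e {0..1} \<and> e ` {0<..<1} = edge_through x
    \<and> h (e 0) < h (e 1) \<and> h ` edge_through x = {h (e 0)<..<h (e 1)}"
proof -
  define C where "C = edge_through x"
  have C: "sheet C" "x \<in> C" unfolding C_def using sheet_edge_through[OF x] .
  have Csub: "C \<subseteq> topspace X" and opC: "openin X C" and CV: "C \<inter> V = {}" and injC: "inj_on h C"
    using C(1) openin_subset by (auto simp: sheet_def)
  have "compactin euclideanreal (h ` topspace X)"
    using image_compactin[OF _ cont] compact by (simp add: compact_space_def)
  then have "bounded (h ` topspace X)" by (simp add: compact_imp_bounded)
  then have "bounded (h ` C)" by (rule bounded_subset) (use Csub in blast)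
  then obtain a b where ab: "a < b" "h ` C = {a<..<b}"
    using open_connected_bounded_real[OF sheet_image[OF C(1)]] C(2) by (metis empty_iff imageI)
  define s where "s = inv_into C h"
  have s: "continuous_map (top_of_set {a<..<b}) X s"
    unfolding s_def by (rule section_continuous[OF opC CV injC]) (simp add: ab(2))
  have sC: "s u \<in> C" and hs: "h (s u) = u" if "a < u" "u < b" for u
  proof -
    have "u \<in> h ` C" unfolding ab(2) using that by simp
    then show "s u \<in> C" "h (s u) = u" unfolding s_def by (rule inv_into_into, rule f_inv_into_f)
  qed
  have sh: "s (h z) = z" if "z \<in> C" for z unfolding s_def using injC that by (rule inv_into_f_f)
  have hC: "a < h z" "h z < b" if "z \<in> C" for z using imageI[OF that, of h] unfolding ab(2) by simp_all
  have away: "\<exists>N. openin X N \<and> z \<in> N \<and> N \<inter> C = {}" if z: "z \<in> topspace X - V" "z \<notin> C" for z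
  proof (intro exI conjI)
    show "openin X (edge_through z)" "z \<in> edge_through z" using sheet_edge_through[OF z(1)] by (simp_all add: sheet_def)
    show "edge_through z \<inter> C = {}"
      using edge_through_eq[OF z(1) x] sheet_edge_through(2)[OF z(1)] z(2) unfolding C_def by blast
  qed
  have op_level: "openin X {y \<in> C. h y \<in> T}" if "open T" for T
  proof -
    have "openin X ({y \<in> topspace X. h y \<in> T} \<inter> C)"
      by (rule openin_Int[OF openin_continuous_map_preimage[OF cont] opC]) (simp add: that)
    moreover have "{y \<in> topspace X. h y \<in> T} \<inter> C = {y \<in> C. h y \<in> T}" using Csub by blast
    ultimately show ?thesis by simp
  qed
  obtain w where w: "w \<in> V" "\<And>W. openin X W \<Longrightarrow> w \<in> W \<Longrightarrow> \<exists>t<b. \<forall>u. t < u \<and> u < b \<longrightarrow> s u \<in> W"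
  proof (rule path_end_limit[OF compact hausdorff finite_V V_sub ab(1) s])
    fix z assume z: "z \<in> topspace X - V"
    have in_C: "s u \<in> C" "h (s u) = u" if "a < u" "u < b" for u using sC hs that by blast+
    show "\<exists>N t. openin X N \<and> z \<in> N \<and> t < b \<and> (\<forall>u. t < u \<and> u < b \<longrightarrow> s u \<notin> N)"
    proof (cases "z \<in> C")
      case True
      let ?m = "(h z + b) / 2"
      have m: "h z < ?m" "?m < b" "a < ?m" using hC[OF True] by auto
      have "\<forall>u. ?m < u \<and> u < b \<longrightarrow> s u \<notin> {y \<in> C. h y \<in> {..<?m}}" using in_C m(3) by auto
      moreover have "openin X {y \<in> C. h y \<in> {..<?m}}" by (rule op_level) simp
      moreover have "z \<in> {y \<in> C. h y \<in> {..<?m}}" using True m(1) by simp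
      ultimately show ?thesis using m(2) by blast
    next
      case False
      then obtain N where N: "openin X N" "z \<in> N" "N \<inter> C = {}" using away[OF z] by blast
      have "\<forall>u. a < u \<and> u < b \<longrightarrow> s u \<notin> N" using in_C(1) N(3) by blast
      then show ?thesis using N ab(1) by blast
    qed
  qed (rule that)
  have s': "continuous_map (top_of_set {-b<..<-a}) X (\<lambda>u. s (- u))"
  proof -
    have "continuous_map (top_of_set {-b<..<-a}) (top_of_set {a<..<b}) uminus"
      by (auto simp: continuous_map_in_subtopology intro!: continuous_intros)
    from continuous_map_compose[OF this s] show ?thesis by (simp add: o_def)
  qed
  obtain v where v: "v \<in> V" "\<And>W. openin X W \<Longrightarrow> v \<in> W \<Longrightarrow> \<exists>t < - a. \<forall>u. t < u \<and> u < - a \<longrightarrow> s (- u) \<in> W"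
  proof (rule path_end_limit[OF compact hausdorff finite_V V_sub _ s'])
    show "- b < - a" using ab(1) by simp
    fix z assume z: "z \<in> topspace X - V"
    have in_C: "s (- u) \<in> C" "h (s (- u)) = - u" if "- b < u" "u < - a" for u
      using sC[of "- u"] hs[of "- u"] that by auto
    show "\<exists>N t. openin X N \<and> z \<in> N \<and> t < - a \<and> (\<forall>u. t < u \<and> u < - a \<longrightarrow> s (- u) \<notin> N)"
    proof (cases "z \<in> C")
      case True
      let ?m = "(h z + a) / 2"
      have m: "?m < h z" "- ?m < - a" "- b < - ?m" using hC[OF True] by auto
      have "\<forall>u. - ?m < u \<and> u < - a \<longrightarrow> s (- u) \<notin> {y \<in> C. h y \<in> {?m<..}}"
      proof (intro allI impI, elim conjE)
        fix u assume u: "- ?m < u" "u < - a"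
        then have "h (s (- u)) = - u" using m(3) by (intro in_C(2)) linarith+
        then have "h (s (- u)) < ?m" using u(1) by linarith
        then show "s (- u) \<notin> {y \<in> C. h y \<in> {?m<..}}" by simp
      qed
      moreover have "openin X {y \<in> C. h y \<in> {?m<..}}" by (rule op_level) simp
      moreover have "z \<in> {y \<in> C. h y \<in> {?m<..}}" using True m(1) by simp
      ultimately show ?thesis using m(2) by blast
    next
      case False
      then obtain N where N: "openin X N" "z \<in> N" "N \<inter> C = {}" using away[OF z] by blast
      have "\<forall>u. - b < u \<and> u < - a \<longrightarrow> s (- u) \<notin> N" using in_C(1) N(3) by blast
      then show ?thesis using N ab(1) by (metis neg_less_iff_less)
    qed
  qed (rule that)
  have hw: "h w = b"
    by (rule height_of_end[OF ab(1) _ w(2), where c = "\<lambda>u. u"]) (use w(1) V_sub hs in auto)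
  have "h v = - (- a)"
    by (rule height_of_end[of "- b" "- a" v "\<lambda>u. s (- u)" uminus])
       (use ab(1) v V_sub hs in \<open>auto intro!: continuous_intros\<close>)
  then have hv: "h v = a" by simp
  define g where "g u = a + u * (b - a)" for u
  have g: "a < g u \<and> g u < b" if "0 < u" "u < 1" for u
  proof -
    have "0 < u * (b - a)" "u * (b - a) < 1 * (b - a)" using that ab(1) by (simp, intro mult_strict_right_mono) simp_all
    then show ?thesis by (simp add: g_def)
  qed
  define e where "e u = (if u \<le> 0 then v else if 1 \<le> u then w else s (g u))" for u
  have he: "h (e u) = g u" if "0 \<le> u" "u \<le> 1" for u
    using that hs g hv hw by (auto simp: e_def g_def)
  have eC: "e u \<in> C" if "0 < u" "u < 1" for u using that sC g by (simp add: e_def)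
  have "inj_on e {0..1}"
  proof (rule inj_onI)
    fix t u assume "t \<in> {0..1}" "u \<in> {0..1}" "e t = e u"
    then have "g t = g u" using he by (metis atLeastAtMost_iff)
    then show "t = u" using ab(1) by (simp add: g_def)
  qed
  moreover have "e ` {0<..<1} = C"
  proof
    show "e ` {0<..<1} \<subseteq> C" using eC by auto
    show "C \<subseteq> e ` {0<..<1}"
    proof
      fix z assume z: "z \<in> C"
      define u where "u = (h z - a) / (b - a)"
      have u: "0 < u" "u < 1" "g u = h z" using hC[OF z] by (simp_all add: u_def g_def)
      then have "z = e u" using sh[OF z] by (simp add: e_def)
      then show "z \<in> e ` {0<..<1}" using u(1,2) by auto
    qed
  qed
  moreover have "pathin X e"
    unfolding pathin_def continuous_map_def
  proof (intro conjI allI impI)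
    show "e \<in> topspace (top_of_set {0..1}) \<rightarrow> topspace X"
    proof (rule Pi_I)
      fix u :: real
      have "e u = v \<or> e u = w \<or> (0 < u \<and> u < 1)" by (auto simp: e_def)
      then show "e u \<in> topspace X" using eC Csub v(1) w(1) V_sub by auto
    qed
    fix N assume N: "openin X N"
    let ?Q = "{u \<in> topspace (top_of_set {0..1}). e u \<in> N}"
    have mid: "openin (top_of_set {0..1::real}) {u \<in> {0<..<1}. e u \<in> N}"
    proof -
      have "continuous_map (top_of_set {0<..<1}) (top_of_set {a<..<b}) g"
        using g by (auto simp: continuous_map_in_subtopology g_def intro!: continuous_intros)
      from continuous_map_compose[OF this s]
      have "openin (top_of_set {0<..<1}) {u \<in> {0<..<1}. s (g u) \<in> N}"
        using openin_continuous_map_preimage[OF _ N] by fastforce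
      then have "open {u \<in> {0<..<1}. s (g u) \<in> N}" by (simp add: openin_open_eq)
      moreover have "{u \<in> {0<..<1}. s (g u) \<in> N} = {u \<in> {0<..<1}. e u \<in> N}" by (auto simp: e_def)
      ultimately show ?thesis by (simp add: open_subset subset_eq)
    qed
    show "openin (top_of_set {0..1}) ?Q"
    proof (subst openin_subopen, intro ballI)
      fix u assume u: "u \<in> ?Q"
      then consider "u = 0" | "u = 1" | "u \<in> {0<..<1}" by fastforce
      then show "\<exists>T. openin (top_of_set {0..1}) T \<and> u \<in> T \<and> T \<subseteq> ?Q"
      proof cases
        case 1
        then have "v \<in> N" using u by (simp add: e_def)
        then obtain t where t: "t < - a" "\<And>r. t < r \<and> r < - a \<Longrightarrow> s (- r) \<in> N" using v(2)[OF N] by blast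
        define d where "d = min 1 ((- a - t) / (b - a))"
        have d: "0 < d" "d \<le> 1" "d \<le> (- a - t) / (b - a)" using t(1) ab(1) by (auto simp: d_def)
        have "r \<in> ?Q" if r: "0 \<le> r" "r < d" for r
        proof (cases "r = 0")
          case False
          have "r < (- a - t) / (b - a)" using r d by linarith
          then have "r * (b - a) < - a - t" using ab(1) by (simp add: pos_less_divide_eq)
          then have "t < - g r" by (simp add: g_def)
          moreover have "- g r < - a" using g[of r] r d False by auto
          ultimately have "s (g r) \<in> N" using t(2)[of "- g r"] by simp
          then show ?thesis using r d False by (simp add: e_def)
        qed (use \<open>v \<in> N\<close> in \<open>simp add: e_def\<close>)
        then have "{0..1} \<inter> {..<d} \<subseteq> ?Q" by auto
        moreover have "openin (top_of_set {0..1}) ({0..1} \<inter> {..<d})" by (rule openin_open_Int) simp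
        moreover have "u \<in> {0..1} \<inter> {..<d}" using 1 d(1) by simp
        ultimately show ?thesis by blast
      next
        case 2
        then have "w \<in> N" using u by (simp add: e_def)
        then obtain t where t: "t < b" "\<And>r. t < r \<and> r < b \<Longrightarrow> s r \<in> N" using w(2)[OF N] by blast
        define d where "d = max 0 ((t - a) / (b - a))"
        have "(t - a) / (b - a) < 1" using t(1) ab(1) by (simp add: pos_divide_less_eq)
        then have d: "d < 1" "0 \<le> d" "(t - a) / (b - a) \<le> d" by (auto simp: d_def)
        have "r \<in> ?Q" if r: "d < r" "r \<le> 1" for r
        proof (cases "r = 1")
          case False
          have "(t - a) / (b - a) < r" using r d by linarith
          then have "t - a < r * (b - a)" using ab(1) by (simp add: pos_divide_less_eq)
          then have "t < g r" by (simp add: g_def)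
          moreover have "g r < b" using g[of r] r d False by auto
          ultimately have "s (g r) \<in> N" using t(2)[of "g r"] by simp
          then show ?thesis using r d False by (simp add: e_def)
        qed (use \<open>w \<in> N\<close> in \<open>simp add: e_def\<close>)
        then have "{0..1} \<inter> {d<..} \<subseteq> ?Q" by auto
        moreover have "openin (top_of_set {0..1}) ({0..1} \<inter> {d<..})" by (rule openin_open_Int) simp
        moreover have "u \<in> {0..1} \<inter> {d<..}" using 2 d(1) by simp
        ultimately show ?thesis by blast
      next
        case 3
        then show ?thesis using mid u by (intro exI[of _ "{u \<in> {0<..<1}. e u \<in> N}"]) auto
      qed
    qed
  qed
  moreover have "e 0 = v" "e 1 = w" by (simp_all add: e_def)
  ultimately show ?thesis
    unfolding C_def[symmetric] using v(1) w(1) hv hw ab by (intro exI[of _ e]) simp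
qed

text \<open>Every edge spans an interval between two heights of vertices, so it crosses one of finitely many
  intermediate levels without vertices. Such a level set is compact and covered by the disjoint open
  edges, hence meets only finitely many of them.\<close>

lemma finite_edges: "finite (edge_through ` (topspace X - V))"
proof -
  let ?\<C> = "edge_through ` (topspace X - V)"
  have level: "finite {C \<in> ?\<C>. t \<in> h ` C}" if t: "t \<notin> h ` V" for t
  proof -
    define Z where "Z = {z \<in> topspace X. h z \<in> {t}}"
    have "closedin X Z" unfolding Z_def by (rule closedin_continuous_map_preimage[OF cont]) simp
    then have "compactin X Z" using compact closedin_compact_space by blast
    moreover have "\<And>C. C \<in> ?\<C> \<Longrightarrow> openin X C" using sheet_edge_through(1) by (auto simp: sheet_def)
    moreover have Zsub: "Z \<subseteq> topspace X - V"
    proof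
      fix z assume z: "z \<in> Z"
      then have "z \<notin> V" using t imageI[of z V h] by (auto simp: Z_def)
      then show "z \<in> topspace X - V" using z by (simp add: Z_def)
    qed
    then have "Z \<subseteq> \<Union>?\<C>" using sheet_edge_through(2) by blast
    ultimately obtain \<F> where F: "finite \<F>" "\<F> \<subseteq> ?\<C>" "Z \<subseteq> \<Union>\<F>"
      unfolding compactin_def by meson
    have "{C \<in> ?\<C>. t \<in> h ` C} \<subseteq> \<F>"
    proof clarify
      fix x z assume x: "x \<in> topspace X" "x \<notin> V" and z: "z \<in> edge_through x" "t = h z"
      have xx: "x \<in> topspace X - V" using x by blast
      have "z \<in> topspace X" using sheet_edge_through(1)[OF xx] openin_subset z(1) by (auto simp: sheet_def)
      then have "z \<in> Z" using z(2) by (simp add: Z_def)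
      then obtain D where D: "D \<in> \<F>" "z \<in> D" using F(3) by blast
      obtain y where y: "y \<in> topspace X - V" "D = edge_through y" using D(1) F(2) by blast
      have "edge_through x = D" unfolding y(2) by (rule edge_through_eq[OF xx y(1)]) (use z D y in blast)
      then show "edge_through x \<in> \<F>" using D(1) by simp
    qed
    then show ?thesis using F(1) finite_subset by blast
  qed
  define P where "P = {p \<in> h ` V \<times> h ` V. fst p < snd p}"
  have finP: "finite P" unfolding P_def using finite_V by simp
  have "\<exists>t. fst p < t \<and> t < snd p \<and> t \<notin> h ` V" if "p \<in> P" for p
  proof -
    have "infinite {fst p<..<snd p}" using that by (simp add: P_def)
    then have "\<not> {fst p<..<snd p} \<subseteq> h ` V" using finite_V finite_subset finite_imageI by blast
    then show ?thesis by auto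
  qed
  then obtain m where m: "\<And>p. p \<in> P \<Longrightarrow> fst p < m p \<and> m p < snd p \<and> m p \<notin> h ` V" by metis
  have "?\<C> \<subseteq> (\<Union>p\<in>P. {C \<in> ?\<C>. m p \<in> h ` C})"
  proof (rule image_subsetI)
    fix x assume x: "x \<in> topspace X - V"
    obtain e where e: "e 0 \<in> V" "e 1 \<in> V" "h (e (0::real)) < h (e 1)" "h ` edge_through x = {h (e 0)<..<h (e 1)}"
      using edge_path[OF x] by blast
    let ?p = "(h (e 0), h (e 1))"
    have p: "?p \<in> P" unfolding P_def using e(1-3) by simp
    have "m ?p \<in> h ` edge_through x" unfolding e(4) using m[OF p] by simp
    then show "edge_through x \<in> (\<Union>p\<in>P. {C \<in> ?\<C>. m p \<in> h ` C})" using p x by blast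
  qed
  moreover have "finite (\<Union>p\<in>P. {C \<in> ?\<C>. m p \<in> h ` C})"
    using finP m level by (intro finite_UN_I) auto
  ultimately show ?thesis by (rule finite_subset)
qed

theorem arc_graph_exists: "\<exists>E. arc_graph X V E"
proof -
  let ?\<C> = "edge_through ` (topspace X - V)"
  have "\<forall>C\<in>?\<C>. \<exists>e. pathin X e \<and> e 0 \<in> V \<and> e 1 \<in> V \<and> inj_on e {0..1} \<and> e ` {0<..<1} = C"
    using edge_path by blast
  then obtain \<epsilon> where \<epsilon>: "\<And>C. C \<in> ?\<C> \<Longrightarrow> pathin X (\<epsilon> C) \<and> \<epsilon> C 0 \<in> V \<and> \<epsilon> C 1 \<in> V \<and> inj_on (\<epsilon> C) {0..1} \<and> \<epsilon> C ` {0<..<1} = C"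
    by metis
  have CV: "C \<inter> V = {}" and Csub: "C \<subseteq> topspace X" if C: "C \<in> ?\<C>" for C
  proof -
    obtain x where x: "x \<in> topspace X - V" "C = edge_through x" using C by (elim imageE)
    have "sheet C" unfolding x(2) by (rule sheet_edge_through(1)[OF x(1)])
    then show "C \<inter> V = {}" "C \<subseteq> topspace X" using openin_subset unfolding sheet_def by blast+
  qed
  have "arc_graph X V (\<epsilon> ` ?\<C>)"
  proof
    show "Hausdorff_space X" "finite V" "V \<subseteq> topspace X" by (rule hausdorff finite_V V_sub)+
    show "finite (\<epsilon> ` ?\<C>)" using finite_edges by (rule finite_imageI)
    have im: "\<epsilon> C ` {0<..<1} = C" if "C \<in> ?\<C>" for C using \<epsilon>[OF that] by blast
    fix e assume "e \<in> \<epsilon> ` ?\<C>"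
    then obtain C where C: "e = \<epsilon> C" "C \<in> ?\<C>" by (rule imageE)
    show "pathin X e" "e 0 \<in> V" "e 1 \<in> V" "inj_on e {0..1}" using \<epsilon>[OF C(2)] unfolding C(1) by blast+
    show "e ` {0<..<1} \<inter> V = {}" unfolding C(1) im[OF C(2)] by (rule CV[OF C(2)])
    fix e' assume "e' \<in> \<epsilon> ` ?\<C>" and ne: "e \<noteq> e'"
    then obtain C' where C': "e' = \<epsilon> C'" "C' \<in> ?\<C>" by (elim imageE) blast
    obtain x y where xy: "x \<in> topspace X - V" "C = edge_through x" "y \<in> topspace X - V" "C' = edge_through y"
      using C(2) C'(2) by blast
    have "C \<noteq> C'" using ne C C' by blast
    then have "C \<inter> C' = {}" using edge_through_eq[OF xy(1,3)] unfolding xy(2,4) by blast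
    then show "e ` {0<..<1} \<inter> e' ` {0<..<1} = {}" unfolding C(1) C'(1) im[OF C(2)] im[OF C'(2)] .
  next
    have "(\<Union>e\<in>\<epsilon> ` ?\<C>. e ` {0<..<1}) = \<Union>?\<C>" using \<epsilon> by auto
    moreover have "\<Union>?\<C> \<subseteq> topspace X" using Csub by blast
    moreover have "topspace X - V \<subseteq> \<Union>?\<C>" using sheet_edge_through(2) by blast
    ultimately show "topspace X = V \<union> (\<Union>e\<in>\<epsilon> ` ?\<C>. e ` {0<..<1})" using V_sub by auto
  qed
  then show ?thesis ..
qed

end


section \<open>The Reeb quotient\<close>

locale reeb_setting =
  fixes M :: "'a topology" and f :: "'a \<Rightarrow> real"
  assumes compact: "compact_space M" and hausdorff: "Hausdorff_space M"
    and cont: "continuous_map M euclideanreal f"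
begin

definition level :: "real \<Rightarrow> 'a set" where "level c = {z \<in> topspace M. f z = c}"

definition q :: "'a \<Rightarrow> 'a set" where "q x = reeb_relation M f `` {x}"

definition height :: "'a set \<Rightarrow> real" where "height \<xi> = f (SOME x. x \<in> \<xi>)"

lemma closedin_level: "closedin M (level c)"
  using closedin_continuous_map_preimage[OF cont, of "{c}"] by (simp add: level_def)

lemma in_q_iff: "y \<in> q x \<longleftrightarrow> connected_component_of (subtopology M (level (f x))) x y"
proof
  assume "y \<in> q x"
  then obtain c where c: "connected_component_of (subtopology M (level c)) x y"
    by (auto simp: q_def reeb_relation_def level_def)
  then have "x \<in> topspace (subtopology M (level c))" by (rule connected_component_in_topspace[THEN conjunct1])
  then have "c = f x" by (simp add: level_def)
  then show "connected_component_of (subtopology M (level (f x))) x y" using c by simp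
qed (auto simp: q_def reeb_relation_def level_def)

lemma q_eq: "q x = connected_component_of_set (subtopology M (level (f x))) x"
  using in_q_iff by auto

lemma connectedin_q: "connectedin M (q x)"
  using connectedin_connected_component_of[of "subtopology M (level (f x))" x]
  unfolding q_eq by (simp add: connectedin_subtopology)

lemma q_subset: "q x \<subseteq> level (f x)"
  using connected_component_of_subset_topspace[of "subtopology M (level (f x))" x]
  unfolding q_eq by auto

lemma q_self: "x \<in> topspace M \<Longrightarrow> x \<in> q x"
  unfolding in_q_iff by (simp add: connected_component_of_refl level_def)

lemma q_eqI: "y \<in> q x \<Longrightarrow> q y = q x"
proof -
  assume y: "y \<in> q x"
  then have "f y = f x" using q_subset by (auto simp: level_def)
  then show "q y = q x" using y unfolding in_q_iff q_eq
    by (simp add: connected_component_of_equiv)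
qed

lemma q_maximal:
  assumes "connectedin M S" "S \<subseteq> level (f x)" "x \<in> S"
  shows "S \<subseteq> q x"
  unfolding q_eq by (rule connected_component_of_maximal) (use assms in \<open>simp_all add: connectedin_subtopology\<close>)

lemma height_q: "x \<in> topspace M \<Longrightarrow> height (q x) = f x"
proof -
  assume "x \<in> topspace M"
  then have "(SOME y. y \<in> q x) \<in> q x" using q_self by (metis someI)
  then show ?thesis using q_subset by (auto simp: height_def level_def)
qed

lemma topspace_reeb: "topspace (reeb_graph M f) = q ` topspace M"
  unfolding reeb_graph_def topspace_quotient_topology by (auto simp: quotient_def q_def)

lemma openin_reeb:
  "openin (reeb_graph M f) \<U> \<longleftrightarrow> \<U> \<subseteq> q ` topspace M \<and> openin M {x \<in> topspace M. q x \<in> \<U>}"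
  using openin_quotient_topology[of M "reeb_relation M f" \<U>] topspace_reeb
  unfolding reeb_graph_def topspace_quotient_topology q_def by simp

lemma quotient_map_q: "quotient_map M (reeb_graph M f) q"
  using quotient_map_quotient_topology[of M "reeb_relation M f"] unfolding reeb_graph_def q_def[abs_def] .

lemma continuous_map_q: "continuous_map M (reeb_graph M f) q"
  by (rule quotient_imp_continuous_map[OF quotient_map_q])

lemma continuous_map_height: "continuous_map (reeb_graph M f) euclideanreal height"
proof -
  have "continuous_map M euclideanreal (height \<circ> q)"
    by (rule continuous_map_eq[OF cont]) (simp add: height_q)
  then show ?thesis using continuous_compose_quotient_map_eq[OF quotient_map_q] by blast
qed

lemma openin_strip: "openin M {z \<in> topspace M. \<bar>f z - c\<bar> < \<epsilon>}"
proof -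
  have "openin M {z \<in> topspace M. f z \<in> ball c \<epsilon>}" by (rule openin_continuous_map_preimage[OF cont]) simp
  moreover have "{z \<in> topspace M. f z \<in> ball c \<epsilon>} = {z \<in> topspace M. \<bar>f z - c\<bar> < \<epsilon>}"
    by (auto simp: dist_real_def abs_minus_commute)
  ultimately show ?thesis by simp
qed

lemma strip_inside:
  assumes W: "openin M W" "level c \<subseteq> W"
  obtains \<epsilon> where "\<epsilon> > 0" "{z \<in> topspace M. \<bar>f z - c\<bar> < \<epsilon>} \<subseteq> W"
proof -
  have "closedin M (topspace M - W)" using W(1) by blast
  then have "compactin M (topspace M - W)" using compact closedin_compact_space by blast
  then have "compact (f ` (topspace M - W))" using image_compactin[OF _ cont] by simp
  then have "closed (f ` (topspace M - W))" by (rule compact_imp_closed)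
  moreover have "c \<notin> f ` (topspace M - W)" using W(2) by (auto simp: level_def)
  ultimately obtain \<epsilon> where e: "\<epsilon> > 0" "\<And>y. y \<in> f ` (topspace M - W) \<Longrightarrow> \<epsilon> \<le> dist c y"
    using separate_point_closed by metis
  show thesis
  proof (rule that[OF e(1)])
    show "{z \<in> topspace M. \<bar>f z - c\<bar> < \<epsilon>} \<subseteq> W"
    proof clarify
      fix z assume z: "z \<in> topspace M" "\<bar>f z - c\<bar> < \<epsilon>"
      show "z \<in> W"
      proof (rule ccontr)
        assume "z \<notin> W"
        then have "\<epsilon> \<le> dist c (f z)" using z(1) by (intro e(2) imageI) simp
        then show False using z(2) by (simp add: dist_real_def abs_minus_commute)
      qed
    qed
  qed
qed

text \<open>Near the level \<open>c\<close> a connected component of a level set lies in \<open>U \<union> V\<close>, hence in one of the two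
  disjoint open sets.\<close>

lemma saturated_open:
  assumes U: "openin M U" and V: "openin M V" and UV: "U \<inter> V = {}"
    and e: "{z \<in> topspace M. \<bar>f z - c\<bar> < \<epsilon>} \<subseteq> U \<union> V"
  shows "openin (reeb_graph M f) (q ` (U \<inter> {z \<in> topspace M. \<bar>f z - c\<bar> < \<epsilon>}))"
proof -
  let ?T = "{z \<in> topspace M. \<bar>f z - c\<bar> < \<epsilon>}"
  have "{x \<in> topspace M. q x \<in> q ` (U \<inter> ?T)} = U \<inter> ?T"
  proof
    show "U \<inter> ?T \<subseteq> {x \<in> topspace M. q x \<in> q ` (U \<inter> ?T)}" by auto
    show "{x \<in> topspace M. q x \<in> q ` (U \<inter> ?T)} \<subseteq> U \<inter> ?T"
    proof clarify
      fix x y assume x: "x \<in> topspace M" and xy: "q x = q y" and y: "y \<in> U" "y \<in> topspace M" "\<bar>f y - c\<bar> < \<epsilon>"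
      have xq: "x \<in> q y" using q_self[OF x] xy by simp
      have fx: "f x = f y" using q_subset[of y] xq by (auto simp: level_def)
      have "q y \<subseteq> ?T" using q_subset[of y] y(3) by (auto simp: level_def)
      then have "q y \<subseteq> U \<union> V" using e by blast
      moreover have "U \<inter> q y \<noteq> {}" using y q_self by blast
      ultimately have "V \<inter> q y = {}"
        using connectedin_q[of y] U V UV unfolding connectedin by blast
      then have "x \<in> U" using xq \<open>q y \<subseteq> U \<union> V\<close> by blast
      then show "x \<in> U \<inter> ?T" using x fx y(3) by simp
    qed
  qed
  then show ?thesis unfolding openin_reeb using U openin_strip by (auto intro!: imageI openin_Int)
qed

text \<open>Two components of one level set are separated by a set that is open and closed in the level
  set, because in compact Hausdorff spaces components are quasi-components. Disjoint neighbourhoods of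
  the two parts still contain all nearby level sets, and so separate the points in the quotient.\<close>

lemma Hausdorff_reeb: "Hausdorff_space (reeb_graph M f)"
  unfolding Hausdorff_space_def
proof (intro allI impI, elim conjE)
  fix \<xi> \<eta> assume "\<xi> \<in> topspace (reeb_graph M f)" "\<eta> \<in> topspace (reeb_graph M f)" and ne: "\<xi> \<noteq> \<eta>"
  then obtain x y where x: "x \<in> topspace M" "\<xi> = q x" and y: "y \<in> topspace M" "\<eta> = q y"
    unfolding topspace_reeb by blast
  show "\<exists>U V. openin (reeb_graph M f) U \<and> openin (reeb_graph M f) V \<and> \<xi> \<in> U \<and> \<eta> \<in> V \<and> disjnt U V"
  proof (cases "f x = f y")
    case False
    define \<delta> where "\<delta> = \<bar>f x - f y\<bar> / 2"
    have \<delta>: "\<delta> > 0" using False by (simp add: \<delta>_def)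
    let ?U = "\<lambda>c. {\<zeta> \<in> topspace (reeb_graph M f). height \<zeta> \<in> ball c \<delta>}"
    have "openin (reeb_graph M f) (?U c)" for c
      by (rule openin_continuous_map_preimage[OF continuous_map_height]) simp
    moreover have "\<xi> \<in> ?U (f x)" "\<eta> \<in> ?U (f y)" using x y \<delta> by (auto simp: topspace_reeb height_q)
    moreover have "disjnt (?U (f x)) (?U (f y))"
    proof -
      have "ball (f x) \<delta> \<inter> ball (f y) \<delta> = {}" by (rule disjoint_ballI) (simp add: \<delta>_def dist_real_def)
      then show ?thesis unfolding disjnt_def by blast
    qed
    ultimately show ?thesis by blast
  next
    case True
    let ?L = "subtopology M (level (f x))"
    have topL: "topspace ?L = level (f x)" using closedin_subset[OF closedin_level] by auto
    have "compact_space ?L" using compact closedin_level closedin_compact_space compact_space_subtopology by blast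
    moreover have "Hausdorff_space ?L" using hausdorff by (rule Hausdorff_space_subtopology)
    ultimately have qc: "quasi_component_of ?L x = connected_component_of ?L x"
      by (intro quasi_eq_connected_component_of) simp
    have "y \<notin> q x" using q_eqI ne x y by blast
    then have "\<not> quasi_component_of ?L x y" unfolding qc in_q_iff .
    moreover have xyL: "x \<in> topspace ?L" "y \<in> topspace ?L" unfolding topL using x y True by (simp_all add: level_def)
    ultimately obtain T where T: "closedin ?L T" "openin ?L T" "x \<in> T" "y \<notin> T"
      unfolding quasi_component_of by blast
    have clT: "closedin M T" using T(1) closedin_level by (rule closedin_trans_full)
    have "closedin ?L (topspace ?L - T)" using T(2) by blast
    then have clT': "closedin M (level (f x) - T)" unfolding topL using closedin_level by (rule closedin_trans_full)
    have "compactin M T" "compactin M (level (f x) - T)" using clT clT' compact closedin_compact_space by blast+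
    moreover have "disjnt T (level (f x) - T)" by (auto simp: disjnt_def)
    ultimately obtain U V where UV: "openin M U" "openin M V" "T \<subseteq> U" "level (f x) - T \<subseteq> V" "disjnt U V"
      using hausdorff Hausdorff_space_compact_sets by metis
    have UV': "U \<inter> V = {}" "V \<inter> U = {}" using UV(5) by (auto simp: disjnt_def)
    obtain \<epsilon> where e: "\<epsilon> > 0" "{z \<in> topspace M. \<bar>f z - f x\<bar> < \<epsilon>} \<subseteq> U \<union> V"
      by (rule strip_inside[of "U \<union> V" "f x"]) (use UV in \<open>auto intro: that\<close>)
    let ?T = "{z \<in> topspace M. \<bar>f z - f x\<bar> < \<epsilon>}"
    have "openin (reeb_graph M f) (q ` (U \<inter> ?T))" by (rule saturated_open[OF UV(1,2) UV'(1) e(2)])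
    moreover have "openin (reeb_graph M f) (q ` (V \<inter> ?T))"
      by (rule saturated_open[OF UV(2,1) UV'(2)]) (use e(2) in blast)
    moreover have "\<xi> \<in> q ` (U \<inter> ?T)" using x T(3) UV(3) e(1) by auto
    moreover have "\<eta> \<in> q ` (V \<inter> ?T)"
    proof -
      have "y \<in> level (f x) - T" using xyL(2) T(4) unfolding topL by blast
      then have "y \<in> V \<inter> ?T" using UV(4) e(1) y(1) True by auto
      then show ?thesis using y(2) by blast
    qed
    moreover have "disjnt (q ` (U \<inter> ?T)) (q ` (V \<inter> ?T))"
    proof -
      have False if "u \<in> U \<inter> ?T" "v \<in> V \<inter> ?T" "q u = q v" for u v
      proof -
        have u: "u \<in> q v" using that q_self[of u] by simp
        have "q v \<subseteq> ?T" using q_subset[of v] that(2) by (auto simp: level_def)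
        then have "q v \<subseteq> U \<union> V" using e by blast
        moreover have "U \<inter> q v \<noteq> {}" "V \<inter> q v \<noteq> {}" using that u q_self by blast+
        ultimately show False using connectedin_q[of v] UV(1,2) UV' unfolding connectedin by blast
      qed
      note * = this
      show ?thesis unfolding disjnt_def
      proof (rule equals0I)
        fix \<zeta> assume z: "\<zeta> \<in> q ` (U \<inter> ?T) \<inter> q ` (V \<inter> ?T)"
        obtain u where u: "\<zeta> = q u" "u \<in> U \<inter> ?T" using IntD1[OF z] by (rule imageE)
        obtain v where v: "\<zeta> = q v" "v \<in> V \<inter> ?T" using IntD2[OF z] by (rule imageE)
        show False by (rule *[OF u(2) v(2)]) (simp only: u(1)[symmetric] v(1)[symmetric])
      qed
    qed
    ultimately show ?thesis by (intro exI conjI)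
  qed
qed

lemma compact_reeb: "compact_space (reeb_graph M f)"
  using image_compactin[OF _ continuous_map_q, of "topspace M"] compact
  by (simp add: compact_space_def topspace_reeb)

lemma closed_map_q: "closed_map M (reeb_graph M f) q"
  using continuous_map_q compact Hausdorff_reeb by (intro T1_Spaces.continuous_imp_closed_map)

lemma monotone_map_q: "monotone_map M (reeb_graph M f) q"
  unfolding monotone_map_def
proof (intro conjI ballI)
  show "q ` topspace M \<subseteq> topspace (reeb_graph M f)" by (simp add: topspace_reeb)
  show "connectedin M {y \<in> topspace M. q y = \<xi>}" if "\<xi> \<in> topspace (reeb_graph M f)" for \<xi>
  proof -
    obtain x where x: "x \<in> topspace M" "\<xi> = q x" using \<open>\<xi> \<in> _\<close> unfolding topspace_reeb by blast
    have "{y \<in> topspace M. q y = \<xi>} = q x"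
      using x q_self q_eqI q_subset[of x] by (auto simp: level_def)
    then show ?thesis using connectedin_q by simp
  qed
qed

end

text \<open>Regular points enter only through their arbitrarily small neighbourhoods that all nearby level
  sets meet in nonempty connected sets. This replaces the flow along the gradient, which for a function
  of class \<open>C\<^sup>1\<close> is merely a continuous vector field.\<close>

locale reeb_critical = reeb_setting +
  fixes Cr :: "'a set"
  assumes finite_Cr: "finite Cr"
    and box: "\<lbrakk>x \<in> topspace M; x \<notin> Cr; openin M W; x \<in> W\<rbrakk> \<Longrightarrow>
      \<exists>B \<epsilon>. openin M B \<and> x \<in> B \<and> B \<subseteq> W \<and> \<epsilon> > 0 \<and>
        (\<forall>t. \<bar>t - f x\<bar> < \<epsilon> \<longrightarrow> connectedin M {z \<in> B. f z = t} \<and> {z \<in> B. f z = t} \<noteq> {})"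
begin

lemma height_locally_open:
  assumes x: "x \<in> topspace M" "x \<notin> Cr" and N: "openin (reeb_graph M f) N" "q x \<in> N"
  shows "\<exists>\<epsilon>>0. {height (q x) - \<epsilon><..<height (q x) + \<epsilon>} \<subseteq> height ` N"
proof -
  have op: "openin M {z \<in> topspace M. q z \<in> N}" using N(1) unfolding openin_reeb by blast
  have x_in: "x \<in> {z \<in> topspace M. q z \<in> N}" using x(1) N(2) by simp
  obtain B \<epsilon> where B: "B \<subseteq> {z \<in> topspace M. q z \<in> N}" "\<epsilon> > 0"
    "\<And>t. \<bar>t - f x\<bar> < \<epsilon> \<Longrightarrow> {z \<in> B. f z = t} \<noteq> {}" using box[OF x op x_in] by auto
  have "{height (q x) - \<epsilon><..<height (q x) + \<epsilon>} \<subseteq> height ` N"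
  proof
    fix t assume "t \<in> {height (q x) - \<epsilon><..<height (q x) + \<epsilon>}"
    then have "\<bar>t - f x\<bar> < \<epsilon>" using height_q[OF x(1)] by (auto simp: abs_less_iff)
    then obtain z where z: "z \<in> B" "f z = t" using B(3) by blast
    then have "height (q z) = t" "q z \<in> N" using B(1) height_q by auto
    then show "t \<in> height ` N" by blast
  qed
  then show ?thesis using B(2) by blast
qed

text \<open>The sets \<open>D i\<close> have at least the intersection pattern of the open sets \<open>B i \<inter> K\<close>, which cover the
  connected set \<open>K\<close>.\<close>

lemma plaques_connected:
  assumes T: "\<And>i. i \<in> T \<Longrightarrow> connectedin M (D i)"
    and K: "connectedin M K" "K \<subseteq> (\<Union>i\<in>T. B i)"
    and B: "\<And>i. i \<in> T \<Longrightarrow> openin M (B i)" "\<And>i. i \<in> T \<Longrightarrow> B i \<inter> K \<noteq> {}"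
    and meet: "\<And>i j. i \<in> T \<Longrightarrow> j \<in> T \<Longrightarrow> B i \<inter> B j \<inter> K \<noteq> {} \<Longrightarrow> D i \<inter> D j \<noteq> {}"
  shows "connectedin M (\<Union>i\<in>T. D i)"
proof (rule ccontr)
  assume "\<not> connectedin M (\<Union>i\<in>T. D i)"
  moreover have Dsub: "D i \<subseteq> topspace M" if "i \<in> T" for i using T[OF that] connectedin_subset_topspace by blast
  ultimately obtain E1 E2 where E: "openin M E1" "openin M E2" "(\<Union>i\<in>T. D i) \<subseteq> E1 \<union> E2"
    "E1 \<inter> E2 \<inter> (\<Union>i\<in>T. D i) = {}" "E1 \<inter> (\<Union>i\<in>T. D i) \<noteq> {}" "E2 \<inter> (\<Union>i\<in>T. D i) \<noteq> {}"
    unfolding connectedin by blast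
  define I1 where "I1 = {i \<in> T. D i \<subseteq> E1}"
  define I2 where "I2 = {i \<in> T. D i \<subseteq> E2}"
  have nonempty: "D i \<noteq> {}" if "i \<in> T" for i using meet[OF that that] B(2)[OF that] by simp
  have cases: "i \<in> I1 \<or> i \<in> I2" if i: "i \<in> T" for i
  proof (rule ccontr)
    assume "\<not> ?thesis"
    then have "\<not> D i \<subseteq> E1" "\<not> D i \<subseteq> E2" using i by (auto simp: I1_def I2_def)
    moreover have "D i \<subseteq> E1 \<union> E2" using E(3) i by blast
    ultimately have "E1 \<inter> D i \<noteq> {}" "E2 \<inter> D i \<noteq> {}" by blast+
    moreover have "E1 \<inter> E2 \<inter> D i = {}" using E(4) i by blast
    ultimately show False using T[OF i] E(1,2) \<open>D i \<subseteq> E1 \<union> E2\<close> unfolding connectedin by blast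
  qed
  let ?U1 = "\<Union>i\<in>I1. B i" and ?U2 = "\<Union>i\<in>I2. B i"
  have I: "I1 \<subseteq> T" "I2 \<subseteq> T" by (auto simp: I1_def I2_def)
  have disj: "B i \<inter> B j \<inter> K = {}" if "i \<in> I1" "j \<in> I2" for i j
  proof (rule ccontr)
    assume "B i \<inter> B j \<inter> K \<noteq> {}"
    then have "D i \<inter> D j \<noteq> {}" using meet that I by blast
    moreover have "D i \<inter> D j \<subseteq> E1 \<inter> E2 \<inter> (\<Union>i\<in>T. D i)" using that by (auto simp: I1_def I2_def)
    ultimately show False using E(4) by blast
  qed
  have "I1 \<noteq> {}"
  proof
    assume "I1 = {}"
    then have "(\<Union>i\<in>T. D i) \<subseteq> E2" using cases by (auto simp: I2_def)
    then show False using E(4,5) by blast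
  qed
  moreover have "I2 \<noteq> {}"
  proof
    assume "I2 = {}"
    then have "(\<Union>i\<in>T. D i) \<subseteq> E1" using cases by (auto simp: I1_def)
    then show False using E(4,6) by blast
  qed
  ultimately have "?U1 \<inter> K \<noteq> {}" "?U2 \<inter> K \<noteq> {}" using B(2) I by blast+
  moreover have "openin M ?U1" "openin M ?U2" using B(1) I by blast+
  moreover have "K \<subseteq> ?U1 \<union> ?U2"
  proof
    fix z assume "z \<in> K"
    then obtain i where i: "i \<in> T" "z \<in> B i" using K(2) by blast
    then show "z \<in> ?U1 \<union> ?U2" using cases[OF i(1)] by blast
  qed
  moreover have "?U1 \<inter> ?U2 \<inter> K = {}" using disj by blast
  ultimately show False using K(1) unfolding connectedin by blast
qed

text \<open>Cover the component \<open>K\<close> of its level set by finitely many small boxes. Boxes that meet inside \<open>K\<close>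
  also meet on all nearby levels, so on each nearby level the pieces of the boxes chain up to a connected
  set. Components that are close to \<open>K\<close> in the quotient lie inside the boxes, thus there is only one of
  them on each level.\<close>

lemma height_locally_injective:
  assumes x: "x \<in> topspace M" and reg: "q x \<inter> Cr = {}"
  shows "\<exists>N. openin (reeb_graph M f) N \<and> q x \<in> N \<and> inj_on height N"
proof -
  define K where "K = q x"
  define c where "c = f x"
  have K: "connectedin M K" "K \<subseteq> level c" "x \<in> K" unfolding K_def c_def using connectedin_q q_subset q_self[OF x] by auto
  have Ktop: "K \<subseteq> topspace M" and fK: "\<And>y. y \<in> K \<Longrightarrow> f y = c" using K(2) by (auto simp: level_def)
  have small: "\<exists>B \<epsilon>. openin M B \<and> y \<in> B \<and> B \<subseteq> W \<and> \<epsilon> > 0 \<and>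
        (\<forall>t. \<bar>t - c\<bar> < \<epsilon> \<longrightarrow> connectedin M {z \<in> B. f z = t} \<and> {z \<in> B. f z = t} \<noteq> {})"
    if y: "y \<in> K" and W: "openin M W" "y \<in> W" for y W
  proof -
    have "y \<in> topspace M" "y \<notin> Cr" using y Ktop reg unfolding K_def by blast+
    from box[OF this W] show ?thesis unfolding fK[OF y] .
  qed
  have "\<exists>p. openin M (fst p) \<and> y \<in> fst p \<and> snd p > (0::real) \<and>
        (\<forall>t. \<bar>t - c\<bar> < snd p \<longrightarrow> connectedin M {z \<in> fst p. f z = t})" if y: "y \<in> K" for y
  proof -
    from small[OF y openin_topspace subsetD[OF Ktop y]] obtain B \<epsilon> where
      "openin M B" "y \<in> B" "\<epsilon> > 0" "\<And>t. \<bar>t - c\<bar> < \<epsilon> \<Longrightarrow> connectedin M {z \<in> B. f z = t}" by auto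
    then show ?thesis by (intro exI[of _ "(B, \<epsilon>)"]) simp
  qed
  then obtain P where P: "\<And>y. y \<in> K \<Longrightarrow> openin M (fst (P y)) \<and> y \<in> fst (P y) \<and> snd (P y) > (0::real) \<and>
        (\<forall>t. \<bar>t - c\<bar> < snd (P y) \<longrightarrow> connectedin M {z \<in> fst (P y). f z = t})" by metis
  define B where "B y = fst (P y)" for y
  define \<epsilon> where "\<epsilon> y = snd (P y)" for y
  have B: "openin M (B y)" "y \<in> B y" "\<epsilon> y > 0"
    "\<And>t. \<bar>t - c\<bar> < \<epsilon> y \<Longrightarrow> connectedin M {z \<in> B y. f z = t}" if "y \<in> K" for y
    using P[OF that] unfolding B_def \<epsilon>_def by blast+
  have "K = {z \<in> topspace M. q z \<in> {K}}" unfolding K_def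
    using q_self q_eqI Ktop[unfolded K_def] by auto
  moreover have "closedin M {z \<in> topspace M. q z \<in> {K}}"
  proof (rule closedin_continuous_map_preimage[OF continuous_map_q])
    show "closedin (reeb_graph M f) {K}"
      using Hausdorff_reeb x unfolding K_def by (intro closedin_Hausdorff_singleton) (auto simp: topspace_reeb)
  qed
  ultimately have "closedin M K" by simp
  then have compK: "compactin M K" using compact closedin_compact_space by blast
  have "\<forall>U\<in>B ` K. openin M U" "K \<subseteq> \<Union>(B ` K)" using B by blast+
  then obtain \<F> where F: "finite \<F>" "\<F> \<subseteq> B ` K" "K \<subseteq> \<Union>\<F>"
    using compK unfolding compactin_def by meson
  obtain T where T: "T \<subseteq> K" "finite T" "\<F> = B ` T" using finite_subset_image[OF F(1,2)] by metis
  have KT: "K \<subseteq> (\<Union>i\<in>T. B i)" using F(3) T(3) by simp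
  have "\<forall>p. \<exists>\<delta>. p \<in> T \<times> T \<longrightarrow> \<delta> > 0 \<and> (B (fst p) \<inter> B (snd p) \<inter> K \<noteq> {} \<longrightarrow>
      (\<forall>t. \<bar>t - c\<bar> < \<delta> \<longrightarrow> {z \<in> B (fst p) \<inter> B (snd p). f z = t} \<noteq> {}))"
  proof
    fix p show "\<exists>\<delta>. p \<in> T \<times> T \<longrightarrow> \<delta> > 0 \<and> (B (fst p) \<inter> B (snd p) \<inter> K \<noteq> {} \<longrightarrow>
      (\<forall>t. \<bar>t - c\<bar> < \<delta> \<longrightarrow> {z \<in> B (fst p) \<inter> B (snd p). f z = t} \<noteq> {}))"
    proof (cases "p \<in> T \<times> T \<and> B (fst p) \<inter> B (snd p) \<inter> K \<noteq> {}")
      case True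
      then have p: "fst p \<in> K" "snd p \<in> K" using T(1) by auto
      obtain y where y: "y \<in> K" "y \<in> B (fst p) \<inter> B (snd p)" using True by blast
      have "openin M (B (fst p) \<inter> B (snd p))" using B(1)[OF p(1)] B(1)[OF p(2)] by (rule openin_Int)
      from small[OF y(1) this y(2)] obtain D \<delta> where D: "D \<subseteq> B (fst p) \<inter> B (snd p)" "\<delta> > 0"
        "\<And>t. \<bar>t - c\<bar> < \<delta> \<Longrightarrow> {z \<in> D. f z = t} \<noteq> {}" by auto
      have "{z \<in> B (fst p) \<inter> B (snd p). f z = t} \<noteq> {}" if "\<bar>t - c\<bar> < \<delta>" for t
        using D(3)[OF that] D(1) by blast
      then show ?thesis using D(2) by (intro exI[of _ \<delta>]) simp
    next
      case False
      then show ?thesis by (intro exI[of _ 1]) auto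
    qed
  qed
  from choice[OF this] obtain \<delta> where \<delta>_all: "\<forall>p. p \<in> T \<times> T \<longrightarrow> \<delta> p > 0 \<and> (B (fst p) \<inter> B (snd p) \<inter> K \<noteq> {} \<longrightarrow>
      (\<forall>t. \<bar>t - c\<bar> < \<delta> p \<longrightarrow> {z \<in> B (fst p) \<inter> B (snd p). f z = t} \<noteq> {}))" ..
  have \<delta>: "\<delta> p > 0"
    "\<And>t. B (fst p) \<inter> B (snd p) \<inter> K \<noteq> {} \<Longrightarrow> \<bar>t - c\<bar> < \<delta> p \<Longrightarrow> {z \<in> B (fst p) \<inter> B (snd p). f z = t} \<noteq> {}"
    if "p \<in> T \<times> T" for p using mp[OF spec[OF \<delta>_all] that] by simp_all
  define r where "r = Min (insert 1 (\<epsilon> ` T \<union> \<delta> ` (T \<times> T)))"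
  have fin: "finite (insert 1 (\<epsilon> ` T \<union> \<delta> ` (T \<times> T)))" using T(2) by simp
  have rpos: "r > 0" unfolding r_def
    using fin B(3) T(1) \<delta>(1) by (subst Min_gr_iff) auto
  have r\<epsilon>: "r \<le> \<epsilon> i" if "i \<in> T" for i unfolding r_def using fin that by (intro Min_le) auto
  have r\<delta>: "r \<le> \<delta> p" if "p \<in> T \<times> T" for p unfolding r_def using fin that by (intro Min_le) auto
  have plaque: "connectedin M (\<Union>i\<in>T. {z \<in> B i. f z = t})" if t: "\<bar>t - c\<bar> < r" for t
  proof (rule plaques_connected[OF _ K(1) KT])
    fix i assume i: "i \<in> T"
    then have iK: "i \<in> K" using T(1) by blast
    show "connectedin M {z \<in> B i. f z = t}" by (rule B(4)[OF iK]) (use r\<epsilon>[OF i] t in linarith)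
    show "openin M (B i)" by (rule B(1)[OF iK])
    show "B i \<inter> K \<noteq> {}" using B(2)[OF iK] iK by blast
    fix j assume j: "j \<in> T" and ne: "B i \<inter> B j \<inter> K \<noteq> {}"
    have p: "(i, j) \<in> T \<times> T" using i j by simp
    have "\<bar>t - c\<bar> < \<delta> (i, j)" using r\<delta>[OF p] t by linarith
    then have "{z \<in> B i \<inter> B j. f z = t} \<noteq> {}" using \<delta>(2)[OF p, of t] ne by simp
    then show "{z \<in> B i. f z = t} \<inter> {z \<in> B j. f z = t} \<noteq> {}" by blast
  qed
  define W where "W = (\<Union>i\<in>T. B i)"
  have W: "openin M W" unfolding W_def using B(1) T(1) by blast
  \<comment> \<open>The components inside \<open>W\<close> form an open set of the quotient, as \<open>q\<close> is a closed map.\<close>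
  define N0 where "N0 = topspace (reeb_graph M f) - q ` (topspace M - W)"
  have "closedin M (topspace M - W)" using W by blast
  then have "closedin (reeb_graph M f) (q ` (topspace M - W))" using closed_map_q unfolding closed_map_def by blast
  then have N0: "openin (reeb_graph M f) N0" unfolding N0_def by blast
  have inside: "q z \<subseteq> W" if z: "z \<in> topspace M" "q z \<in> N0" for z
  proof (rule ccontr)
    assume "\<not> q z \<subseteq> W"
    then obtain w where w: "w \<in> q z" "w \<notin> W" by blast
    then have "w \<in> topspace M" using q_subset by (auto simp: level_def)
    then have "q w \<in> q ` (topspace M - W)" using w(2) by blast
    then show False using z(2) q_eqI[OF w(1)] unfolding N0_def by simp
  qed
  define N where "N = N0 \<inter> {\<xi> \<in> topspace (reeb_graph M f). height \<xi> \<in> ball c r}"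
  have "openin (reeb_graph M f) {\<xi> \<in> topspace (reeb_graph M f). height \<xi> \<in> ball c r}"
    by (rule openin_continuous_map_preimage[OF continuous_map_height]) simp
  then have "openin (reeb_graph M f) N" unfolding N_def using N0 by blast
  moreover have "q x \<in> N"
  proof -
    have "q x \<notin> q ` (topspace M - W)"
    proof
      assume "q x \<in> q ` (topspace M - W)"
      then obtain w where "w \<in> topspace M" "w \<notin> W" "q w = q x" by auto
      then have "w \<in> K" using q_self[of w] unfolding K_def by simp
      then show False using KT \<open>w \<notin> W\<close> unfolding W_def by blast
    qed
    then show ?thesis unfolding N_def N0_def using x rpos by (simp add: topspace_reeb height_q c_def)
  qed
  moreover have "inj_on height N"
  proof (rule inj_onI)
    fix \<xi> \<eta> assume N: "\<xi> \<in> N" "\<eta> \<in> N" and eq: "height \<xi> = height \<eta>"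
    obtain u where u: "u \<in> topspace M" "\<xi> = q u" using N(1) by (auto simp: N_def topspace_reeb)
    obtain v where v: "v \<in> topspace M" "\<eta> = q v" using N(2) by (auto simp: N_def topspace_reeb)
    have fuv: "f u = f v" using eq u v by (simp add: height_q)
    have "height (q u) \<in> ball c r" using N(1) u by (simp add: N_def)
    then have t: "\<bar>f u - c\<bar> < r" using u(1) by (simp add: height_q dist_real_def abs_minus_commute)
    let ?S = "\<Union>i\<in>T. {z \<in> B i. f z = f u}"
    have S_eq: "?S = {z \<in> W. f z = f u}" by (auto simp: W_def)
    have uW: "u \<in> W" using inside[OF u(1)] N(1) q_self[OF u(1)] by (auto simp: N_def u(2))
    have vW: "v \<in> W" using inside[OF v(1)] N(2) q_self[OF v(1)] by (auto simp: N_def v(2))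
    have "?S \<subseteq> q u"
    proof (rule q_maximal[OF plaque[OF t]])
      show "?S \<subseteq> level (f u)" unfolding S_eq using openin_subset[OF W] by (auto simp: level_def)
      show "u \<in> ?S" unfolding S_eq using uW by simp
    qed
    then have "v \<in> q u" unfolding S_eq using vW fuv by auto
    then show "\<xi> = \<eta>" using q_eqI u(2) v(2) by simp
  qed
  ultimately show ?thesis by blast
qed

theorem reeb_arc_graph:
  assumes V: "finite V" "V \<subseteq> topspace M"
  shows "\<exists>W E. q ` V \<subseteq> W \<and> arc_graph (reeb_graph M f) W E"
proof -
  define W where "W = q ` (V \<union> (Cr \<inter> topspace M))"
  have regular: "\<exists>x. x \<in> topspace M \<and> \<xi> = q x \<and> q x \<inter> Cr = {} \<and> x \<notin> Cr"
    if xi: "\<xi> \<in> topspace (reeb_graph M f) - W" for \<xi>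
  proof -
    obtain x where x: "x \<in> topspace M" "\<xi> = q x" using xi unfolding topspace_reeb by blast
    have "q x \<inter> Cr = {}"
    proof (rule equals0I)
      fix y assume y: "y \<in> q x \<inter> Cr"
      then have "q y = q x" "y \<in> topspace M" using q_eqI q_subset[of x] by (auto simp: level_def)
      then have "\<xi> \<in> W" using y x unfolding W_def by auto
      then show False using xi by blast
    qed
    moreover have "x \<notin> Cr" using calculation q_self[OF x(1)] by blast
    ultimately show ?thesis using x by blast
  qed
  have "height_space (reeb_graph M f) height W"
  proof
    show "compact_space (reeb_graph M f)" by (rule compact_reeb)
    show "Hausdorff_space (reeb_graph M f)" by (rule Hausdorff_reeb)
    show "continuous_map (reeb_graph M f) euclideanreal height" by (rule continuous_map_height)
    show "finite W" unfolding W_def using V(1) finite_Cr by simp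
    show "W \<subseteq> topspace (reeb_graph M f)" unfolding W_def topspace_reeb using V(2) by blast
    show "\<exists>N. openin (reeb_graph M f) N \<and> \<xi> \<in> N \<and> inj_on height N"
      if "\<xi> \<in> topspace (reeb_graph M f) - W" for \<xi>
      using regular[OF that] height_locally_injective by blast
    show "\<exists>\<epsilon>>0. {height \<xi> - \<epsilon><..<height \<xi> + \<epsilon>} \<subseteq> height ` N"
      if "\<xi> \<in> topspace (reeb_graph M f) - W" "openin (reeb_graph M f) N" "\<xi> \<in> N" for \<xi> N
      using regular[OF that(1)] height_locally_open that(2,3) by blast
  qed
  then obtain E where "arc_graph (reeb_graph M f) W E" using height_space.arc_graph_exists by blast
  moreover have "q ` V \<subseteq> W" unfolding W_def by (intro image_mono) blast
  ultimately show ?thesis by (intro exI conjI)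
qed

end


section \<open>Functions of class C1 on manifolds\<close>

text \<open>Choose \<open>v\<close> with \<open>f' x v = 1\<close>. The map \<open>F z = z + (f z - f' x z) v\<close> has derivative the identity
  at \<open>x\<close> and satisfies \<open>f' x (F z) = f z\<close>. By the inverse function theorem it is a local homeomorphism, and it
  straightens the level sets of \<open>f\<close> to slices of a ball by hyperplanes.\<close>

lemma regular_point_box:
  fixes f :: "'e::euclidean_space \<Rightarrow> real"
  assumes S: "open S" and f: "C1_on S f" and x: "x \<in> S"
    and reg: "\<not> (f has_derivative (\<lambda>_. 0)) (at x)" and W: "open W" "x \<in> W"
  obtains B \<epsilon> where "open B" "x \<in> B" "B \<subseteq> S \<inter> W" "\<epsilon> > 0"
    "\<And>t. \<bar>t - f x\<bar> < \<epsilon> \<Longrightarrow> connected {z \<in> B. f z = t} \<and> {z \<in> B. f z = t} \<noteq> {}"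
proof -
  obtain f' :: "'e \<Rightarrow> 'e \<Rightarrow>\<^sub>L real" where f': "\<And>z. z \<in> S \<Longrightarrow> (f has_derivative blinfun_apply (f' z)) (at z)"
    and cont: "continuous_on S f'" using f unfolding C1_on_def by blast
  have "blinfun_apply (f' x) \<noteq> (\<lambda>_. 0)" using f'[OF x] reg by metis
  then obtain v0 where v0: "f' x v0 \<noteq> 0" by auto
  define v where "v = v0 /\<^sub>R f' x v0"
  have v: "f' x v = 1" using v0 by (simp add: v_def blinfun.scaleR_right)
  define F where "F z = z + (f z - f' x z) *\<^sub>R v" for z
  define F' where "F' z = id_blinfun + (blinfun_scaleR_left v o\<^sub>L (f' z - f' x))" for z
  have level: "f' x (F z) = f z" for z
    by (simp add: F_def blinfun.add_right blinfun.scaleR_right v)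
  have der: "(F has_derivative blinfun_apply (F' z)) (at z)" if "z \<in> S \<inter> W" for z
  proof -
    have "(F has_derivative (\<lambda>h. h + (f' z h - f' x h) *\<^sub>R v)) (at z)"
      unfolding F_def using that by (auto intro!: derivative_eq_intros f')
    moreover have "blinfun_apply (F' z) = (\<lambda>h. h + (f' z h - f' x h) *\<^sub>R v)"
      by (simp add: F'_def fun_eq_iff blinfun.add_left blinfun.diff_left)
    ultimately show ?thesis by simp
  qed
  have "continuous_on (S \<inter> W) F'"
    unfolding F'_def using continuous_on_subset[OF cont, of "S \<inter> W"]
    by (intro continuous_intros bounded_bilinear.continuous_on[OF bounded_bilinear_blinfun_compose]) auto
  moreover have "id_blinfun o\<^sub>L F' x = id_blinfun" by (rule blinfun_eqI) (simp add: F'_def)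
  moreover have "open (S \<inter> W)" "x \<in> S \<inter> W" using S W x by auto
  ultimately obtain U' V g g' where U': "open U'" "U' \<subseteq> S \<inter> W" "x \<in> U'" "open V" "F x \<in> V" "homeomorphism U' V F g"
    using inverse_function_theorem[of "S \<inter> W" F F' x id_blinfun] der by metis
  obtain \<rho> where \<rho>: "\<rho> > 0" "ball (F x) \<rho> \<subseteq> V" using U'(4,5) by (meson openE)
  have hom: "\<And>z. z \<in> U' \<Longrightarrow> g (F z) = z" "\<And>y. y \<in> V \<Longrightarrow> F (g y) = y" "continuous_on V g"
    "continuous_on U' F" "\<And>y. y \<in> V \<Longrightarrow> g y \<in> U'" "\<And>z. z \<in> U' \<Longrightarrow> F z \<in> V"
    using U'(6) by (auto simp: homeomorphism_def)
  define B where "B = U' \<inter> F -` ball (F x) \<rho>"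
  \<comment> \<open>The slice at height \<open>t\<close> contains \<open>F x + (t - f x) v\<close>, at distance \<open>\<bar>t - f x\<bar> norm v\<close> from \<open>F x\<close>.\<close>
  show thesis
  proof (rule that[of B "\<rho> / (norm v + 1)"])
    show "open B" unfolding B_def by (rule continuous_open_preimage[OF hom(4) U'(1)]) simp
    show "x \<in> B" "B \<subseteq> S \<inter> W" using U' \<rho> by (auto simp: B_def)
    show "\<rho> / (norm v + 1) > 0" using \<rho> by (simp add: add_nonneg_pos)
    fix t assume t: "\<bar>t - f x\<bar> < \<rho> / (norm v + 1)"
    define L where "L = ball (F x) \<rho> \<inter> {y. f' x y = t}"
    have "{z \<in> B. f z = t} = g ` L"
    proof
      show "{z \<in> B. f z = t} \<subseteq> g ` L"
      proof
        fix z assume "z \<in> {z \<in> B. f z = t}"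
        then have "F z \<in> L" "z = g (F z)" using hom(1) level by (auto simp: B_def L_def)
        then show "z \<in> g ` L" by blast
      qed
      show "g ` L \<subseteq> {z \<in> B. f z = t}"
      proof (rule image_subsetI)
        fix y assume y: "y \<in> L"
        then have "y \<in> V" using \<rho>(2) by (auto simp: L_def)
        then show "g y \<in> {z \<in> B. f z = t}"
          using hom(2,5)[of y] y level[of "g y"] by (simp add: B_def L_def)
      qed
    qed
    moreover have "convex L" unfolding L_def
    proof (rule convex_Int)
      show "convex {y. f' x y = t}"
        by (rule convexI) (simp add: blinfun.add_right blinfun.scaleR_right flip: distrib_right)
    qed simp
    moreover have "continuous_on L g" by (rule continuous_on_subset[OF hom(3)]) (use \<rho>(2) in \<open>auto simp: L_def\<close>)
    moreover have "F x + (t - f x) *\<^sub>R v \<in> L"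
    proof -
      have "\<bar>t - f x\<bar> * norm v \<le> \<bar>t - f x\<bar> * (norm v + 1)" by (simp add: mult_left_mono)
      also have "\<dots> < \<rho>" using t by (simp add: pos_less_divide_eq add_nonneg_pos)
      finally show ?thesis
        by (simp add: L_def dist_norm blinfun.add_right blinfun.scaleR_right level v)
    qed
    ultimately show "connected {z \<in> B. f z = t} \<and> {z \<in> B. f z = t} \<noteq> {}"
      using connected_continuous_image[of L g] convex_connected[of L] by auto
  qed
qed

lemma chart_facts:
  assumes "is_chart M (U, \<phi>)"
  shows "openin M U" and "open (\<phi> ` U)" and "inj_on \<phi> U"
    and "\<And>z. z \<in> U \<Longrightarrow> inv_into U \<phi> (\<phi> z) = z"
    and "continuous_map (subtopology M U) (top_of_set (\<phi> ` U)) \<phi>"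
    and "continuous_map (top_of_set (\<phi> ` U)) M (inv_into U \<phi>)"
    and "\<And>T. openin M T \<Longrightarrow> T \<subseteq> U \<Longrightarrow> open (\<phi> ` T)"
    and "\<And>B. open B \<Longrightarrow> B \<subseteq> \<phi> ` U \<Longrightarrow> openin M {z \<in> U. \<phi> z \<in> B}"
    and "\<And>B. B \<subseteq> \<phi> ` U \<Longrightarrow> {z \<in> U. \<phi> z \<in> B} = inv_into U \<phi> ` B"
proof -
  show U: "openin M U" and S: "open (\<phi> ` U)" using assms by (simp_all add: is_chart_def)
  have hom: "homeomorphic_map (subtopology M U) (top_of_set (\<phi> ` U)) \<phi>" using assms by (simp add: is_chart_def)
  have topU: "topspace (subtopology M U) = U" using openin_subset[OF U] by auto
  show inj: "inj_on \<phi> U" using homeomorphic_imp_injective_map[OF hom] unfolding topU .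
  show inv: "inv_into U \<phi> (\<phi> z) = z" if "z \<in> U" for z using that inj by simp
  show cont: "continuous_map (subtopology M U) (top_of_set (\<phi> ` U)) \<phi>"
    by (rule homeomorphic_imp_continuous_map[OF hom])
  show op: "open (\<phi> ` T)" if T: "openin M T" "T \<subseteq> U" for T
  proof -
    have "openin (subtopology M U) T" using T U by (simp add: openin_open_subtopology)
    then have "openin (top_of_set (\<phi> ` U)) (\<phi> ` T)"
      using homeomorphic_imp_open_map[OF hom] by (simp add: open_map_def)
    then show ?thesis using S by (simp add: openin_open_eq)
  qed
  show pre: "openin M {z \<in> U. \<phi> z \<in> B}" if B: "open B" "B \<subseteq> \<phi> ` U" for B
  proof -
    have "openin (top_of_set (\<phi> ` U)) B" using B S by (simp add: openin_open_eq)
    from openin_continuous_map_preimage[OF cont this, unfolded topU]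
    show ?thesis using openin_trans_full[OF _ U] by blast
  qed
  show im: "{z \<in> U. \<phi> z \<in> B} = inv_into U \<phi> ` B" if "B \<subseteq> \<phi> ` U" for B
  proof
    show "{z \<in> U. \<phi> z \<in> B} \<subseteq> inv_into U \<phi> ` B" using inv by (metis (no_types, lifting) image_eqI mem_Collect_eq subsetI)
    show "inv_into U \<phi> ` B \<subseteq> {z \<in> U. \<phi> z \<in> B}"
    proof (rule image_subsetI)
      fix y assume "y \<in> B"
      then show "inv_into U \<phi> y \<in> {z \<in> U. \<phi> z \<in> B}"
        using subsetD[OF that] by (simp add: f_inv_into_f inv_into_into)
    qed
  qed
  show "continuous_map (top_of_set (\<phi> ` U)) M (inv_into U \<phi>)"
    unfolding continuous_map_def
  proof (intro conjI allI impI)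
    show "inv_into U \<phi> \<in> topspace (top_of_set (\<phi> ` U)) \<rightarrow> topspace M"
      using openin_subset[OF U] by (auto simp: inv)
    fix T assume T: "openin M T"
    have "{y \<in> \<phi> ` U. inv_into U \<phi> y \<in> T} = \<phi> ` (T \<inter> U)" by (auto simp: inv)
    moreover have "open (\<phi> ` (T \<inter> U))" using T U by (intro op) auto
    ultimately show "openin (top_of_set (\<phi> ` U)) {y \<in> topspace (top_of_set (\<phi> ` U)). inv_into U \<phi> y \<in> T}"
      using S by (simp add: openin_open_eq) auto
  qed
qed

context
  fixes M :: "'a topology" and A :: "('a set \<times> ('a \<Rightarrow> real^'n)) set" and f :: "'a \<Rightarrow> real"
  assumes atlas: "C1_atlas M A" and f: "C1_function A f"
begin

lemma chart_around:
  assumes "x \<in> topspace M"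
  obtains U \<phi> where "(U, \<phi>) \<in> A" "x \<in> U" "is_chart M (U, \<phi>)" "C1_on (\<phi> ` U) (f \<circ> inv_into U \<phi>)"
proof -
  have "topspace M = (\<Union>(U, \<phi>)\<in>A. U)" and ch: "\<forall>c\<in>A. is_chart M c" using atlas by (auto simp: C1_atlas_def)
  then obtain U \<phi> where "(U, \<phi>) \<in> A" "x \<in> U" using assms by auto
  then show thesis using that ch f unfolding C1_function_def by fastforce
qed

lemma critical_points_subset: "critical_points A f \<subseteq> topspace M"
  using atlas by (auto simp: critical_points_def C1_atlas_def)

lemma continuous_map_C1_function: "continuous_map M euclideanreal f"
proof -
  have "\<exists>N. openin M N \<and> x \<in> N \<and> continuous_map (subtopology M N) euclideanreal f" if x: "x \<in> topspace M" for x
  proof -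
    obtain U \<phi> where U: "(U, \<phi>) \<in> A" "x \<in> U" "is_chart M (U, \<phi>)" "C1_on (\<phi> ` U) (f \<circ> inv_into U \<phi>)"
      using chart_around[OF x] .
    have "continuous_on (\<phi> ` U) (f \<circ> inv_into U \<phi>)"
      using U(4) unfolding C1_on_def
      by (meson continuous_at_imp_continuous_on has_derivative_continuous)
    then have "continuous_map (top_of_set (\<phi> ` U)) euclideanreal (f \<circ> inv_into U \<phi>)" by simp
    from continuous_map_compose[OF chart_facts(5)[OF U(3)] this]
    have "continuous_map (subtopology M U) euclideanreal f"
      by (rule continuous_map_eq) (simp add: chart_facts(4)[OF U(3)])
    then show ?thesis using chart_facts(1)[OF U(3)] U(2) by blast
  qed
  then obtain N where N: "\<And>x. x \<in> topspace M \<Longrightarrow> openin M (N x) \<and> x \<in> N x \<and> continuous_map (subtopology M (N x)) euclideanreal f"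
    by metis
  show ?thesis by (rule pasting_lemma[where I = "topspace M" and T = N and f = "\<lambda>_. f"]) (use N in auto)
qed

lemma manifold_box:
  assumes x: "x \<in> topspace M" "x \<notin> critical_points A f" and W: "openin M W" "x \<in> W"
  obtains B \<epsilon> where "openin M B" "x \<in> B" "B \<subseteq> W" "\<epsilon> > 0"
    "\<And>t. \<bar>t - f x\<bar> < \<epsilon> \<Longrightarrow> connectedin M {z \<in> B. f z = t} \<and> {z \<in> B. f z = t} \<noteq> {}"
proof -
  obtain U \<phi> where U: "(U, \<phi>) \<in> A" "x \<in> U" "is_chart M (U, \<phi>)" "C1_on (\<phi> ` U) (f \<circ> inv_into U \<phi>)"
    using chart_around[OF x(1)] .
  let ?\<psi> = "inv_into U \<phi>"
  note ch = chart_facts[OF U(3)]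
  have reg: "\<not> ((f \<circ> ?\<psi>) has_derivative (\<lambda>_. 0)) (at (\<phi> x))"
    using x(2) U(1,2) unfolding critical_points_def by blast
  have op: "open (\<phi> ` (W \<inter> U))" and in_op: "\<phi> x \<in> \<phi> ` (W \<inter> U)" using W U(2) ch(1) by (auto intro!: ch(7))
  obtain B \<epsilon> where B: "open B" "\<phi> x \<in> B" "B \<subseteq> \<phi> ` U \<inter> \<phi> ` (W \<inter> U)" "\<epsilon> > 0"
    "\<And>t. \<bar>t - (f \<circ> ?\<psi>) (\<phi> x)\<bar> < \<epsilon> \<Longrightarrow> connected {z \<in> B. (f \<circ> ?\<psi>) z = t} \<and> {z \<in> B. (f \<circ> ?\<psi>) z = t} \<noteq> {}"
    by (rule regular_point_box[OF ch(2) U(4) imageI[OF U(2)] reg op in_op]) (rule that)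
  have BU: "B \<subseteq> \<phi> ` U" using B(3) by blast
  show thesis
  proof (rule that[of "{z \<in> U. \<phi> z \<in> B}" \<epsilon>])
    show "openin M {z \<in> U. \<phi> z \<in> B}" by (rule ch(8)[OF B(1) BU])
    show "x \<in> {z \<in> U. \<phi> z \<in> B}" using U(2) B(2) by simp
    show "{z \<in> U. \<phi> z \<in> B} \<subseteq> W"
    proof
      fix z assume z: "z \<in> {z \<in> U. \<phi> z \<in> B}"
      then obtain w where "w \<in> W" "w \<in> U" "\<phi> z = \<phi> w" using B(3) by blast
      then show "z \<in> W" using z inj_onD[OF ch(3)] by blast
    qed
    show "\<epsilon> > 0" by fact
    fix t assume "\<bar>t - f x\<bar> < \<epsilon>"
    then have c: "connected {y \<in> B. (f \<circ> ?\<psi>) y = t} \<and> {y \<in> B. (f \<circ> ?\<psi>) y = t} \<noteq> {}"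
      using B(5)[of t] ch(4)[OF U(2)] by simp
    let ?L = "{y \<in> B. (f \<circ> ?\<psi>) y = t}"
    have eq: "{z \<in> {z \<in> U. \<phi> z \<in> B}. f z = t} = ?\<psi> ` ?L"
    proof -
      have "?\<psi> ` ?L = {z \<in> U. \<phi> z \<in> ?L}" using ch(9)[of ?L] BU by blast
      also have "\<dots> = {z \<in> {z \<in> U. \<phi> z \<in> B}. f z = t}" using ch(4) by auto
      finally show ?thesis ..
    qed
    have "connectedin M (?\<psi> ` ?L)"
      by (rule connectedin_continuous_map_image[OF ch(6)])
         (use c BU in \<open>simp add: connectedin_subtopology, blast\<close>)
    then show "connectedin M {z \<in> {z \<in> U. \<phi> z \<in> B}. f z = t} \<and> {z \<in> {z \<in> U. \<phi> z \<in> B}. f z = t} \<noteq> {}"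
      unfolding eq using c by simp
  qed
qed

text \<open>In one chart regularity is an open condition; that the charts agree on what is critical is the
  chain rule for the transition map.\<close>

lemma regular_neighbourhood:
  assumes x: "x \<in> topspace M" "x \<notin> critical_points A f"
  obtains W where "openin M W" "x \<in> W" "W \<inter> critical_points A f = {}"
proof -
  obtain U \<phi> where U: "(U, \<phi>) \<in> A" "x \<in> U" "is_chart M (U, \<phi>)" "C1_on (\<phi> ` U) (f \<circ> inv_into U \<phi>)"
    using chart_around[OF x(1)] .
  let ?\<psi> = "inv_into U \<phi>"
  note ch = chart_facts[OF U(3)]
  obtain f' :: "(real^'n) \<Rightarrow> (real^'n) \<Rightarrow>\<^sub>L real" where
    f': "\<And>z. z \<in> \<phi> ` U \<Longrightarrow> ((f \<circ> ?\<psi>) has_derivative blinfun_apply (f' z)) (at z)"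
    and cont: "continuous_on (\<phi> ` U) f'" using U(4) unfolding C1_on_def by blast
  define B where "B = \<phi> ` U \<inter> f' -` (- {0})"
  have B: "open B" "B \<subseteq> \<phi> ` U" unfolding B_def
    by (rule continuous_open_preimage[OF cont ch(2)], auto)
  have zero: "f' y = 0" if y: "y \<in> \<phi> ` U" and der: "((f \<circ> ?\<psi>) has_derivative (\<lambda>_. 0)) (at y)" for y
    using has_derivative_unique[OF f'[OF y] der] by (intro blinfun_eqI) simp
  show thesis
  proof (rule that[of "{z \<in> U. \<phi> z \<in> B}"])
    show "openin M {z \<in> U. \<phi> z \<in> B}" by (rule ch(8)[OF B])
    have "f' (\<phi> x) \<noteq> 0"
    proof
      assume "f' (\<phi> x) = 0"
      then have "((f \<circ> ?\<psi>) has_derivative (\<lambda>_. 0)) (at (\<phi> x))"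
        using f'[OF imageI[OF U(2)]] by (simp add: zero_blinfun.rep_eq)
      then show False using x(2) U(1,2) unfolding critical_points_def by blast
    qed
    then show "x \<in> {z \<in> U. \<phi> z \<in> B}" using U(2) by (simp add: B_def)
    show "{z \<in> U. \<phi> z \<in> B} \<inter> critical_points A f = {}"
    proof (rule equals0I)
      fix z assume z: "z \<in> {z \<in> U. \<phi> z \<in> B} \<inter> critical_points A f"
      then obtain V \<psi> where V: "(V, \<psi>) \<in> A" "z \<in> V"
        and der: "((f \<circ> inv_into V \<psi>) has_derivative (\<lambda>_. 0)) (at (\<psi> z))"
        unfolding critical_points_def by blast
      have zU: "z \<in> U" using z by blast
      have chV: "is_chart M (V, \<psi>)" using atlas V(1) by (auto simp: C1_atlas_def)
      have "C1_on (\<phi> ` (U \<inter> V)) (\<psi> \<circ> ?\<psi>)" using atlas U(1) V(1) unfolding C1_atlas_def by fastforce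
      then obtain \<tau>' where \<tau>': "((\<psi> \<circ> ?\<psi>) has_derivative \<tau>') (at (\<phi> z))"
        unfolding C1_on_def using zU V(2) by blast
      have "(\<psi> \<circ> ?\<psi>) (\<phi> z) = \<psi> z" using ch(4)[OF zU] by simp
      then have "((f \<circ> inv_into V \<psi>) \<circ> (\<psi> \<circ> ?\<psi>) has_derivative (\<lambda>_. 0) \<circ> \<tau>') (at (\<phi> z))"
        using der by (intro diff_chain_at[OF \<tau>']) simp
      then have "((f \<circ> inv_into V \<psi>) \<circ> (\<psi> \<circ> ?\<psi>) has_derivative (\<lambda>_. 0)) (at (\<phi> z))" by (simp add: o_def)
      moreover have "open (\<phi> ` (U \<inter> V))" using ch(1) chart_facts(1)[OF chV] by (intro ch(7)) auto
      moreover have "\<phi> z \<in> \<phi> ` (U \<inter> V)" using zU V(2) by blast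
      ultimately have "((f \<circ> ?\<psi>) has_derivative (\<lambda>_. 0)) (at (\<phi> z))"
        by (rule has_derivative_transform_within_open)
           (auto simp: ch(4) chart_facts(4)[OF chV])
      from zero[OF imageI[OF zU] this] show False using z by (simp add: B_def)
    qed
  qed
qed

lemma finite_critical_points:
  assumes "compact_space M" and isol: "isolated_critical_points M A f"
  shows "finite (critical_points A f)"
proof -
  let ?C = "critical_points A f"
  have "\<exists>W. openin M W \<and> x \<in> W \<and> W \<inter> ?C \<subseteq> {x}" if x: "x \<in> topspace M" for x
  proof (cases "x \<in> ?C")
    case True
    then show ?thesis using isol unfolding isolated_critical_points_def by fast
  next
    case False
    then show ?thesis using regular_neighbourhood[OF x] by (metis empty_subsetI)
  qed
  then obtain W where W: "\<And>x. x \<in> topspace M \<Longrightarrow> openin M (W x) \<and> x \<in> W x \<and> W x \<inter> ?C \<subseteq> {x}" by metis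
  have "(\<forall>U\<in>W ` topspace M. openin M U) \<and> topspace M \<subseteq> \<Union>(W ` topspace M)" using W by blast
  then have "\<exists>\<F>. finite \<F> \<and> \<F> \<subseteq> W ` topspace M \<and> topspace M \<subseteq> \<Union>\<F>"
    by (rule mp[OF spec[OF assms(1)[unfolded compact_space_alt]]])
  then obtain T where T: "T \<subseteq> topspace M" "finite T" "topspace M \<subseteq> (\<Union>x\<in>T. W x)"
    by (metis finite_subset_image)
  have "?C \<subseteq> T"
  proof
    fix c assume c: "c \<in> ?C"
    then obtain x where "x \<in> T" "c \<in> W x" using T(3) critical_points_subset by blast
    then show "c \<in> T" using W[of x] T(1) c by blast
  qed
  then show ?thesis using T(2) finite_subset by blast
qed

lemma locally_path_connected_manifold: "locally_path_connected_space M"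
  unfolding locally_path_connected_space
proof (intro allI impI, elim conjE)
  fix V x assume V: "openin M V" "x \<in> V"
  then have x: "x \<in> topspace M" using openin_subset by blast
  obtain U \<phi> where U: "(U, \<phi>) \<in> A" "x \<in> U" "is_chart M (U, \<phi>)" "C1_on (\<phi> ` U) (f \<circ> inv_into U \<phi>)"
    using chart_around[OF x] .
  note ch = chart_facts[OF U(3)]
  have "open (\<phi> ` (V \<inter> U))" "\<phi> x \<in> \<phi> ` (V \<inter> U)" using V U(2) ch(1) by (auto intro!: ch(7))
  then obtain r where r: "r > 0" "ball (\<phi> x) r \<subseteq> \<phi> ` (V \<inter> U)" by (meson openE)
  then have sub: "ball (\<phi> x) r \<subseteq> \<phi> ` U" by blast
  let ?B = "{z \<in> U. \<phi> z \<in> ball (\<phi> x) r}"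
  have "path_connectedin M ?B"
    unfolding ch(9)[OF sub]
    by (rule path_connectedin_continuous_map_image[OF ch(6)])
       (use sub in \<open>simp add: path_connectedin_subtopology convex_imp_path_connected\<close>)
  moreover have "?B \<subseteq> V"
  proof
    fix z assume z: "z \<in> ?B"
    then obtain w where "w \<in> V" "w \<in> U" "\<phi> z = \<phi> w" using r(2) by blast
    then show "z \<in> V" using z inj_onD[OF ch(3)] by blast
  qed
  ultimately show "\<exists>U. openin M U \<and> path_connectedin M U \<and> x \<in> U \<and> U \<subseteq> V"
    using ch(8)[OF _ sub] U(2) r(1) by (intro exI[of _ ?B]) auto
qed

end


section \<open>Cutting the manifold along edges of the Reeb graph\<close>

lemma (in arc_graph) finite_graph: "finite_graph X"
  unfolding finite_graph_def
proof (intro conjI exI[of _ V] exI[of _ E] ballI)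
  show "Hausdorff_space X" "finite V" "V \<subseteq> topspace X" "finite E" "topspace X = V \<union> (\<Union>e\<in>E. e ` {0<..<1})"
    by (rule hausdorff finite_V V_sub finite_E cover)+
  show "pairwise (\<lambda>e e'. disjnt (e ` {0<..<1}) (e' ` {0<..<1})) E"
    using disjoint by (simp add: pairwise_def disjnt_def)
  fix e assume e: "e \<in> E"
  show "pathin X e" "e 0 \<in> V" "e 1 \<in> V" "e ` {0<..<1} \<inter> V = {}"
    by (rule path[OF e] ends[OF e] interior_V[OF e])+
  show "inj_on e {0<..<1}" by (rule inj_on_subset[OF inj[OF e]]) auto
qed

lemma path_connectedin_open:
  assumes "locally_path_connected_space M" "openin M S" "connectedin M S"
  shows "path_connectedin M S"
proof -
  have "locally_path_connected_space (subtopology M S)"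
    using assms(1,2) by (rule locally_path_connected_space_open_subset)
  then show ?thesis
    using assms(3) path_connected_eq_connected_space unfolding path_connectedin_def connectedin_def by blast
qed

text \<open>The base point lies over a vertex, so that it survives the removal of the middle of any edge.\<close>

locale reeb_graph_cut = reeb_setting M f + arc_graph "reeb_graph M f" V E
  for M :: "'a topology" and f and V and E :: "(real \<Rightarrow> 'a set) set" +
  fixes x0 :: 'a
  assumes x0: "x0 \<in> topspace M" "q x0 \<in> V" and lpc: "locally_path_connected_space M"
begin

text \<open>Preimages of connected open sets under the quotient map are connected and open, hence path
  connected. So the preimages of the open edges in \<open>F\<close> are handles attached to the preimage of the rest,
  whenever the rest is connected.\<close>

lemma cut_action:
  fixes b :: "(real \<Rightarrow> 'a set) \<Rightarrow> 'y \<Rightarrow> 'y"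
  assumes F: "F \<subseteq> E" and conn: "connectedin (reeb_graph M f) (topspace (reeb_graph M f) - (\<Union>e\<in>F. open_arc e))"
    and b: "\<And>e. e \<in> F \<Longrightarrow> bij (b e)"
  obtains act where "bijection_action (fundamental_group M x0) act"
    "\<And>e. e \<in> F \<Longrightarrow> \<exists>S\<in>carrier (fundamental_group M x0). act S = b e"
proof -
  let ?G = "fundamental_group M x0"
  define pre where "pre S = {x \<in> topspace M. q x \<in> S}" for S
  have pre_open: "openin M (pre S)" if "openin (reeb_graph M f) S" for S
    unfolding pre_def by (rule openin_continuous_map_preimage[OF continuous_map_q that])
  have pre_pc: "path_connectedin M (pre S)" if S: "openin (reeb_graph M f) S" "connectedin (reeb_graph M f) S" for S
  proof (rule path_connectedin_open[OF lpc pre_open[OF S(1)]])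
    show "connectedin M (pre S)" unfolding pre_def
      by (rule connectedin_monotone_quotient_map_preimage[OF monotone_map_q quotient_map_q S(2)]) (simp add: S(1))
  qed
  have pre_ne: "pre S \<noteq> {}" if "S \<subseteq> topspace (reeb_graph M f)" "S \<noteq> {}" for S
  proof -
    obtain \<xi> where "\<xi> \<in> S" using \<open>S \<noteq> {}\<close> by blast
    moreover then obtain x where "x \<in> topspace M" "\<xi> = q x" using \<open>S \<subseteq> _\<close> unfolding topspace_reeb by blast
    ultimately show ?thesis unfolding pre_def by blast
  qed
  have pre_Int: "pre (S \<inter> T) = pre S \<inter> pre T" and pre_Un: "pre (S \<union> T) = pre S \<union> pre T" for S T
    unfolding pre_def by blast+
  have pre_disj: "pre S \<inter> pre T = {}" if "S \<inter> T = {}" for S T using that unfolding pre_def by blast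
  have pre_UN: "pre (\<Union>e\<in>F. S e) = (\<Union>e\<in>F. pre (S e))" for S unfolding pre_def by blast
  have pre_top: "pre (topspace (reeb_graph M f)) = topspace M" unfolding pre_def topspace_reeb by blast
  let ?P = "pre (band_complement F)"
  have opP: "openin (reeb_graph M f) (band_complement F)" by (rule openin_band_complement[OF F])
  have F_E: "e \<in> E" if "e \<in> F" for e using F that by blast
  have 1: "openin M ?P" by (rule pre_open[OF opP])
  have 2: "path_connectedin M ?P" by (rule pre_pc[OF opP connectedin_band_complement[OF F conn]])
  have 3: "x0 \<in> ?P"
  proof -
    have "{q x0} \<subseteq> band_complement F"
    proof (rule subset_band_complement)
      show "{q x0} \<subseteq> topspace (reeb_graph M f)" using x0(1) unfolding topspace_reeb by simp
      fix e assume e: "e \<in> F"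
      have "e ` {1/3..2/3} \<subseteq> open_arc e" by (intro image_mono) auto
      moreover have "q x0 \<notin> open_arc e" using interior_V[OF F_E[OF e]] x0(2) by (metis IntI empty_iff)
      ultimately show "{q x0} \<inter> e ` {1/3..2/3} = {}" by (metis Int_insert_left_if0 Int_empty_left subsetD)
    qed
    then show ?thesis unfolding pre_def using x0(1) by simp
  qed
  have 4: "topspace M = ?P \<union> (\<Union>e\<in>F. pre (open_arc e))"
    unfolding pre_UN[symmetric] pre_Un[symmetric] topspace_eq_band_complement[OF F, symmetric] pre_top ..
  have 5: "openin M (pre (open_arc e))" "path_connectedin M (pre (open_arc e))" if e: "e \<in> F" for e
  proof -
    have "connectedin (reeb_graph M f) (open_arc e)" by (rule connectedin_e[OF F_E[OF e]]) auto
    then show "openin M (pre (open_arc e))" "path_connectedin M (pre (open_arc e))"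
      using pre_open pre_pc openin_open_arc[OF F_E[OF e]] by blast+
  qed
  have 6: "pre (open_arc e) \<inter> pre (open_arc e') = {}" if "e \<in> F" "e' \<in> F" "e \<noteq> e'" for e e'
    by (rule pre_disj[OF disjoint[OF F_E F_E]]) (use that in auto)
  have 7: "pre (open_arc e) \<inter> ?P = pre (e ` {0<..<1/3}) \<union> pre (e ` {2/3<..<1})" if e: "e \<in> F" for e
    unfolding pre_Int[symmetric] open_arc_Int_band_complement[OF F e] pre_Un ..
  have 8: "pre (e ` {0<..<1/3}) \<inter> pre (e ` {2/3<..<1}) = {}" if e: "e \<in> F" for e
  proof (rule pre_disj)
    have "e ` ({0<..<1/3} \<inter> {2/3<..<1}) = e ` {0<..<1/3} \<inter> e ` {2/3<..<1}"
      by (rule inj_on_image_Int[OF inj[OF F_E[OF e]]]) auto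
    then show "e ` {0<..<1/3} \<inter> e ` {2/3<..<1} = {}" by (simp add: image_is_empty)
  qed
  have ends_open: "openin (reeb_graph M f) (e ` {0<..<1/3})" "openin (reeb_graph M f) (e ` {2/3<..<1})" if e: "e \<in> F" for e
    by (auto intro!: openin_e[OF F_E[OF e]])
  have ends_ne: "e ` {0<..<1/3} \<noteq> {}" "e ` {2/3<..<1} \<noteq> {}" for e :: "real \<Rightarrow> 'a set" by simp_all
  obtain act where act: "\<And>S. S \<in> carrier ?G \<Longrightarrow> bij (act S)"
    "\<And>S T. \<lbrakk>S \<in> carrier ?G; T \<in> carrier ?G\<rbrakk> \<Longrightarrow> act (S \<otimes>\<^bsub>?G\<^esub> T) = act S \<circ> act T"
    "\<And>e. e \<in> F \<Longrightarrow> \<exists>S\<in>carrier ?G. act S = b e"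
  proof (rule band_monodromy[of M ?P x0 "\<lambda>e. pre (open_arc e)" F "\<lambda>e. pre (e ` {0<..<1/3})" "\<lambda>e. pre (e ` {2/3<..<1})" b])
    show "openin M ?P" "path_connectedin M ?P" "x0 \<in> ?P" "topspace M = ?P \<union> (\<Union>e\<in>F. pre (open_arc e))"
      by (rule 1 2 3 4)+
    fix e assume e: "e \<in> F"
    show "openin M (pre (open_arc e))" "path_connectedin M (pre (open_arc e))" by (rule 5[OF e])+
    show "pre (open_arc e) \<inter> ?P = pre (e ` {0<..<1/3}) \<union> pre (e ` {2/3<..<1})" by (rule 7[OF e])
    show "pre (e ` {0<..<1/3}) \<inter> pre (e ` {2/3<..<1}) = {}" by (rule 8[OF e])
    show "openin M (pre (e ` {0<..<1/3}))" "openin M (pre (e ` {2/3<..<1}))"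
      by (rule pre_open[OF ends_open(1)[OF e]], rule pre_open[OF ends_open(2)[OF e]])
    show "pre (e ` {0<..<1/3}) \<noteq> {}"
      by (rule pre_ne[OF openin_subset[OF ends_open(1)[OF e]] ends_ne(1)])
    show "pre (e ` {2/3<..<1}) \<noteq> {}"
      by (rule pre_ne[OF openin_subset[OF ends_open(2)[OF e]] ends_ne(2)])
    show "bij (b e)" by (rule b[OF e])
    fix e' assume "e' \<in> F" "e \<noteq> e'"
    then show "pre (open_arc e) \<inter> pre (open_arc e') = {}" by (rule 6[OF e])
  qed (rule that)
  have "bijection_action ?G act"
    by (intro bijection_action.intro bijection_action_axioms.intro group_fundamental_group[OF x0(1)] act(1,2))
  then show thesis using act(3) by (rule that)
qed

lemma infinite_if_cycle:
  assumes e: "e \<in> E" and conn: "connectedin (reeb_graph M f) (topspace (reeb_graph M f) - open_arc e)"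
  shows "infinite (carrier (fundamental_group M x0))"
proof -
  have F: "{e} \<subseteq> E" using e by simp
  have conn': "connectedin (reeb_graph M f) (topspace (reeb_graph M f) - (\<Union>e\<in>{e}. open_arc e))" using conn by simp
  have bij: "bij (\<lambda>j::int. j + 1)" by (rule bij_betw_byWitness[of _ "\<lambda>j. j - 1"]) auto
  obtain act where act: "bijection_action (fundamental_group M x0) act"
    "\<And>e'. e' \<in> {e} \<Longrightarrow> \<exists>S\<in>carrier (fundamental_group M x0). act S = (\<lambda>j::int. j + 1)"
    by (rule cut_action[OF F conn', where b = "\<lambda>_ j::int. j + 1"]) (rule bij, rule that)
  obtain S where S: "S \<in> carrier (fundamental_group M x0)" "act S = (\<lambda>j::int. j + 1)" using act(2) by blast
  show ?thesis
    by (rule bijection_action.infinite_if_shift[OF act(1) S(1), of "\<lambda>j. j"]) (simp add: S(2))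
qed

lemma not_amenable_if_two_cycles:
  assumes e: "e \<in> E" "e' \<in> E" "e \<noteq> e'"
    and conn: "connectedin (reeb_graph M f) (topspace (reeb_graph M f) - open_arc e - open_arc e')"
  shows "\<not> comm_group (fundamental_group M x0)" "\<not> amenable_group (fundamental_group M x0)"
proof -
  let ?G = "fundamental_group M x0"
  obtain a b :: "nat \<Rightarrow> nat" and A1 A2 B1 B2 where
    bij: "bij a" "bij b" and pp: "a ` (- A2) \<subseteq> A1" "b ` (- B2) \<subseteq> B1"
    "A1 \<inter> A2 = {}" "B1 \<inter> B2 = {}" "(A1 \<union> A2) \<inter> (B1 \<union> B2) = {}" "A1 \<noteq> {}"
    by (rule ping_pong_bijections) (rule that)
  obtain y where y: "y \<in> A1" using pp(6) by blast
  have F: "{e, e'} \<subseteq> E" using e by simp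
  have "topspace (reeb_graph M f) - (\<Union>e\<in>{e, e'}. open_arc e) = topspace (reeb_graph M f) - open_arc e - open_arc e'"
    by (simp add: Diff_eq Int_assoc)
  then have conn': "connectedin (reeb_graph M f) (topspace (reeb_graph M f) - (\<Union>e\<in>{e, e'}. open_arc e))"
    using conn by (simp only:)
  define c where "c i = (if i = e then a else b)" for i
  have bij_c: "bij (c i)" for i using bij by (simp add: c_def)
  obtain act where act: "bijection_action ?G act"
    "\<And>i. i \<in> {e, e'} \<Longrightarrow> \<exists>S\<in>carrier ?G. act S = c i"
    by (rule cut_action[OF F conn', where b = c]) (rule bij_c, rule that)
  have "\<exists>S\<in>carrier ?G. act S = c e" "\<exists>S\<in>carrier ?G. act S = c e'" by (rule act(2); simp)+
  then obtain g h where g: "g \<in> carrier ?G" "act g = a" and h: "h \<in> carrier ?G" "act h = b"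
    using e(3) by (auto simp: c_def)
  interpret bijection_action ?G act by (rule act(1))
  have ping: "act g ` (- A2) \<subseteq> A1" "act h ` (- B2) \<subseteq> B1" unfolding g(2) h(2) by (rule pp)+
  have nc: "g \<otimes>\<^bsub>?G\<^esub> h \<noteq> h \<otimes>\<^bsub>?G\<^esub> g"
    by (rule ping_pong_not_commutative[OF g(1) h(1) ping pp(3-5) y])
  show "\<not> comm_group ?G"
  proof
    assume "comm_group ?G"
    then interpret comm_group ?G .
    show False using nc m_comm[OF g(1) h(1)] by simp
  qed
  show "\<not> amenable_group ?G" by (rule ping_pong_not_amenable[OF g(1) h(1) ping pp(3-5)])
qed

end

theorem corollary5p2:
  fixes M :: "'a topology"
    and A :: "('a set \<times> ('a \<Rightarrow> real^'n)) set"
    and x0 :: 'a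
  assumes "closed_manifold M A"
    and "connected_space M"
    and "CARD('n) \<ge> 2"
    and "x0 \<in> topspace M"
  shows "(finite (carrier (fundamental_group M x0)) \<longrightarrow>
            (\<forall>f. C1_function A f \<and> isolated_critical_points M A f \<longrightarrow>
               is_tree (reeb_graph M f))) \<and>
         (comm_group (fundamental_group M x0) \<or> amenable_group (fundamental_group M x0) \<longrightarrow>
            (\<forall>f. C1_function A f \<and> isolated_critical_points M A f \<longrightarrow>
               (\<exists>r\<le>1. has_number_of_loops (reeb_graph M f) r)))"
proof -
  let ?G = "fundamental_group M x0"
  have cpt: "compact_space M" and haus: "Hausdorff_space M" and atlas: "C1_atlas M A"
    using assms(1) by (simp_all add: closed_manifold_def)
  have main: "(finite (carrier ?G) \<longrightarrow> is_tree (reeb_graph M f)) \<and>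
      (comm_group ?G \<or> amenable_group ?G \<longrightarrow> (\<exists>r\<le>1. has_number_of_loops (reeb_graph M f) r))"
    if f: "C1_function A f" "isolated_critical_points M A f" for f
  proof -
    let ?R = "reeb_graph M f"
    interpret reeb_critical M f "critical_points A f"
    proof
      show "compact_space M" "Hausdorff_space M" by fact+
      show "continuous_map M euclideanreal f" by (rule continuous_map_C1_function[OF atlas f(1)])
      show "finite (critical_points A f)" by (rule finite_critical_points[OF atlas f(1) cpt f(2)])
      fix x W assume x: "x \<in> topspace M" "x \<notin> critical_points A f" and W: "openin M W" "x \<in> W"
      show "\<exists>B \<epsilon>. openin M B \<and> x \<in> B \<and> B \<subseteq> W \<and> \<epsilon> > 0 \<and>
        (\<forall>t. \<bar>t - f x\<bar> < \<epsilon> \<longrightarrow> connectedin M {z \<in> B. f z = t} \<and> {z \<in> B. f z = t} \<noteq> {})"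
        by (rule manifold_box[OF atlas f(1) x W]) blast
    qed
    have lpc: "locally_path_connected_space M" by (rule locally_path_connected_manifold[OF atlas f(1)])
    have connR: "connected_space ?R"
      using connected_space_quotient_map_image[OF quotient_map_q assms(2)] .
    \<comment> \<open>Besides the image of \<open>x0\<close>, any other point can be made a vertex, and so a base point off all open edges.\<close>
    have cut: "\<exists>V E. q z \<in> V \<and> reeb_graph_cut M f V E x0" if z: "z \<in> topspace M" for z
    proof -
      obtain V E where VE: "q ` {x0, z} \<subseteq> V" "arc_graph ?R V E"
        using reeb_arc_graph[of "{x0, z}"] assms(4) z by auto
      have "reeb_graph_cut M f V E x0"
        by (intro reeb_graph_cut.intro reeb_graph_cut_axioms.intro reeb_setting_axioms VE(2) assms(4) lpc) (use VE(1) in auto)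
      then show ?thesis using VE(1) by auto
    qed
    have fin: "finite_graph ?R"
    proof -
      obtain V E where "reeb_graph_cut M f V E x0" using cut[OF assms(4)] by blast
      then show ?thesis by (rule arc_graph.finite_graph[OF reeb_graph_cut.axioms(2)])
    qed
    have tree: "is_tree ?R" if fin_G: "finite (carrier ?G)"
    proof -
      obtain V E where "reeb_graph_cut M f V E x0" using cut[OF assms(4)] by blast
      then interpret cut: reeb_graph_cut M f V E x0 .
      have "contracts_to ?R (topspace ?R) (q x0)"
      proof (rule cut.bridge_trichotomy[OF connR])
        assume "\<And>w. w \<in> topspace ?R \<Longrightarrow> contracts_to ?R (topspace ?R) w"
        then show ?thesis using assms(4) by (simp add: topspace_reeb)
      qed (use cut.infinite_if_cycle fin_G in blast)+
      then have "homotopic_with (\<lambda>_. True) ?R ?R id (\<lambda>_. q x0)"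
        unfolding contracts_to_def subtopology_topspace by (rule homotopic_with_mono) simp
      then show ?thesis using fin unfolding is_tree_def contractible_space_def by blast
    qed
    have loops: "\<exists>r\<le>1. has_number_of_loops ?R r" if G: "comm_group ?G \<or> amenable_group ?G"
    proof -
      have cases: "(\<forall>w\<in>topspace ?R. contracts_to ?R (topspace ?R) w) \<or> free_group_of_rank (fundamental_group ?R y) 1"
        if y: "y \<in> topspace ?R" for y
      proof -
        obtain z where z: "z \<in> topspace M" "y = q z" using y unfolding topspace_reeb by blast
        obtain V E where VE: "q z \<in> V" "reeb_graph_cut M f V E x0" using cut[OF z(1)] by blast
        interpret cut: reeb_graph_cut M f V E x0 by (rule VE(2))
        show ?thesis
        proof (rule cut.bridge_trichotomy[OF connR])
          assume "\<And>w. w \<in> topspace ?R \<Longrightarrow> contracts_to ?R (topspace ?R) w"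
          then show ?thesis by blast
        next
          fix e assume e: "e \<in> E" and c: "\<And>w. w \<in> topspace ?R - cut.open_arc e \<Longrightarrow> contracts_to ?R (topspace ?R - cut.open_arc e) w"
          have "y \<notin> cut.open_arc e" using cut.interior_V[OF e] VE(1) unfolding z(2) by (metis IntI empty_iff)
          then have y': "y \<in> topspace ?R - cut.open_arc e" using y by (intro DiffI)
          show ?thesis using cut.unicyclic_fundamental_group[OF e y' c[OF y']] by blast
        next
          fix e e' assume "e \<in> E" "e' \<in> E" "e \<noteq> e'" "connectedin ?R (topspace ?R - cut.open_arc e - cut.open_arc e')"
          then show ?thesis using cut.not_amenable_if_two_cycles G by blast
        qed
      qed
      show ?thesis
      proof (cases "\<forall>w\<in>topspace ?R. contracts_to ?R (topspace ?R) w")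
        case True
        have "has_number_of_loops ?R 0"
          unfolding has_number_of_loops_def
        proof (intro conjI ballI fin connR)
          fix y assume y: "y \<in> topspace ?R"
          show "free_group_of_rank (fundamental_group ?R y) 0"
            by (rule trivial_fundamental_group[OF y bspec[OF True y]])
        qed
        then show ?thesis by (intro exI[of _ 0] conjI) simp_all
      next
        case False
        have "has_number_of_loops ?R 1"
          unfolding has_number_of_loops_def
        proof (intro conjI ballI fin connR)
          fix y assume y: "y \<in> topspace ?R"
          show "free_group_of_rank (fundamental_group ?R y) 1"
            using cases[OF y] by (rule disjE) (erule notE[OF False], assumption)
        qed
        then show ?thesis by (intro exI[of _ 1] conjI) simp_all
      qed
    qed
    show ?thesis by (intro conjI impI tree loops)
  qed
  show ?thesis
  proof (intro conjI impI allI)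
    fix f assume G: "finite (carrier ?G)" and f: "C1_function A f \<and> isolated_critical_points M A f"
    show "is_tree (reeb_graph M f)" by (rule mp[OF conjunct1[OF main[OF conjunct1[OF f] conjunct2[OF f]]] G])
  next
    fix f assume G: "comm_group ?G \<or> amenable_group ?G" and f: "C1_function A f \<and> isolated_critical_points M A f"
    show "\<exists>r\<le>1. has_number_of_loops (reeb_graph M f) r"
      by (rule mp[OF conjunct2[OF main[OF conjunct1[OF f] conjunct2[OF f]]] G])
  qed
qed

end
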